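(* Let $(\mathcal{E},\mathcal{F})$ be a strongly local regular symmetric Dirichlet form on $L_2(X,\mu)$, assume $\mu$ is energy dominant for $(\mathcal{E},\mathcal{F})$ and that there exists a point separating coordinate sequence for $(\mathcal{E},\mathcal{F})$ with respect to $\mu$. Define $$d_{\mathbb{D}}(x,y)=\sup\{a(x)-a(y): a\in\mathbb{A}_0,\ \|[\mathbb{D},\pi(a)]\|\le1\}.$$ Then $d_{\mathbb{D}}$ is a metric in the wide sense on $X$ and $d_{\mathbb{D}}\le d_{\Gamma,\mu}$. If $X$ is compact, then $d_{\mathbb{D}}=d_{\Gamma,\mu}$.
   Context: $X$ locally compact separable metric, $\mu$ Radon of full support, $\mathcal{C}=C_c(X)\cap\mathcal{F}$, complexified. Energy measures $\Gamma(f,g)$ by polarization of $\int\varphi\,d\Gamma(f)=\mathcal{E}(\varphi f,f)-\frac12\mathcal{E}(\varphi,f^2)$; energy dominant: $\Gamma(f)\ll\mu$ for all $f\in\mathcal{C}$; $\Gamma(f)$ also denotes $d\Gamma(f)/d\mu$, and $\Gamma(f)\le\mu$ means this density is $\le 1$ a.e. Coordinate sequence w.r.t. $\mu$: $(f_n)\subset\mathcal{C}$ with $\mathcal{E}_1$-dense span in $\mathcal{F}$ and $\Gamma(f_n)\le\mu$; point separating if they separate points. Strongly local: $\mathcal{E}(f,g)=0$ if $f$ is constant near $\operatorname{supp}g$. $\mathcal{F}_{loc}$: functions agreeing on each compact with some element of $\mathcal{F}$; their energy measures defined locally. $d_{\Gamma,\mu}(x,y)=\sup\{f(x)-f(y):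 f\in\mathcal{F}_{loc}\cap C(X),\ \Gamma(f)\le\mu\}$. $\mathbb{A}_0=\{f\in\mathcal{C}:\Gamma(f)\in L_\infty(X,\mu)\}$. $\mathcal{H}$: completion of $\mathcal{C}\otimes\mathcal{B}_b(X)$ modulo null vectors for $\langle a\otimes b,c\otimes d\rangle=\int b\bar d\,d\Gamma(a,c)$ with bimodule actions $c(a\otimes b)=(ac)\otimes b-c\otimes(ab)$, $(a\otimes b)c=a\otimes(bc)$; $\partial a=a\otimes\mathbf1$ closed with domain $\mathcal{F}$; $\partial^*$ adjoint; $\mathbb{H}=L_2(X,\mu)\oplus\mathcal{H}$; $\mathbb{D}(f,\omega)=(\partial^*\omega,\partial f)$ on $\mathcal{F}\oplus\mathrm{dom}\,\partial^*$; $\pi(a)$ is multiplication by $a$ on both components; $[\mathbb{D},\pi(a)]$ is bounded for $a\in\mathbb{A}_0$. A metric in the wide sense satisfies the metric axioms but may take the value $+\infty$. *)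

theory Defs
  imports "HOL-Analysis.Analysis"
begin

text \<open>mu is a Radon measure of full support on the Borel sets of a locally compact
separable metric space (separable metric = metric + second countable).  On such spaces
a Borel measure that is finite on compacts is automatically (inner and outer) regular.\<close>

definition radon_full_support :: "('a::{metric_space,second_countable_topology}) measure \<Rightarrow> bool" where
  "radon_full_support M \<longleftrightarrow>
     sets M = sets borel \<and> space M = UNIV \<and>
     (\<forall>K. compact K \<longrightarrow> emeasure M K < \<infinity>) \<and>
     (\<forall>U. open U \<and> U \<noteq> {} \<longrightarrow> emeasure M U > 0)"

definition L2r :: "'a measure \<Rightarrow> ('a \<Rightarrow> real) \<Rightarrow> bool" where
  "L2r M f \<longleftrightarrow> f \<in> borel_measurable M \<and> integrable M (\<lambda>x. (f x)\<^sup>2)"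

definition L2c :: "'a measure \<Rightarrow> ('a \<Rightarrow> complex) \<Rightarrow> bool" where
  "L2c M f \<longleftrightarrow> f \<in> borel_measurable M \<and> integrable M (\<lambda>x. (cmod (f x))\<^sup>2)"

definition innerL2 :: "'a measure \<Rightarrow> ('a \<Rightarrow> complex) \<Rightarrow> ('a \<Rightarrow> complex) \<Rightarrow> complex" where
  "innerL2 M f g = (\<integral>x. f x * cnj (g x) \<partial>M)"

definition normL2 :: "'a measure \<Rightarrow> ('a \<Rightarrow> complex) \<Rightarrow> real" where
  "normL2 M f = sqrt (\<integral>x. (cmod (f x))\<^sup>2 \<partial>M)"

definition compact_support :: "('a::topological_space \<Rightarrow> 'b::zero) \<Rightarrow> bool" where
  "compact_support f \<longleftrightarrow> compact (closure {x. f x \<noteq> 0})"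

definition esupp :: "'a::topological_space measure \<Rightarrow> ('a \<Rightarrow> real) \<Rightarrow> 'a set" where
  "esupp M f = - \<Union>{U. open U \<and> (AE x in M. x \<in> U \<longrightarrow> f x = 0)}"

definition E1r :: "'a measure \<Rightarrow> (('a\<Rightarrow>real) \<Rightarrow> ('a\<Rightarrow>real) \<Rightarrow> real) \<Rightarrow> ('a \<Rightarrow> real) \<Rightarrow> real" where
  "E1r M E f = sqrt (E f f + (\<integral>x. (f x)\<^sup>2 \<partial>M))"

definition Ccore :: "(('a::topological_space)\<Rightarrow>real) set \<Rightarrow> ('a \<Rightarrow> real) set" where
  "Ccore F = {f \<in> F. continuous_on UNIV f \<and> compact_support f}"

text \<open>A symmetric Dirichlet form on L2(X,mu) (elements of F are representatives; F is
closed under mu-a.e. modification, and E only depends on the classes).\<close>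
definition sym_dirichlet_form ::
  "'a::{metric_space,second_countable_topology} measure \<Rightarrow> (('a\<Rightarrow>real) \<Rightarrow> ('a\<Rightarrow>real) \<Rightarrow> real) \<Rightarrow> ('a\<Rightarrow>real) set \<Rightarrow> bool" where
  "sym_dirichlet_form M E F \<longleftrightarrow>
     (\<forall>f\<in>F. L2r M f) \<and>
     (\<forall>f\<in>F. \<forall>g. g \<in> borel_measurable M \<and> (AE x in M. f x = g x) \<longrightarrow>
         g \<in> F \<and> (\<forall>h\<in>F. E g h = E f h)) \<and>
     (\<lambda>_. 0) \<in> F \<and>
     (\<forall>f\<in>F. \<forall>g\<in>F. (\<lambda>x. f x + g x) \<in> F) \<and>
     (\<forall>f\<in>F. \<forall>c. (\<lambda>x. c * f x) \<in> F) \<and>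
     (\<forall>f\<in>F. \<forall>g\<in>F. E f g = E g f) \<and>
     (\<forall>f\<in>F. \<forall>g\<in>F. \<forall>h\<in>F. E (\<lambda>x. f x + g x) h = E f h + E g h) \<and>
     (\<forall>f\<in>F. \<forall>h\<in>F. \<forall>c. E (\<lambda>x. c * f x) h = c * E f h) \<and>
     (\<forall>f\<in>F. E f f \<ge> 0) \<and>
     \<comment> \<open>dense in L2\<close>
     (\<forall>u. L2r M u \<longrightarrow> (\<forall>e>0. \<exists>v\<in>F. (\<integral>x. (u x - v x)\<^sup>2 \<partial>M) < e)) \<and>
     \<comment> \<open>closed: (F, E_1) is complete\<close>
     (\<forall>u::nat \<Rightarrow> 'a \<Rightarrow> real. (\<forall>n. u n \<in> F) \<and>
         (\<forall>e>0. \<exists>N. \<forall>m\<ge>N. \<forall>n\<ge>N. E1r M E (\<lambda>x. u m x - u n x) < e) \<longrightarrow>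
         (\<exists>v\<in>F. (\<lambda>n. E1r M E (\<lambda>x. u n x - v x)) \<longlonglongrightarrow> 0)) \<and>
     \<comment> \<open>Markov property (unit contraction)\<close>
     (\<forall>u\<in>F. (\<lambda>x. max 0 (min 1 (u x))) \<in> F \<and>
         E (\<lambda>x. max 0 (min 1 (u x))) (\<lambda>x. max 0 (min 1 (u x))) \<le> E u u)"

definition regular_form ::
  "'a::{metric_space,second_countable_topology} measure \<Rightarrow> (('a\<Rightarrow>real) \<Rightarrow> ('a\<Rightarrow>real) \<Rightarrow> real) \<Rightarrow> ('a\<Rightarrow>real) set \<Rightarrow> bool" where
  "regular_form M E F \<longleftrightarrow>
     (\<forall>f\<in>F. \<forall>e>0. \<exists>g\<in>Ccore F. E1r M E (\<lambda>x. f x - g x) < e) \<and>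
     (\<forall>f. continuous_on UNIV f \<and> compact_support f \<longrightarrow>
         (\<forall>e>0. \<exists>g\<in>Ccore F. \<forall>x. \<bar>f x - g x\<bar> < e))"

definition strongly_local ::
  "'a::{metric_space,second_countable_topology} measure \<Rightarrow> (('a\<Rightarrow>real) \<Rightarrow> ('a\<Rightarrow>real) \<Rightarrow> real) \<Rightarrow> ('a\<Rightarrow>real) set \<Rightarrow> bool" where
  "strongly_local M E F \<longleftrightarrow>
     (\<forall>f\<in>F. \<forall>g\<in>F. compact (esupp M f) \<and> compact (esupp M g) \<and>
        (\<exists>U c. open U \<and> esupp M g \<subseteq> U \<and> (AE x in M. x \<in> U \<longrightarrow> f x = c)) \<longrightarrow> E f g = 0)"

text \<open>gamma is the density of Gamma(f) for f in C = C_c \<inter> F.\<close>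
definition dens_C ::
  "'a::{metric_space,second_countable_topology} measure \<Rightarrow> (('a\<Rightarrow>real) \<Rightarrow> ('a\<Rightarrow>real) \<Rightarrow> real) \<Rightarrow> ('a\<Rightarrow>real) set
    \<Rightarrow> ('a \<Rightarrow> real) \<Rightarrow> ('a \<Rightarrow> real) \<Rightarrow> bool" where
  "dens_C M E F f \<gamma> \<longleftrightarrow> \<gamma> \<in> borel_measurable M \<and> (\<forall>x. \<gamma> x \<ge> 0) \<and>
     (\<forall>\<phi>\<in>Ccore F. integrable M (\<lambda>x. \<phi> x * \<gamma> x) \<and>
        (\<integral>x. \<phi> x * \<gamma> x \<partial>M) = E (\<lambda>x. \<phi> x * f x) f - E \<phi> (\<lambda>x. (f x)\<^sup>2) / 2)"

text \<open>Energy dominance: Gamma(f) << mu for every f in C.\<close>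
definition energy_dominant ::
  "'a::{metric_space,second_countable_topology} measure \<Rightarrow> (('a\<Rightarrow>real) \<Rightarrow> ('a\<Rightarrow>real) \<Rightarrow> real) \<Rightarrow> ('a\<Rightarrow>real) set \<Rightarrow> bool" where
  "energy_dominant M E F \<longleftrightarrow> (\<forall>f\<in>Ccore F. \<exists>\<gamma>. dens_C M E F f \<gamma>)"

text \<open>Density of Gamma(f) for general f in F: Gamma(f) is the total variation limit of
Gamma(f_n), f_n in C, f_n \<rightarrow> f in E_1.\<close>
definition dens_F ::
  "'a::{metric_space,second_countable_topology} measure \<Rightarrow> (('a\<Rightarrow>real) \<Rightarrow> ('a\<Rightarrow>real) \<Rightarrow> real) \<Rightarrow> ('a\<Rightarrow>real) set
    \<Rightarrow> ('a \<Rightarrow> real) \<Rightarrow> ('a \<Rightarrow> real) \<Rightarrow> bool" where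
  "dens_F M E F f \<gamma> \<longleftrightarrow> \<gamma> \<in> borel_measurable M \<and> (\<forall>x. \<gamma> x \<ge> 0) \<and> integrable M \<gamma> \<and>
     (\<exists>fs gs. (\<forall>n. fs n \<in> Ccore F \<and> dens_C M E F (fs n) (gs n)) \<and>
        (\<lambda>n. E1r M E (\<lambda>x. fs n x - f x)) \<longlonglongrightarrow> 0 \<and>
        (\<lambda>n. \<integral>x. \<bar>gs n x - \<gamma> x\<bar> \<partial>M) \<longlonglongrightarrow> 0)"

definition gam ::
  "'a::{metric_space,second_countable_topology} measure \<Rightarrow> (('a\<Rightarrow>real) \<Rightarrow> ('a\<Rightarrow>real) \<Rightarrow> real) \<Rightarrow> ('a\<Rightarrow>real) set
    \<Rightarrow> ('a \<Rightarrow> real) \<Rightarrow> 'a \<Rightarrow> real" where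
  "gam M E F f = (SOME \<gamma>. dens_F M E F f \<gamma>)"

definition gam2 ::
  "'a::{metric_space,second_countable_topology} measure \<Rightarrow> (('a\<Rightarrow>real) \<Rightarrow> ('a\<Rightarrow>real) \<Rightarrow> real) \<Rightarrow> ('a\<Rightarrow>real) set
    \<Rightarrow> ('a \<Rightarrow> real) \<Rightarrow> ('a \<Rightarrow> real) \<Rightarrow> 'a \<Rightarrow> real" where
  "gam2 M E F u v x = (gam M E F (\<lambda>y. u y + v y) x - gam M E F (\<lambda>y. u y - v y) x) / 4"

definition Fc :: "('a\<Rightarrow>real) set \<Rightarrow> ('a \<Rightarrow> complex) set" where
  "Fc F = {f. (\<lambda>x. Re (f x)) \<in> F \<and> (\<lambda>x. Im (f x)) \<in> F}"

definition Cc :: "('a::topological_space\<Rightarrow>real) set \<Rightarrow> ('a \<Rightarrow> complex) set" where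
  "Cc F = {f. (\<lambda>x. Re (f x)) \<in> Ccore F \<and> (\<lambda>x. Im (f x)) \<in> Ccore F}"

text \<open>sesquilinear extension (linear in the first, conjugate linear in the second argument)\<close>
definition Ec :: "(('a\<Rightarrow>real) \<Rightarrow> ('a\<Rightarrow>real) \<Rightarrow> real) \<Rightarrow> ('a \<Rightarrow> complex) \<Rightarrow> ('a \<Rightarrow> complex) \<Rightarrow> complex" where
  "Ec E f g = complex_of_real (E (\<lambda>x. Re (f x)) (\<lambda>x. Re (g x)) + E (\<lambda>x. Im (f x)) (\<lambda>x. Im (g x)))
     + \<i> * complex_of_real (E (\<lambda>x. Im (f x)) (\<lambda>x. Re (g x)) - E (\<lambda>x. Re (f x)) (\<lambda>x. Im (g x)))"

definition E1c :: "'a measure \<Rightarrow> (('a\<Rightarrow>real) \<Rightarrow> ('a\<Rightarrow>real) \<Rightarrow> real) \<Rightarrow> ('a \<Rightarrow> complex) \<Rightarrow> real" where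
  "E1c M E f = sqrt (Re (Ec E f f) + (\<integral>x. (cmod (f x))\<^sup>2 \<partial>M))"

definition gamc ::
  "'a::{metric_space,second_countable_topology} measure \<Rightarrow> (('a\<Rightarrow>real) \<Rightarrow> ('a\<Rightarrow>real) \<Rightarrow> real) \<Rightarrow> ('a\<Rightarrow>real) set
    \<Rightarrow> ('a \<Rightarrow> complex) \<Rightarrow> ('a \<Rightarrow> complex) \<Rightarrow> 'a \<Rightarrow> complex" where
  "gamc M E F f g x =
     complex_of_real (gam2 M E F (\<lambda>y. Re (f y)) (\<lambda>y. Re (g y)) x + gam2 M E F (\<lambda>y. Im (f y)) (\<lambda>y. Im (g y)) x)
     + \<i> * complex_of_real (gam2 M E F (\<lambda>y. Im (f y)) (\<lambda>y. Re (g y)) x - gam2 M E F (\<lambda>y. Re (f y)) (\<lambda>y. Im (g y)) x)"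

definition gam_le_mu ::
  "'a::{metric_space,second_countable_topology} measure \<Rightarrow> (('a\<Rightarrow>real) \<Rightarrow> ('a\<Rightarrow>real) \<Rightarrow> real) \<Rightarrow> ('a\<Rightarrow>real) set
    \<Rightarrow> ('a \<Rightarrow> complex) \<Rightarrow> bool" where
  "gam_le_mu M E F f \<longleftrightarrow> (AE x in M. Re (gamc M E F f f x) \<le> 1)"

definition coordinate_sequence ::
  "'a::{metric_space,second_countable_topology} measure \<Rightarrow> (('a\<Rightarrow>real) \<Rightarrow> ('a\<Rightarrow>real) \<Rightarrow> real) \<Rightarrow> ('a\<Rightarrow>real) set
    \<Rightarrow> (nat \<Rightarrow> 'a \<Rightarrow> complex) \<Rightarrow> bool" where
  "coordinate_sequence M E F fs \<longleftrightarrow>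
     (\<forall>n. fs n \<in> Cc F \<and> gam_le_mu M E F (fs n)) \<and>
     (\<forall>f\<in>Fc F. \<forall>e>0. \<exists>N (c::nat \<Rightarrow> complex).
         E1c M E (\<lambda>x. (\<Sum>i<N. c i * fs i x) - f x) < e)"

definition point_separating :: "(nat \<Rightarrow> 'a \<Rightarrow> complex) \<Rightarrow> bool" where
  "point_separating fs \<longleftrightarrow> (\<forall>x y. x \<noteq> y \<longrightarrow> (\<exists>n. fs n x \<noteq> fs n y))"

definition Floc :: "'a::topological_space measure \<Rightarrow> ('a\<Rightarrow>real) set \<Rightarrow> ('a \<Rightarrow> real) \<Rightarrow> bool" where
  "Floc M F f \<longleftrightarrow> (\<forall>K. compact K \<longrightarrow> (\<exists>g\<in>F. AE x in M. x \<in> K \<longrightarrow> f x = g x))"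

definition gam_loc_le_mu ::
  "'a::{metric_space,second_countable_topology} measure \<Rightarrow> (('a\<Rightarrow>real) \<Rightarrow> ('a\<Rightarrow>real) \<Rightarrow> real) \<Rightarrow> ('a\<Rightarrow>real) set
    \<Rightarrow> ('a \<Rightarrow> real) \<Rightarrow> bool" where
  "gam_loc_le_mu M E F f \<longleftrightarrow>
     (\<forall>K g. compact K \<and> g \<in> F \<and> (AE x in M. x \<in> K \<longrightarrow> f x = g x) \<longrightarrow>
        (AE x in M. x \<in> K \<longrightarrow> gam M E F g x \<le> 1))"

definition d_Gamma ::
  "'a::{metric_space,second_countable_topology} measure \<Rightarrow> (('a\<Rightarrow>real) \<Rightarrow> ('a\<Rightarrow>real) \<Rightarrow> real) \<Rightarrow> ('a\<Rightarrow>real) set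
    \<Rightarrow> 'a \<Rightarrow> 'a \<Rightarrow> ereal" where
  "d_Gamma M E F x y = Sup {ereal (f x - f y) | f. continuous_on UNIV f \<and> Floc M F f \<and> gam_loc_le_mu M E F f}"

text \<open>Algebraic tensor product C \<otimes> B_b(X): finite sums of elementary tensors a \<otimes> b,
represented by lists of pairs (a,b).\<close>
definition PS :: "('a::{metric_space,second_countable_topology}\<Rightarrow>real) set \<Rightarrow> (('a \<Rightarrow> complex) \<times> ('a \<Rightarrow> complex)) list set" where
  "PS F = {s. \<forall>(a,b)\<in>set s. a \<in> Cc F \<and> b \<in> borel_measurable borel \<and> bounded (range b)}"

definition preinner ::
  "'a::{metric_space,second_countable_topology} measure \<Rightarrow> (('a\<Rightarrow>real) \<Rightarrow> ('a\<Rightarrow>real) \<Rightarrow> real) \<Rightarrow> ('a\<Rightarrow>real) set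
    \<Rightarrow> (('a \<Rightarrow> complex) \<times> ('a \<Rightarrow> complex)) list \<Rightarrow> (('a \<Rightarrow> complex) \<times> ('a \<Rightarrow> complex)) list \<Rightarrow> complex" where
  "preinner M E F s t =
     (\<Sum>(a,b)\<leftarrow>s. \<Sum>(c,d)\<leftarrow>t. \<integral>x. b x * cnj (d x) * gamc M E F a c x \<partial>M)"

text \<open>H is represented by a real Hilbert space (the realification of the complex Hilbert
space H, whose real inner product is the real part of the complex one) together with a
map iota from C \<otimes> B_b(X) onto a dense subspace which preserves the inner product; this
is exactly the completion modulo null vectors, unique up to unitary equivalence.\<close>
definition hilbert_rep ::
  "'a::{metric_space,second_countable_topology} measure \<Rightarrow> (('a\<Rightarrow>real) \<Rightarrow> ('a\<Rightarrow>real) \<Rightarrow> real) \<Rightarrow> ('a\<Rightarrow>real) set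
    \<Rightarrow> ((('a \<Rightarrow> complex) \<times> ('a \<Rightarrow> complex)) list \<Rightarrow> 'h::{real_inner,complete_space}) \<Rightarrow> bool" where
  "hilbert_rep M E F \<iota> \<longleftrightarrow>
     (\<forall>s\<in>PS F. \<forall>t\<in>PS F. inner (\<iota> s) (\<iota> t) = Re (preinner M E F s t)) \<and>
     (\<forall>s\<in>PS F. \<forall>t\<in>PS F. \<iota> (s @ t) = \<iota> s + \<iota> t) \<and>
     closure (\<iota> ` PS F) = UNIV"

definition rmul :: "(('a \<Rightarrow> complex) \<times> ('a \<Rightarrow> complex)) list \<Rightarrow> ('a \<Rightarrow> complex) \<Rightarrow> (('a \<Rightarrow> complex) \<times> ('a \<Rightarrow> complex)) list" where
  "rmul s c = map (\<lambda>(a,b). (a, \<lambda>x. b x * c x)) s"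

text \<open>multiplication by c on H (continuous extension of the module action)\<close>
definition mulH :: "('a::{metric_space,second_countable_topology}\<Rightarrow>real) set
    \<Rightarrow> ((('a \<Rightarrow> complex) \<times> ('a \<Rightarrow> complex)) list \<Rightarrow> 'h::{real_inner,complete_space})
    \<Rightarrow> ('a \<Rightarrow> complex) \<Rightarrow> 'h \<Rightarrow> 'h" where
  "mulH F \<iota> c \<omega> = (SOME v. \<exists>S. (\<forall>n. S n \<in> PS F) \<and> (\<lambda>n. \<iota> (S n)) \<longlonglongrightarrow> \<omega> \<and>
                                (\<lambda>n. \<iota> (rmul (S n) c)) \<longlonglongrightarrow> v)"

text \<open>the closed derivation \<partial> with domain F: closure of a \<mapsto> a \<otimes> 1 on C\<close>
definition partialH ::
  "'a::{metric_space,second_countable_topology} measure \<Rightarrow> (('a\<Rightarrow>real) \<Rightarrow> ('a\<Rightarrow>real) \<Rightarrow> real) \<Rightarrow> ('a\<Rightarrow>real) set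
    \<Rightarrow> ((('a \<Rightarrow> complex) \<times> ('a \<Rightarrow> complex)) list \<Rightarrow> 'h::{real_inner,complete_space})
    \<Rightarrow> ('a \<Rightarrow> complex) \<Rightarrow> 'h" where
  "partialH M E F \<iota> f = (SOME v. \<exists>fs. (\<forall>n. fs n \<in> Cc F) \<and>
       (\<lambda>n. E1c M E (\<lambda>x. fs n x - f x)) \<longlonglongrightarrow> 0 \<and> (\<lambda>n. \<iota> [(fs n, \<lambda>_. 1)]) \<longlonglongrightarrow> v)"

text \<open>omega \<in> dom \<partial>* and \<partial>* omega = g.  (Real parts suffice since F is a complex
subspace and \<partial> is complex linear.)\<close>
definition adjoint_rel ::
  "'a::{metric_space,second_countable_topology} measure \<Rightarrow> (('a\<Rightarrow>real) \<Rightarrow> ('a\<Rightarrow>real) \<Rightarrow> real) \<Rightarrow> ('a\<Rightarrow>real) set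
    \<Rightarrow> ((('a \<Rightarrow> complex) \<times> ('a \<Rightarrow> complex)) list \<Rightarrow> 'h::{real_inner,complete_space})
    \<Rightarrow> 'h \<Rightarrow> ('a \<Rightarrow> complex) \<Rightarrow> bool" where
  "adjoint_rel M E F \<iota> \<omega> g \<longleftrightarrow> L2c M g \<and>
     (\<forall>f\<in>Fc F. inner (partialH M E F \<iota> f) \<omega> = Re (innerL2 M f g))"

text \<open>\<parallel>[D, \<pi>(a)]\<parallel> \<le> 1, where D(f,\<omega>) = (\<partial>*\<omega>, \<partial>f) on F \<oplus> dom \<partial>*, \<pi>(a)(f,\<omega>) = (af, a\<omega>),
and the commutator [D,\<pi>(a)] = D\<pi>(a) - \<pi>(a)D lives on {v \<in> dom D. \<pi>(a) v \<in> dom D}; the norm on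
H_D = L2 \<oplus> H is the Hilbert sum norm.\<close>
definition comm_norm_le1 ::
  "'a::{metric_space,second_countable_topology} measure \<Rightarrow> (('a\<Rightarrow>real) \<Rightarrow> ('a\<Rightarrow>real) \<Rightarrow> real) \<Rightarrow> ('a\<Rightarrow>real) set
    \<Rightarrow> ((('a \<Rightarrow> complex) \<times> ('a \<Rightarrow> complex)) list \<Rightarrow> 'h::{real_inner,complete_space})
    \<Rightarrow> ('a \<Rightarrow> complex) \<Rightarrow> bool" where
  "comm_norm_le1 M E F \<iota> a \<longleftrightarrow>
     (\<forall>f \<omega> g1 g2. f \<in> Fc F \<and> (\<lambda>x. a x * f x) \<in> Fc F \<and>
        adjoint_rel M E F \<iota> \<omega> g1 \<and> adjoint_rel M E F \<iota> (mulH F \<iota> a \<omega>) g2 \<longrightarrow>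
        (normL2 M (\<lambda>x. g2 x - a x * g1 x))\<^sup>2
          + (norm (partialH M E F \<iota> (\<lambda>x. a x * f x) - mulH F \<iota> a (partialH M E F \<iota> f)))\<^sup>2
        \<le> (normL2 M f)\<^sup>2 + (norm \<omega>)\<^sup>2)"

definition A0 ::
  "'a::{metric_space,second_countable_topology} measure \<Rightarrow> (('a\<Rightarrow>real) \<Rightarrow> ('a\<Rightarrow>real) \<Rightarrow> real) \<Rightarrow> ('a\<Rightarrow>real) set
    \<Rightarrow> ('a \<Rightarrow> complex) set" where
  "A0 M E F = {a \<in> Cc F. \<exists>C. AE x in M. cmod (gamc M E F a a x) \<le> C}"

definition d_D ::
  "'a::{metric_space,second_countable_topology} measure \<Rightarrow> (('a\<Rightarrow>real) \<Rightarrow> ('a\<Rightarrow>real) \<Rightarrow> real) \<Rightarrow> ('a\<Rightarrow>real) set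
    \<Rightarrow> ((('a \<Rightarrow> complex) \<times> ('a \<Rightarrow> complex)) list \<Rightarrow> 'h::{real_inner,complete_space})
    \<Rightarrow> 'a \<Rightarrow> 'a \<Rightarrow> ereal" where
  "d_D M E F \<iota> x y = Sup {ereal (a x - a y) | a.
       (\<lambda>z. complex_of_real (a z)) \<in> A0 M E F \<and> comm_norm_le1 M E F \<iota> (\<lambda>z. complex_of_real (a z))}"

definition wide_metric :: "('a \<Rightarrow> 'a \<Rightarrow> ereal) \<Rightarrow> bool" where
  "wide_metric d \<longleftrightarrow>
     (\<forall>x y. d x y \<ge> 0) \<and> (\<forall>x y. d x y = 0 \<longleftrightarrow> x = y) \<and> (\<forall>x y. d x y = d y x) \<and>
     (\<forall>x y z. d x z \<le> d x y + d y z)"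

end

theory Submission
  imports Defs
begin

text \<open>
  For a real function \<open>a\<close> of the core, the Leibniz rule gives \<open>\<partial>(a f) - a \<partial>f = f \<partial>a\<close>, an element of norm
  \<open>(\<integral> |f|\<^sup>2 d\<Gamma>(a))\<^sup>1\<^sup>/\<^sup>2\<close>; together with the dual estimate for \<open>\<partial>\<^sup>*\<close> this shows that
  \<open>\<parallel>[D, \<pi>(a)]\<parallel> \<le> 1\<close> if and only if \<open>\<Gamma>(a) \<le> \<mu>\<close>. Hence the first distance is the supremum of
  \<open>a x - a y\<close> over core functions with \<open>\<Gamma>(a) \<le> \<mu>\<close>. To compare it with the intrinsic distance one needs
  that \<open>\<Gamma>\<close> is local on arbitrary compact sets, which follows from \<open>\<Gamma>(u) = 0\<close> almost everywhere on
  \<open>{u = 0}\<close>.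

  The Leibniz rule is derived from the unit contraction property and strong locality alone. The slices
  \<open>min f t - min f s\<close> of a nonnegative core function over disjoint level intervals are orthogonal for the
  form, so that \<open>f\<^sup>2\<close> and \<open>f\<^sup>3\<close> belong to the domain and \<open>3 E(f\<^sup>2, f\<^sup>2) = 4 E(f, f\<^sup>3)\<close>. This identity says
  that the Leibniz defect, a symmetric quadrilinear form, vanishes on the diagonal of the positive cone,
  and polarization makes it vanish identically.
\<close>

section \<open>Quadratic forms\<close>

text \<open>The densities \<open>gam\<close> are chosen function by function, so identities between
  them hold only almost everywhere. They are obtained by integrating against core functions and
  comparing expressions in \<open>E\<close>; this is why one identity for \<open>E\<close> itself,
  the vanishing of the defect, carries the whole calculus. Products of core functions are not known
  to lie in the domain at the outset, so the chain rule for squares and cubes has to come before the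
  defect can even be written down; it needs truncation at levels, hence the positive cone.

  Locality is delicate because the local condition compares f with elements of F on a compact set
  that may have empty interior, where strong locality is silent. As the Leibniz rule yields chain
  rules for polynomials only, values near 0 are isolated not by a smooth cut-off but by t (1 - t^2 /
  R^2)^n, whose derivative stays near 1 at small values and fades elsewhere. A general element of F
  is reached only through core approximants, so the exponent n has to be tied to the speed of the
  approximation.\<close>

lemma nonneg_quadratic_imp_discriminant:
  fixes a b c :: real
  assumes "\<And>t. 0 \<le> a + 2 * t * b + t\<^sup>2 * c" and "c \<ge> 0"
  shows "b\<^sup>2 \<le> a * c"
proof (cases "c = 0")
  case True
  have "b = 0"
  proof (rule ccontr)
    assume "b \<noteq> 0"
    \<comment> \<open>At this point a + 2 t b = a - (a + 1) = -1.\<close>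
    then show False
      using assms(1)[of "- (a + 1) / (2 * b)"] True by (simp add: field_simps)
  qed
  then show ?thesis using True by simp
next
  case False
  then have "c > 0" using assms(2) by simp
  then show ?thesis
    using assms(1)[of "- b / c"] by (simp add: field_simps power2_eq_square)
qed

text \<open>Turns a Cauchy-Schwarz inequality with one fixed factor into a limit; with
  \<open>b = 1\<close> it merely removes a square.\<close>

lemma tendsto_zero_of_square_le_mult:
  fixes x a :: "nat \<Rightarrow> real"
  assumes "\<And>n. (x n)\<^sup>2 \<le> a n * b" and "a \<longlonglongrightarrow> 0"
  shows "x \<longlonglongrightarrow> 0"
proof -
  have "(\<lambda>n. a n * b) \<longlonglongrightarrow> 0"
    using tendsto_mult_right[OF assms(2), of b] by simp
  then have "(\<lambda>n. (x n)\<^sup>2) \<longlonglongrightarrow> 0"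
    by (rule tendsto_sandwich[OF _ _ tendsto_const, rotated 2]) (auto simp: assms(1))
  then have "(\<lambda>n. sqrt ((x n)\<^sup>2)) \<longlonglongrightarrow> sqrt 0" by (rule tendsto_real_sqrt)
  then show ?thesis by (simp add: tendsto_rabs_zero_iff)
qed

section \<open>Square-integrable functions\<close>

lemma square_sum_le: "(a + b)\<^sup>2 \<le> 2 * a\<^sup>2 + 2 * (b::real)\<^sup>2"
  using zero_le_power2[of "a - b"] by (simp add: power2_eq_square algebra_simps)

lemma L2r_add:
  assumes "L2r M f" "L2r M g"
  shows "L2r M (\<lambda>x. f x + g x)"
proof -
  have [measurable]: "f \<in> borel_measurable M" "g \<in> borel_measurable M"
    using assms by (auto simp: L2r_def)
  have "integrable M (\<lambda>x. (f x + g x)\<^sup>2)"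
    by (rule Bochner_Integration.integrable_bound[of _ "\<lambda>x. 2 * (f x)\<^sup>2 + 2 * (g x)\<^sup>2"])
       (use assms square_sum_le in \<open>auto simp: L2r_def\<close>)
  then show ?thesis by (simp add: L2r_def)
qed

lemma L2r_scale: "L2r M f \<Longrightarrow> L2r M (\<lambda>x. c * f x)"
  by (auto simp: L2r_def power_mult_distrib)

lemma L2r_diff:
  assumes "L2r M f" "L2r M g"
  shows "L2r M (\<lambda>x. f x - g x)"
  using L2r_add[OF assms(1) L2r_scale[OF assms(2), of "-1"]] by simp

lemma L2r_mult_integrable:
  assumes "L2r M f" "L2r M g"
  shows "integrable M (\<lambda>x. f x * g x)"
proof -
  have [measurable]: "f \<in> borel_measurable M" "g \<in> borel_measurable M"
    using assms by (auto simp: L2r_def)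
  have bd: "\<bar>a * b\<bar> \<le> a\<^sup>2 + b\<^sup>2" for a b :: real
    using zero_le_power2[of "\<bar>a\<bar> - \<bar>b\<bar>"] zero_le_power2[of a] zero_le_power2[of b]
      mult_nonneg_nonneg[of "\<bar>a\<bar>" "\<bar>b\<bar>"]
    by (simp add: power2_eq_square algebra_simps abs_mult del: mult_nonneg_nonneg)
  show ?thesis
    by (rule Bochner_Integration.integrable_bound[of _ "\<lambda>x. (f x)\<^sup>2 + (g x)\<^sup>2"])
       (use assms bd in \<open>simp_all add: L2r_def\<close>)
qed

lemma L2r_integral_add_le:
  assumes "L2r M f" "L2r M g"
  shows "(\<integral>x. (f x + g x)\<^sup>2 \<partial>M) \<le> 2 * (\<integral>x. (f x)\<^sup>2 \<partial>M) + 2 * (\<integral>x. (g x)\<^sup>2 \<partial>M)"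
proof -
  have "(\<integral>x. (f x + g x)\<^sup>2 \<partial>M) \<le> (\<integral>x. 2 * (f x)\<^sup>2 + 2 * (g x)\<^sup>2 \<partial>M)"
    by (rule integral_mono) (use L2r_add[OF assms] assms square_sum_le in \<open>auto simp: L2r_def\<close>)
  also have "\<dots> = 2 * (\<integral>x. (f x)\<^sup>2 \<partial>M) + 2 * (\<integral>x. (g x)\<^sup>2 \<partial>M)"
    using assms by (subst Bochner_Integration.integral_add) (auto simp: L2r_def)
  finally show ?thesis .
qed

lemma L2r_integral_diff_le:
  assumes "L2r M f" "L2r M g" "L2r M h"
  shows "(\<integral>x. (f x - g x)\<^sup>2 \<partial>M) \<le> 2 * (\<integral>x. (f x - h x)\<^sup>2 \<partial>M) + 2 * (\<integral>x. (g x - h x)\<^sup>2 \<partial>M)"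
proof -
  have "(\<integral>x. (f x - g x)\<^sup>2 \<partial>M) = (\<integral>x. ((f x - h x) + (h x - g x))\<^sup>2 \<partial>M)" by simp
  also have "\<dots> \<le> 2 * (\<integral>x. (f x - h x)\<^sup>2 \<partial>M) + 2 * (\<integral>x. (h x - g x)\<^sup>2 \<partial>M)"
    by (intro L2r_integral_add_le L2r_diff assms)
  finally show ?thesis by (simp add: power2_commute)
qed

lemma L2r_AE_eq_of_integral_zero:
  assumes "L2r M f" "L2r M g" "(\<integral>x. (f x - g x)\<^sup>2 \<partial>M) = 0"
  shows "AE x in M. f x = g x"
  using integral_nonneg_eq_0_iff_AE[of M "\<lambda>x. (f x - g x)\<^sup>2"] L2r_diff[OF assms(1,2)] assms(3)
  by (auto simp: L2r_def)

lemma L2r_CS: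
  assumes "L2r M f" "L2r M g"
  shows "(\<integral>x. f x * g x \<partial>M)\<^sup>2 \<le> (\<integral>x. (f x)\<^sup>2 \<partial>M) * (\<integral>x. (g x)\<^sup>2 \<partial>M)"
proof (rule nonneg_quadratic_imp_discriminant)
  fix t :: real
  have i: "integrable M (\<lambda>x. (f x)\<^sup>2)" "integrable M (\<lambda>x. (g x)\<^sup>2)" "integrable M (\<lambda>x. f x * g x)"
    using assms L2r_mult_integrable[OF assms] by (auto simp: L2r_def)
  have "0 \<le> (\<integral>x. (f x + t * g x)\<^sup>2 \<partial>M)" by simp
  also have "(\<lambda>x. (f x + t * g x)\<^sup>2) = (\<lambda>x. (f x)\<^sup>2 + 2 * t * (f x * g x) + t\<^sup>2 * (g x)\<^sup>2)"
    by (auto simp: power2_eq_square algebra_simps)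
  also have "(\<integral>x. (f x)\<^sup>2 + 2 * t * (f x * g x) + t\<^sup>2 * (g x)\<^sup>2 \<partial>M)
      = (\<integral>x. (f x)\<^sup>2 \<partial>M) + 2 * t * (\<integral>x. f x * g x \<partial>M) + t\<^sup>2 * (\<integral>x. (g x)\<^sup>2 \<partial>M)"
    using i by simp
  finally show "0 \<le> (\<integral>x. (f x)\<^sup>2 \<partial>M) + 2 * t * (\<integral>x. f x * g x \<partial>M) + t\<^sup>2 * (\<integral>x. (g x)\<^sup>2 \<partial>M)" .
qed simp

lemma L2r_inner_tendsto:
  assumes u: "\<And>n. L2r M (u n)" "L2r M v" and w: "L2r M w"
    and lim: "(\<lambda>n. \<integral>x. (u n x - v x)\<^sup>2 \<partial>M) \<longlonglongrightarrow> 0"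
  shows "(\<lambda>n. \<integral>x. u n x * w x \<partial>M) \<longlonglongrightarrow> (\<integral>x. v x * w x \<partial>M)"
proof -
  have "(\<lambda>n. \<integral>x. (u n x - v x) * w x \<partial>M) \<longlonglongrightarrow> 0"
    by (rule tendsto_zero_of_square_le_mult[OF L2r_CS lim]) (intro L2r_diff u w)+
  moreover have "(\<integral>x. (u n x - v x) * w x \<partial>M) = (\<integral>x. u n x * w x \<partial>M) - (\<integral>x. v x * w x \<partial>M)" for n
    using L2r_mult_integrable[OF u(1) w] L2r_mult_integrable[OF u(2) w] by (simp add: left_diff_distrib)
  ultimately show ?thesis by (simp add: LIM_zero_iff)
qed

text \<open>By u^2 = (u - v)^2 + 2 u v - v^2 the convergence of norms reduces to that of inner
  products with the fixed function \<open>v\<close>.\<close>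

lemma L2r_square_tendsto:
  assumes u: "\<And>n. L2r M (u n)" "L2r M v" and lim: "(\<lambda>n. \<integral>x. (u n x - v x)\<^sup>2 \<partial>M) \<longlonglongrightarrow> 0"
  shows "(\<lambda>n. \<integral>x. (u n x)\<^sup>2 \<partial>M) \<longlonglongrightarrow> (\<integral>x. (v x)\<^sup>2 \<partial>M)"
proof -
  have eq: "(\<integral>x. (u n x)\<^sup>2 \<partial>M) = (\<integral>x. (u n x - v x)\<^sup>2 \<partial>M) + 2 * (\<integral>x. u n x * v x \<partial>M) - (\<integral>x. v x * v x \<partial>M)" for n
  proof -
    have "integrable M (\<lambda>x. (u n x - v x)\<^sup>2)" "integrable M (\<lambda>x. u n x * v x)" "integrable M (\<lambda>x. v x * v x)"
      using L2r_diff[OF u(1)[of n] u(2)] L2r_mult_integrable[OF u(1)[of n] u(2)] L2r_mult_integrable[OF u(2) u(2)]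
      by (auto simp: L2r_def)
    then have "(\<integral>x. (u n x - v x)\<^sup>2 \<partial>M) + 2 * (\<integral>x. u n x * v x \<partial>M) - (\<integral>x. v x * v x \<partial>M)
        = (\<integral>x. (u n x - v x)\<^sup>2 + 2 * (u n x * v x) - v x * v x \<partial>M)" by simp
    also have "\<dots> = (\<integral>x. (u n x)\<^sup>2 \<partial>M)"
      by (rule Bochner_Integration.integral_cong) (auto simp: power2_eq_square algebra_simps)
    finally show ?thesis by simp
  qed
  have "(\<lambda>n. (\<integral>x. (u n x - v x)\<^sup>2 \<partial>M) + 2 * (\<integral>x. u n x * v x \<partial>M) - (\<integral>x. v x * v x \<partial>M))
      \<longlonglongrightarrow> 0 + 2 * (\<integral>x. v x * v x \<partial>M) - (\<integral>x. v x * v x \<partial>M)"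
    by (intro tendsto_intros lim L2r_inner_tendsto[OF u u(2) lim])
  then show ?thesis unfolding eq by (simp add: power2_eq_square)
qed

lemma L2r_bounded_mult:
  assumes "L2r M f" "a \<in> borel_measurable M" "\<And>x. \<bar>a x\<bar> \<le> R"
  shows "L2r M (\<lambda>x. a x * f x)"
    and "(\<integral>x. (a x * f x)\<^sup>2 \<partial>M) \<le> R\<^sup>2 * (\<integral>x. (f x)\<^sup>2 \<partial>M)"
proof -
  have [measurable]: "f \<in> borel_measurable M" "a \<in> borel_measurable M" using assms by (auto simp: L2r_def)
  have f2: "integrable M (\<lambda>x. R\<^sup>2 * (f x)\<^sup>2)" using assms by (auto simp: L2r_def)
  have b: "(a x * f x)\<^sup>2 \<le> R\<^sup>2 * (f x)\<^sup>2" for x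
    unfolding power_mult_distrib using power_mono[OF assms(3)[of x] abs_ge_zero, of 2]
    by (intro mult_right_mono) auto
  have i: "integrable M (\<lambda>x. (a x * f x)\<^sup>2)"
    by (rule Bochner_Integration.integrable_bound[OF f2]) (use b in auto)
  then show "L2r M (\<lambda>x. a x * f x)" by (simp add: L2r_def)
  show "(\<integral>x. (a x * f x)\<^sup>2 \<partial>M) \<le> R\<^sup>2 * (\<integral>x. (f x)\<^sup>2 \<partial>M)"
    using integral_mono[OF i f2 b] by simp
qed

lemma L2c_parts:
  assumes "L2c M f"
  shows "L2r M (\<lambda>x. Re (f x))" "L2r M (\<lambda>x. Im (f x))"
proof -
  have [measurable]: "f \<in> borel_measurable M" and i: "integrable M (\<lambda>x. (cmod (f x))\<^sup>2)"
    using assms by (auto simp: L2c_def)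
  show "L2r M (\<lambda>x. Re (f x))" "L2r M (\<lambda>x. Im (f x))"
    unfolding L2r_def by (auto intro!: Bochner_Integration.integrable_bound[OF i] AE_I2 simp: cmod_power2)
qed

lemma normL2_sq:
  assumes "L2r M (\<lambda>x. Re (f x))" "L2r M (\<lambda>x. Im (f x))"
  shows "(normL2 M f)\<^sup>2 = (\<integral>x. (Re (f x))\<^sup>2 \<partial>M) + (\<integral>x. (Im (f x))\<^sup>2 \<partial>M)"
  using assms by (simp add: normL2_def cmod_power2 L2r_def)

lemma normL2_nonneg: "normL2 M f \<ge> 0"
  by (simp add: normL2_def)

text \<open>The form lives on real functions, so complex estimates are made on real and imaginary
  parts; \<open>adjoint_rel\<close> involves the real part of the inner product alone.\<close>

lemma Re_innerL2:
  assumes "L2r M (\<lambda>x. Re (f x))" "L2r M (\<lambda>x. Im (f x))" "L2r M (\<lambda>x. Re (g x))" "L2r M (\<lambda>x. Im (g x))"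
  shows "Re (innerL2 M f g) = (\<integral>x. Re (f x) * Re (g x) \<partial>M) + (\<integral>x. Im (f x) * Im (g x) \<partial>M)"
proof -
  note i = L2r_mult_integrable[OF assms(1,3)] L2r_mult_integrable[OF assms(2,4)]
    L2r_mult_integrable[OF assms(2,3)] L2r_mult_integrable[OF assms(1,4)]
  have "integrable M (\<lambda>x. complex_of_real (Re (f x) * Re (g x) + Im (f x) * Im (g x))
      + \<i> * complex_of_real (Im (f x) * Re (g x) - Re (f x) * Im (g x)))"
    using i by (intro Bochner_Integration.integrable_add integrable_mult_right integrable_of_real Bochner_Integration.integrable_diff)
  also have "(\<lambda>x. complex_of_real (Re (f x) * Re (g x) + Im (f x) * Im (g x))
      + \<i> * complex_of_real (Im (f x) * Re (g x) - Re (f x) * Im (g x))) = (\<lambda>x. f x * cnj (g x))"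
    by (auto simp: complex_eq_iff)
  finally have "integrable M (\<lambda>x. f x * cnj (g x))" .
  then show ?thesis unfolding innerL2_def using i by (simp add: integral_Re[symmetric])
qed

section \<open>Strongly local Dirichlet forms\<close>

lemma compact_support_mono:
  assumes "compact_support f" "\<And>x. g x \<noteq> 0 \<Longrightarrow> f x \<noteq> 0"
  shows "compact_support g"
proof -
  have "closure {x. g x \<noteq> 0} \<subseteq> closure {x. f x \<noteq> 0}"
    by (rule closure_mono) (use assms(2) in auto)
  then show ?thesis
    using assms(1) unfolding compact_support_def
    by (metis closed_closure compact_Int_closed inf.absorb_iff2)
qed

lemma compact_support_Un:
  assumes "compact_support f" "compact_support g" "\<And>x. h x \<noteq> 0 \<Longrightarrow> f x \<noteq> 0 \<or> g x \<noteq> 0"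
  shows "compact_support h"
proof -
  have "closure {x. h x \<noteq> 0} \<subseteq> closure ({x. f x \<noteq> 0} \<union> {x. g x \<noteq> 0})"
    by (rule closure_mono) (use assms(3) in auto)
  moreover have "compact (closure ({x. f x \<noteq> 0} \<union> {x. g x \<noteq> 0}))"
    using assms(1,2) by (simp add: compact_support_def closure_Un compact_Un)
  ultimately show ?thesis
    unfolding compact_support_def by (metis closed_closure compact_Int_closed inf.absorb_iff2)
qed

text \<open>The core is described by topological supports, strong locality by supports modulo null
  sets; this passes from one to the other.\<close>

lemma compact_esupp:
  assumes "compact_support f"
  shows "compact (esupp M f)" "esupp M f \<subseteq> closure {x. f x \<noteq> 0}"
proof -
  show sub: "esupp M f \<subseteq> closure {x. f x \<noteq> 0}"
  proof -
    have "- closure {x. f x \<noteq> 0} \<subseteq> \<Union>{U. open U \<and> (AE x in M. x \<in> U \<longrightarrow> f x = 0)}"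
      using closure_subset[of "{x. f x \<noteq> 0}"] by (intro Union_upper) (auto intro!: AE_I2)
    then show ?thesis unfolding esupp_def by blast
  qed
  have "closed (esupp M f)" unfolding esupp_def by (auto intro!: open_Union)
  then show "compact (esupp M f)"
    using sub assms unfolding compact_support_def by (metis compact_Int_closed inf.absorb_iff2)
qed

section \<open>The form as a closed bilinear form\<close>

locale local_dirichlet =
  fixes M :: "'a::{metric_space,second_countable_topology} measure"
    and E :: "('a \<Rightarrow> real) \<Rightarrow> ('a \<Rightarrow> real) \<Rightarrow> real"
    and F :: "('a \<Rightarrow> real) set"
  assumes lc: "locally_compact_space (euclidean :: 'a topology)"
    and radon: "radon_full_support M"
    and form: "sym_dirichlet_form M E F"
    and regular: "regular_form M E F"
    and sloc: "strongly_local M E F"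
    and edom: "energy_dominant M E F"
begin

lemma sets_M [measurable_cong]: "sets M = sets borel"
  and space_M [simp]: "space M = UNIV"
  and finite_compact: "compact K \<Longrightarrow> emeasure M K < \<infinity>"
  using radon by (auto simp: radon_full_support_def)

lemma F_L2: "f \<in> F \<Longrightarrow> L2r M f"
  using form by (simp add: sym_dirichlet_form_def)

lemma F_meas: "f \<in> F \<Longrightarrow> f \<in> borel_measurable M"
  using F_L2 by (auto simp: L2r_def)

lemma
  assumes "f \<in> F" "g \<in> borel_measurable M" "AE x in M. f x = g x"
  shows F_cong_AE: "g \<in> F" and E_cong_AE: "h \<in> F \<Longrightarrow> E g h = E f h"
proof -
  have "\<forall>f\<in>F. \<forall>g. g \<in> borel_measurable M \<and> (AE x in M. f x = g x) \<longrightarrow>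
         g \<in> F \<and> (\<forall>h\<in>F. E g h = E f h)"
    using form by (simp add: sym_dirichlet_form_def)
  then show "g \<in> F" "h \<in> F \<Longrightarrow> E g h = E f h" using assms by blast+
qed

lemma F_zero [simp]: "(\<lambda>_. 0) \<in> F"
  using form by (simp add: sym_dirichlet_form_def)

lemma F_add: "f \<in> F \<Longrightarrow> g \<in> F \<Longrightarrow> (\<lambda>x. f x + g x) \<in> F"
  using form by (simp add: sym_dirichlet_form_def)

lemma F_scale: "f \<in> F \<Longrightarrow> (\<lambda>x. c * f x) \<in> F"
  using form by (simp add: sym_dirichlet_form_def)

lemma E_sym: "f \<in> F \<Longrightarrow> g \<in> F \<Longrightarrow> E f g = E g f"
  using form by (simp add: sym_dirichlet_form_def)

lemma E_add: "f \<in> F \<Longrightarrow> g \<in> F \<Longrightarrow> h \<in> F \<Longrightarrow> E (\<lambda>x. f x + g x) h = E f h + E g h"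
proof -
  have "\<forall>f\<in>F. \<forall>g\<in>F. \<forall>h\<in>F. E (\<lambda>x. f x + g x) h = E f h + E g h"
    using form unfolding sym_dirichlet_form_def by (elim conjE) assumption
  then show "f \<in> F \<Longrightarrow> g \<in> F \<Longrightarrow> h \<in> F \<Longrightarrow> E (\<lambda>x. f x + g x) h = E f h + E g h" by blast
qed

lemma E_scale: "f \<in> F \<Longrightarrow> h \<in> F \<Longrightarrow> E (\<lambda>x. c * f x) h = c * E f h"
proof -
  have "\<forall>f\<in>F. \<forall>h\<in>F. \<forall>c. E (\<lambda>x. c * f x) h = c * E f h"
    using form unfolding sym_dirichlet_form_def by (elim conjE) assumption
  then show "f \<in> F \<Longrightarrow> h \<in> F \<Longrightarrow> E (\<lambda>x. c * f x) h = c * E f h" by blast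
qed

lemma E_nonneg: "f \<in> F \<Longrightarrow> E f f \<ge> 0"
  using form by (simp add: sym_dirichlet_form_def)

lemma unit_contraction:
  assumes "u \<in> F"
  shows "(\<lambda>x. max 0 (min 1 (u x))) \<in> F"
    and "E (\<lambda>x. max 0 (min 1 (u x))) (\<lambda>x. max 0 (min 1 (u x))) \<le> E u u"
  using form assms by (simp_all add: sym_dirichlet_form_def)

lemma F_minus: "f \<in> F \<Longrightarrow> (\<lambda>x. - f x) \<in> F"
  using F_scale[of f "-1"] by simp

lemma F_diff: "f \<in> F \<Longrightarrow> g \<in> F \<Longrightarrow> (\<lambda>x. f x - g x) \<in> F"
  using F_add[of f "\<lambda>x. - g x"] F_minus[of g] by simp

lemma F_sum: "(\<And>i. i \<in> I \<Longrightarrow> f i \<in> F) \<Longrightarrow> (\<lambda>x. \<Sum>i\<in>I. f i x) \<in> F"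
  by (induction I rule: infinite_finite_induct) (auto intro: F_add)

lemma E_minus: "f \<in> F \<Longrightarrow> h \<in> F \<Longrightarrow> E (\<lambda>x. - f x) h = - E f h"
  using E_scale[of f h "-1"] by simp

lemma E_diff: "f \<in> F \<Longrightarrow> g \<in> F \<Longrightarrow> h \<in> F \<Longrightarrow> E (\<lambda>x. f x - g x) h = E f h - E g h"
  using E_add[of f "\<lambda>x. - g x" h] F_minus[of g] E_minus[of g h] by simp

lemma E_zero [simp]: "h \<in> F \<Longrightarrow> E (\<lambda>_. 0) h = 0"
  using E_scale[of h h 0] by simp

lemma E_add_right: "f \<in> F \<Longrightarrow> g \<in> F \<Longrightarrow> h \<in> F \<Longrightarrow> E h (\<lambda>x. f x + g x) = E h f + E h g"
  by (simp add: E_sym[of h] E_add F_add)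

lemma E_scale_right: "f \<in> F \<Longrightarrow> h \<in> F \<Longrightarrow> E h (\<lambda>x. c * f x) = c * E h f"
  by (simp add: E_sym[of h] E_scale F_scale)

lemma E_minus_right: "f \<in> F \<Longrightarrow> h \<in> F \<Longrightarrow> E h (\<lambda>x. - f x) = - E h f"
  by (simp add: E_sym[of h] E_minus F_minus)

lemma E_diff_right: "f \<in> F \<Longrightarrow> g \<in> F \<Longrightarrow> h \<in> F \<Longrightarrow> E h (\<lambda>x. f x - g x) = E h f - E h g"
  by (simp add: E_sym[of h] E_diff F_diff)

lemma E_zero_right [simp]: "h \<in> F \<Longrightarrow> E h (\<lambda>_. 0) = 0"
  by (simp add: E_sym[of h])

lemma E_sum: "(\<And>i. i \<in> I \<Longrightarrow> f i \<in> F) \<Longrightarrow> h \<in> F \<Longrightarrow> E (\<lambda>x. \<Sum>i\<in>I. f i x) h = (\<Sum>i\<in>I. E (f i) h)"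
  by (induction I rule: infinite_finite_induct) (auto simp: E_add F_sum)

lemma E_sum_right: "(\<And>i. i \<in> I \<Longrightarrow> f i \<in> F) \<Longrightarrow> h \<in> F \<Longrightarrow> E h (\<lambda>x. \<Sum>i\<in>I. f i x) = (\<Sum>i\<in>I. E h (f i))"
  by (induction I rule: infinite_finite_induct) (auto simp: E_add_right F_sum)

lemmas E_bilinear = E_add E_add_right E_scale E_scale_right E_diff E_diff_right E_minus E_minus_right
lemmas F_closed = F_add F_scale F_diff F_minus

abbreviation energy (\<open>\<E>\<close>) where "\<E> f \<equiv> E f f"

lemma E_cong_AE2:
  assumes "f \<in> F" "g \<in> borel_measurable M" "AE x in M. f x = g x"
  shows "E g g = E f f"
  using F_cong_AE[OF assms] E_cong_AE[OF assms] assms(1) E_sym by metis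

lemma E_quadratic:
  assumes "f \<in> F" "g \<in> F"
  shows "\<E> (\<lambda>x. f x + t * g x) = E f f + 2 * t * E f g + t\<^sup>2 * E g g"
  using assms E_sym[OF assms(2,1)]
  by (simp add: E_bilinear F_closed power2_eq_square algebra_simps)

lemma E_CS:
  assumes "f \<in> F" "g \<in> F"
  shows "(E f g)\<^sup>2 \<le> E f f * E g g"
proof (rule nonneg_quadratic_imp_discriminant)
  show "0 \<le> E f f + 2 * t * E f g + t\<^sup>2 * E g g" for t
    unfolding E_quadratic[OF assms, symmetric] by (intro E_nonneg F_closed assms)
qed (rule E_nonneg[OF assms(2)])

lemma E_add_le:
  assumes "f \<in> F" "g \<in> F"
  shows "\<E> (\<lambda>x. f x + g x) \<le> 2 * E f f + 2 * E g g"
proof -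
  have "0 \<le> \<E> (\<lambda>x. f x + (-1) * g x)"
    by (intro E_nonneg F_closed assms)
  then show ?thesis
    using E_quadratic[OF assms, of "-1"] E_quadratic[OF assms, of 1] by simp
qed

lemma E_diff_le:
  assumes "f \<in> F" "g \<in> F" "h \<in> F"
  shows "\<E> (\<lambda>x. f x - g x)
    \<le> 2 * \<E> (\<lambda>x. f x - h x) + 2 * \<E> (\<lambda>x. g x - h x)"
proof -
  have "\<E> (\<lambda>x. h x - g x) = \<E> (\<lambda>x. g x - h x)"
    using assms E_sym by (simp add: E_bilinear F_closed)
  then show ?thesis
    using E_add_le[OF F_diff[OF assms(1,3)] F_diff[OF assms(3,2)]] by simp
qed

lemma E_tendsto_left:
  assumes "\<And>n. u n \<in> F" "v \<in> F" "h \<in> F"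
    and "(\<lambda>n. \<E> (\<lambda>x. u n x - v x)) \<longlonglongrightarrow> 0"
  shows "(\<lambda>n. E (u n) h) \<longlonglongrightarrow> E v h"
proof -
  have "(\<lambda>n. E (\<lambda>x. u n x - v x) h) \<longlonglongrightarrow> 0"
    by (rule tendsto_zero_of_square_le_mult[OF E_CS assms(4)]) (auto intro: F_diff assms)
  then have "(\<lambda>n. E (u n) h - E v h) \<longlonglongrightarrow> 0" using assms by (simp add: E_diff)
  then show ?thesis by (simp add: LIM_zero_iff)
qed

text \<open>Rests on E(u_n, w_n) + E(v, z) = E(u_n - v, w_n - z) + E(u_n, z) + E(w_n, v):
  Cauchy-Schwarz controls the first term on the right, and the other two have a fixed
  argument.\<close>

lemma E_tendsto:
  assumes u: "\<And>n. u n \<in> F" "v \<in> F"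
    and lu: "(\<lambda>n. \<E> (\<lambda>x. u n x - v x)) \<longlonglongrightarrow> 0"
    and w: "\<And>n. w n \<in> F" "z \<in> F"
    and lw: "(\<lambda>n. \<E> (\<lambda>x. w n x - z x)) \<longlonglongrightarrow> 0"
  shows "(\<lambda>n. E (u n) (w n)) \<longlonglongrightarrow> E v z"
proof -
  have "(\<lambda>n. sqrt (\<E> (\<lambda>x. u n x - v x)) * sqrt (\<E> (\<lambda>x. w n x - z x))) \<longlonglongrightarrow> 0"
    using tendsto_mult[OF tendsto_real_sqrt[OF lu] tendsto_real_sqrt[OF lw]] by simp
  moreover have "\<bar>E (\<lambda>x. u n x - v x) (\<lambda>x. w n x - z x)\<bar>
      \<le> sqrt (\<E> (\<lambda>x. u n x - v x)) * sqrt (\<E> (\<lambda>x. w n x - z x))" for n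
    using E_CS[OF F_diff[OF u(1)[of n] u(2)] F_diff[OF w(1)[of n] w(2)]]
    by (metis real_sqrt_abs real_sqrt_le_mono real_sqrt_mult)
  ultimately have "(\<lambda>n. E (\<lambda>x. u n x - v x) (\<lambda>x. w n x - z x)) \<longlonglongrightarrow> 0"
    by (intro Lim_null_comparison[where f = "\<lambda>n. E (\<lambda>x. u n x - v x) (\<lambda>x. w n x - z x)"]) auto
  from tendsto_add[OF tendsto_add[OF this E_tendsto_left[OF u w(2) lu]] E_tendsto_left[OF w u(2) lw]]
  have "(\<lambda>n. E (\<lambda>x. u n x - v x) (\<lambda>x. w n x - z x) + E (u n) z + E (w n) v) \<longlonglongrightarrow> E v z + E z v" by simp
  moreover have "E (\<lambda>x. u n x - v x) (\<lambda>x. w n x - z x) + E (u n) z + E (w n) v = E (u n) (w n) + E v z" for n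
    using u w E_sym[OF w(1)[of n] u(2)] by (simp add: E_bilinear F_closed)
  ultimately have "(\<lambda>n. E (u n) (w n) + E v z) \<longlonglongrightarrow> E v z + E v z"
    using E_sym[OF u(2) w(2)] by simp
  from tendsto_diff[OF this tendsto_const[of "E v z"]] show ?thesis by simp
qed

lemma E_tendsto_diag:
  assumes "\<And>n. u n \<in> F" "v \<in> F" "(\<lambda>n. \<E> (\<lambda>x. u n x - v x)) \<longlonglongrightarrow> 0"
  shows "(\<lambda>n. \<E> (u n)) \<longlonglongrightarrow> E v v"
  by (rule E_tendsto) (use assms in auto)

lemma E1r_tendsto_iff:
  assumes "\<And>n. u n \<in> F"
  shows "(\<lambda>n. E1r M E (u n)) \<longlonglongrightarrow> 0 \<longleftrightarrow>
    (\<lambda>n. \<E> (u n)) \<longlonglongrightarrow> 0 \<and> (\<lambda>n. \<integral>x. (u n x)\<^sup>2 \<partial>M) \<longlonglongrightarrow> 0"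
proof
  assume "(\<lambda>n. E1r M E (u n)) \<longlonglongrightarrow> 0"
  from tendsto_power[OF this, of 2]
  have *: "(\<lambda>n. \<E> (u n) + (\<integral>x. (u n x)\<^sup>2 \<partial>M)) \<longlonglongrightarrow> 0"
    by (simp add: E1r_def E_nonneg assms)
  show "(\<lambda>n. \<E> (u n)) \<longlonglongrightarrow> 0 \<and> (\<lambda>n. \<integral>x. (u n x)\<^sup>2 \<partial>M) \<longlonglongrightarrow> 0"
    by (auto intro!: tendsto_sandwich[OF _ _ tendsto_const *] simp: E_nonneg assms)
next
  assume "(\<lambda>n. \<E> (u n)) \<longlonglongrightarrow> 0 \<and> (\<lambda>n. \<integral>x. (u n x)\<^sup>2 \<partial>M) \<longlonglongrightarrow> 0"
  then show "(\<lambda>n. E1r M E (u n)) \<longlonglongrightarrow> 0"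
    unfolding E1r_def by (auto intro!: tendsto_eq_intros)
qed

text \<open>The shape of closedness used everywhere below: the candidate limit \<open>v\<close> is
  known in L2, and only the energies have to be Cauchy. Completeness provides some limit in F; it
  agrees with \<open>v\<close> almost everywhere, and both F and \<open>E\<close> respect such a
  change.\<close>

lemma closed_form:
  assumes u: "\<And>n. u n \<in> F" and v: "L2r M v"
    and lim: "(\<lambda>n. \<integral>x. (u n x - v x)\<^sup>2 \<partial>M) \<longlonglongrightarrow> 0"
    and cau: "\<And>e. e > 0 \<Longrightarrow> \<exists>N. \<forall>m\<ge>N. \<forall>n\<ge>N. \<E> (\<lambda>x. u m x - u n x) < e"
  shows "v \<in> F" and "(\<lambda>n. \<E> (\<lambda>x. u n x - v x)) \<longlonglongrightarrow> 0"
proof -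
  have "\<exists>N. \<forall>m\<ge>N. \<forall>n\<ge>N. E1r M E (\<lambda>x. u m x - u n x) < e" if e: "e > 0" for e
  proof -
    \<comment> \<open>The energy takes one half of e^2; the L2 part takes 2 * e^2/8 + 2 * e^2/8, the
      other half.\<close>
    have e2: "e\<^sup>2 / 2 > 0" "e\<^sup>2 / 8 > 0" using e by simp_all
    obtain N1 where N1: "\<And>m n. m \<ge> N1 \<Longrightarrow> n \<ge> N1 \<Longrightarrow> \<E> (\<lambda>x. u m x - u n x) < e\<^sup>2 / 2"
      using cau[OF e2(1)] by blast
    obtain N2 where N2: "\<And>n. n \<ge> N2 \<Longrightarrow> (\<integral>x. (u n x - v x)\<^sup>2 \<partial>M) < e\<^sup>2 / 8"
      using order_tendstoD(2)[OF lim e2(2)] by (auto simp: eventually_sequentially)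
    show ?thesis
    proof (intro exI[of _ "max N1 N2"] allI impI)
      fix m n assume mn: "m \<ge> max N1 N2" "n \<ge> max N1 N2"
      have "(\<integral>x. (u m x - u n x)\<^sup>2 \<partial>M) \<le> 2 * (\<integral>x. (u m x - v x)\<^sup>2 \<partial>M) + 2 * (\<integral>x. (u n x - v x)\<^sup>2 \<partial>M)"
        by (intro L2r_integral_diff_le F_L2 u v)
      then have "\<E> (\<lambda>x. u m x - u n x) + (\<integral>x. (u m x - u n x)\<^sup>2 \<partial>M) < e\<^sup>2"
        using N1[of m n] N2[of m] N2[of n] mn by simp
      then show "E1r M E (\<lambda>x. u m x - u n x) < e"
        unfolding E1r_def using e real_less_lsqrt by (simp add: real_sqrt_less_iff real_less_lsqrt)
    qed
  qed
  moreover have "\<forall>u::nat \<Rightarrow> 'a \<Rightarrow> real. (\<forall>n. u n \<in> F) \<and>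
         (\<forall>e>0. \<exists>N. \<forall>m\<ge>N. \<forall>n\<ge>N. E1r M E (\<lambda>x. u m x - u n x) < e) \<longrightarrow>
         (\<exists>v\<in>F. (\<lambda>n. E1r M E (\<lambda>x. u n x - v x)) \<longlonglongrightarrow> 0)"
    using form by (simp add: sym_dirichlet_form_def)
  ultimately obtain w where w: "w \<in> F" and lw: "(\<lambda>n. E1r M E (\<lambda>x. u n x - w x)) \<longlonglongrightarrow> 0"
    using u by blast
  have lw': "(\<lambda>n. \<E> (\<lambda>x. u n x - w x)) \<longlonglongrightarrow> 0"
      "(\<lambda>n. \<integral>x. (u n x - w x)\<^sup>2 \<partial>M) \<longlonglongrightarrow> 0"
    using lw E1r_tendsto_iff[of "\<lambda>n x. u n x - w x"] F_diff u w by auto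
  have "(\<integral>x. (w x - v x)\<^sup>2 \<partial>M) \<le> 2 * (\<integral>x. (u n x - w x)\<^sup>2 \<partial>M) + 2 * (\<integral>x. (u n x - v x)\<^sup>2 \<partial>M)" for n
    using L2r_integral_diff_le[OF F_L2[OF w] v F_L2[OF u[of n]]] by (simp add: power2_commute)
  moreover have "(\<lambda>n. 2 * (\<integral>x. (u n x - w x)\<^sup>2 \<partial>M) + 2 * (\<integral>x. (u n x - v x)\<^sup>2 \<partial>M)) \<longlonglongrightarrow> 0"
    using lw'(2) lim by (auto intro!: tendsto_eq_intros)
  ultimately have "(\<integral>x. (w x - v x)\<^sup>2 \<partial>M) \<le> 0"
    by (intro LIMSEQ_le_const) auto
  then have "(\<integral>x. (w x - v x)\<^sup>2 \<partial>M) = 0"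
    by (intro antisym) auto
  then have ae: "AE x in M. w x = v x"
    by (intro L2r_AE_eq_of_integral_zero F_L2 w v)
  have vm: "v \<in> borel_measurable M" using v by (simp add: L2r_def)
  show vF: "v \<in> F" by (rule F_cong_AE[OF w vm ae])
  have "\<E> (\<lambda>x. u n x - v x) = \<E> (\<lambda>x. u n x - w x)" for n
    by (rule E_cong_AE2) (use ae F_diff[OF u w] F_meas[OF u[of n]] vm in auto)
  then show "(\<lambda>n. \<E> (\<lambda>x. u n x - v x)) \<longlonglongrightarrow> 0" using lw'(1) by simp
qed

subsection \<open>Truncation\<close>

text \<open>Truncation of \<open>u\<close> at t is t times the unit contraction of u / t; at t = 0
  the truncation of a nonnegative function is the zero function.\<close>

lemma F_truncate:
  assumes "u \<in> F" "\<And>x. u x \<ge> 0" "t \<ge> 0"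
  shows "(\<lambda>x. min (u x) t) \<in> F"
    and "\<E> (\<lambda>x. min (u x) t) \<le> E u u"
proof -
  have "(\<lambda>x. min (u x) t) \<in> F \<and> \<E> (\<lambda>x. min (u x) t) \<le> E u u"
  proof (cases "t = 0")
    case True
    then have "(\<lambda>x. min (u x) t) = (\<lambda>_. 0)" using assms(2) by (auto simp: fun_eq_iff min_absorb2)
    then show ?thesis using E_nonneg[OF assms(1)] by simp
  next
    case False
    then have t: "t > 0" using assms by simp
    define v where "v = (\<lambda>x. inverse t * u x)"
    have v: "v \<in> F" unfolding v_def by (rule F_scale[OF assms(1)])
    define c where "c = (\<lambda>x. max 0 (min 1 (v x)))"
    have c: "c \<in> F" "E c c \<le> E v v" unfolding c_def using unit_contraction[OF v] by auto
    have eq: "(\<lambda>x. min (u x) t) = (\<lambda>x. t * c x)"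
      using t assms(2) by (auto simp: c_def v_def min_def max_def field_simps fun_eq_iff intro: antisym)
    have "E v v = E u u / t\<^sup>2"
      unfolding v_def using assms(1) by (simp add: E_bilinear F_closed power2_eq_square divide_inverse)
    then have "t\<^sup>2 * E c c \<le> E u u" using mult_left_mono[OF c(2), of "t\<^sup>2"] t by simp
    then show ?thesis
      unfolding eq using c(1) by (simp add: E_bilinear F_closed power2_eq_square)
  qed
  then show "(\<lambda>x. min (u x) t) \<in> F" "\<E> (\<lambda>x. min (u x) t) \<le> E u u" by auto
qed

text \<open>Truncating \<open>min u t + s (u - t)\<^sup>+\<close> at \<open>t\<close> gives back \<open>min u t\<close>; letting \<open>s\<close> tend to \<open>0\<close> in
  the contraction inequality shows that the mixed term is nonnegative.\<close>

lemma E_truncate_superadditive: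
  assumes "u \<in> F" "\<And>x. u x \<ge> 0" "t \<ge> 0"
  shows "\<E> (\<lambda>x. min (u x) t)
    + \<E> (\<lambda>x. u x - min (u x) t) \<le> E u u"
proof -
  define p where "p = (\<lambda>x. min (u x) t)"
  define q where "q = (\<lambda>x. u x - min (u x) t)"
  have p: "p \<in> F" unfolding p_def by (rule F_truncate[OF assms])
  have q: "q \<in> F" unfolding q_def using F_diff[OF assms(1) F_truncate(1)[OF assms]] .
  have pos: "0 \<le> 2 * E p q + s * E q q" if s: "s > 0" for s
  proof -
    define w where "w = (\<lambda>x. p x + s * q x)"
    have w: "w \<in> F" unfolding w_def by (intro F_closed p q)
    have w0: "w x \<ge> 0" for x
      unfolding w_def p_def q_def using assms(2)[of x] assms(3) s by (auto simp: min_def)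
    have "(\<lambda>x. min (w x) t) = p"
      using s by (auto simp: fun_eq_iff w_def p_def q_def min_def mult_le_0_iff)
    then have "E p p \<le> E w w" using F_truncate(2)[OF w w0 assms(3)] by simp
    also have "E w w = E p p + 2 * s * E p q + s\<^sup>2 * E q q"
      unfolding w_def by (rule E_quadratic[OF p q])
    finally have "0 \<le> s * (2 * E p q + s * E q q)" by (simp add: power2_eq_square algebra_simps)
    then show ?thesis using s by (simp add: zero_le_mult_iff)
  qed
  have "0 \<le> E p q"
  proof (rule ccontr)
    assume n: "\<not> 0 \<le> E p q"
    have "E q q \<ge> 0" by (rule E_nonneg[OF q])
    \<comment> \<open>For this s the inequality reads 0 \<le> E(p, q) (2 - E(q, q) / (E(q, q) + 1)),
      whose second factor is positive.\<close>
    show False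
      using pos[of "- E p q / (E q q + 1)"] n \<open>E q q \<ge> 0\<close>
        mult_nonneg_nonneg[of "- E p q" "E q q"]
      by (simp add: field_simps add_nonneg_pos zero_le_mult_iff mult_less_0_iff)
  qed
  moreover have "u = (\<lambda>x. p x + 1 * q x)" by (auto simp: p_def q_def)
  then have "E u u = E p p + 2 * E p q + E q q" using E_quadratic[OF p q, of 1] by simp
  ultimately show ?thesis unfolding p_def[symmetric] q_def[symmetric] by simp
qed

text \<open>Superadditivity bounds the energy of a difference of two truncations by the difference
  of their energies. These energies decrease, so the truncations are Cauchy in \<open>E\<close>, and
  closedness identifies the limit with their L2 limit 0.\<close>

lemma E_truncate_tendsto_zero:
  assumes "u \<in> F" "\<And>x. u x \<ge> 0"
  shows "(\<lambda>n. \<E> (\<lambda>x. min (u x) (1 / real (Suc n)))) \<longlonglongrightarrow> 0"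
proof -
  define v where "v = (\<lambda>n x. min (u x) (1 / real (Suc n)))"
  have vF: "v n \<in> F" for n unfolding v_def by (rule F_truncate) (use assms in auto)
  have v0: "v n x \<ge> 0" for n x unfolding v_def using assms(2)[of x] by simp
  have step: "\<E> (\<lambda>x. v m x - v n x) \<le> \<E> (v m) - \<E> (v n)" if "m \<le> n" for m n
  proof -
    have "1 / real (Suc n) \<le> 1 / real (Suc m)" using that by (simp add: frac_le)
    then have "(\<lambda>x. min (v m x) (1 / real (Suc n))) = v n"
      unfolding v_def by (auto simp: fun_eq_iff min_def)
    then show ?thesis
      using E_truncate_superadditive[OF vF[of m] v0, of "1 / real (Suc n)"]
      by (simp add: fun_eq_iff)
  qed
  have dec: "\<E> (v n) \<le> \<E> (v m)" if "m \<le> n" for m n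
    using step[OF that] E_nonneg[OF F_diff[OF vF[of m] vF[of n]]] by linarith
  have "decseq (\<lambda>n. \<E> (v n))" using dec by (auto simp: decseq_def)
  then have "convergent (\<lambda>n. \<E> (v n))"
    using decseq_convergent E_nonneg[OF vF] unfolding convergent_def by metis
  then have cau: "Cauchy (\<lambda>n. \<E> (v n))" by (rule convergent_Cauchy)
  have um [measurable]: "u \<in> borel_measurable M" by (rule F_meas[OF assms(1)])
  have l2: "(\<lambda>n. \<integral>x. (v n x - 0)\<^sup>2 \<partial>M) \<longlonglongrightarrow> (\<integral>x. 0 \<partial>M)"
  proof (rule integral_dominated_convergence[where w = "\<lambda>x. (u x)\<^sup>2"])
    show "integrable M (\<lambda>x. (u x)\<^sup>2)" using F_L2[OF assms(1)] by (simp add: L2r_def)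
    show "AE x in M. (\<lambda>n. (v n x - 0)\<^sup>2) \<longlonglongrightarrow> 0"
    proof (rule AE_I2)
      fix x
      have "(\<lambda>n. v n x) \<longlonglongrightarrow> 0"
        by (rule tendsto_sandwich[OF _ _ tendsto_const LIMSEQ_inverse_real_of_nat])
           (use v0 assms(2) in \<open>auto simp: v_def inverse_eq_divide intro!: always_eventually\<close>)
      then show "(\<lambda>n. (v n x - 0)\<^sup>2) \<longlonglongrightarrow> 0" using tendsto_power[of _ 0 _ 2] by fastforce
    qed
    show "AE x in M. norm ((v n x - 0)\<^sup>2) \<le> (u x)\<^sup>2" for n
      using v0 assms(2) by (intro AE_I2) (auto simp: v_def power_mono)
    show "(\<lambda>x. (v n x - 0)\<^sup>2) \<in> borel_measurable M" for n unfolding v_def by measurable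
  qed auto
  have "(\<lambda>n. \<E> (\<lambda>x. v n x - (\<lambda>_. 0) x)) \<longlonglongrightarrow> 0"
  proof (rule closed_form(2)[OF vF])
    show "L2r M (\<lambda>_. 0)" by (rule F_L2) simp
    show "(\<lambda>n. \<integral>x. (v n x - 0)\<^sup>2 \<partial>M) \<longlonglongrightarrow> 0" using l2 by simp
    fix e :: real assume "e > 0"
    with cau obtain N where N: "\<And>m n. m \<ge> N \<Longrightarrow> n \<ge> N \<Longrightarrow> \<bar>\<E> (v m) - \<E> (v n)\<bar> < e"
      unfolding Cauchy_def dist_real_def by meson
    have "\<E> (\<lambda>x. v m x - v n x) < e" if "m \<ge> N" "n \<ge> N" for m n
    proof (cases "m \<le> n")
      case True
      then show ?thesis using step[OF True] N[OF that] by linarith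
    next
      case False
      have "\<E> (\<lambda>x. v m x - v n x) = \<E> (\<lambda>x. v n x - v m x)"
        using vF[of m] vF[of n] by (simp add: E_bilinear F_closed)
      then show ?thesis using step[of n m] N[OF that(2,1)] False by linarith
    qed
    then show "\<exists>N. \<forall>m\<ge>N. \<forall>n\<ge>N. \<E> (\<lambda>x. v m x - v n x) < e" by blast
  qed
  then show ?thesis unfolding v_def by simp
qed

subsection \<open>The core\<close>

lemma CoreI: "f \<in> F \<Longrightarrow> continuous_on UNIV f \<Longrightarrow> compact_support f \<Longrightarrow> f \<in> Ccore F"
  by (simp add: Ccore_def)

lemma Core_F: "f \<in> Ccore F \<Longrightarrow> f \<in> F"
  and Core_cont: "f \<in> Ccore F \<Longrightarrow> continuous_on UNIV f"
  and Core_supp: "f \<in> Ccore F \<Longrightarrow> compact_support f"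
  by (auto simp: Ccore_def)

lemma Core_zero [simp]: "(\<lambda>_. 0) \<in> Ccore F"
  by (rule CoreI) (auto simp: compact_support_def)

lemma Core_add: "f \<in> Ccore F \<Longrightarrow> g \<in> Ccore F \<Longrightarrow> (\<lambda>x. f x + g x) \<in> Ccore F"
  by (rule CoreI) (auto simp: Core_F Core_cont F_add continuous_on_add
      intro: compact_support_Un[OF Core_supp Core_supp, of f g])

lemma Core_scale: "f \<in> Ccore F \<Longrightarrow> (\<lambda>x. c * f x) \<in> Ccore F"
  by (rule CoreI) (auto simp: Core_F Core_cont F_scale continuous_on_mult_left
      intro: compact_support_mono[OF Core_supp, of f])

lemma Core_minus: "f \<in> Ccore F \<Longrightarrow> (\<lambda>x. - f x) \<in> Ccore F"
  using Core_scale[of f "-1"] by simp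

lemma Core_diff: "f \<in> Ccore F \<Longrightarrow> g \<in> Ccore F \<Longrightarrow> (\<lambda>x. f x - g x) \<in> Ccore F"
  using Core_add[of f "\<lambda>x. - g x"] Core_minus[of g] by simp

lemma Core_bounded:
  assumes "f \<in> Ccore F"
  obtains R where "R > 0" "\<And>x. \<bar>f x\<bar> \<le> R"
proof -
  have "compact (f ` closure {x. f x \<noteq> 0})"
    using assms by (auto simp: Ccore_def compact_support_def intro!: compact_continuous_image
        elim: continuous_on_subset)
  then have "bounded (f ` closure {x. f x \<noteq> 0})" by (rule compact_imp_bounded)
  then obtain R where R: "\<And>x. x \<in> closure {x. f x \<noteq> 0} \<Longrightarrow> \<bar>f x\<bar> \<le> R" "R > 0"
    by (auto simp: bounded_pos)
  have "\<bar>f x\<bar> \<le> R" for x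
    using R closure_subset[of "{x. f x \<noteq> 0}"] by (cases "f x = 0") auto
  then show ?thesis using R(2) that by blast
qed

lemma Core_min:
  assumes "f \<in> Ccore F" "\<And>x. f x \<ge> 0" "t \<ge> 0"
  shows "(\<lambda>x. min (f x) t) \<in> Ccore F"
proof (rule CoreI)
  show "(\<lambda>x. min (f x) t) \<in> F" by (intro F_truncate Core_F assms)
  show "continuous_on UNIV (\<lambda>x. min (f x) t)" by (intro continuous_intros Core_cont assms)
  show "compact_support (\<lambda>x. min (f x) t)"
    by (rule compact_support_mono[OF Core_supp[OF assms(1)]]) (use assms(3) in auto)
qed

lemma strong_locality:
  assumes "f \<in> Ccore F" "g \<in> Ccore F" "open U" "closure {x. g x \<noteq> 0} \<subseteq> U" "\<And>x. x \<in> U \<Longrightarrow> f x = c"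
  shows "E f g = 0"
proof -
  have "compact (esupp M f)" "compact (esupp M g)" "esupp M g \<subseteq> U"
    using compact_esupp[OF Core_supp[OF assms(1)]] compact_esupp[OF Core_supp[OF assms(2)]] assms(4)
    by blast+
  moreover have "AE x in M. x \<in> U \<longrightarrow> f x = c" using assms(5) by auto
  ultimately show ?thesis
    using sloc Core_F[OF assms(1)] Core_F[OF assms(2)] assms(3) unfolding strongly_local_def by blast
qed

text \<open>On the open set where f > s the function min f s is constant. For s < t this set
  contains the closed set where f \<ge> t, hence the support of f - min f t, and strong locality
  applies. For s = t there is no room between the two sets; the levels s + 1/(n+1) leave some, and
  the error they cause is a truncation of f - min f s at 1/(n+1), whose energy vanishes in the
  limit.\<close>

lemma E_truncate_orthogonal:
  assumes f: "f \<in> Ccore F" "\<And>x. f x \<ge> 0" and "0 \<le> s" "s \<le> t"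
  shows "E (\<lambda>x. min (f x) s) (\<lambda>x. f x - min (f x) t) = 0"
proof -
  have strict: "E (\<lambda>x. min (f x) s) (\<lambda>x. f x - min (f x) t) = 0" if "s < t" for t
  proof (rule strong_locality[where U = "{x. f x > s}" and c = s])
    have "closed {x. f x \<ge> t}"
      using Core_cont[OF f(1)] by (intro closed_Collect_le) auto
    then have "closure {x. f x - min (f x) t \<noteq> 0} \<subseteq> {x. f x \<ge> t}"
      by (intro closure_minimal) auto
    then show "closure {x. f x - min (f x) t \<noteq> 0} \<subseteq> {x. f x > s}" using that by auto
    show "open {x. f x > s}" using Core_cont[OF f(1)] by (intro open_Collect_less) auto
  qed (use assms that in \<open>auto intro!: Core_diff Core_min\<close>)
  show ?thesis
  proof (cases "s < t")
    case True then show ?thesis by (rule strict)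
  next
    case False
    then have st: "t = s" using assms by simp
    define p where "p = (\<lambda>x. min (f x) s)"
    define g where "g = (\<lambda>x. f x - min (f x) s)"
    have pF: "p \<in> F" unfolding p_def by (intro F_truncate Core_F assms)
    have gF: "g \<in> F" unfolding g_def by (intro F_diff F_truncate Core_F assms)
    have g0: "g x \<ge> 0" for x unfolding g_def by simp
    define h where "h = (\<lambda>n x. f x - min (f x) (s + 1 / real (Suc n)))"
    have hF: "h n \<in> F" for n unfolding h_def by (intro F_diff F_truncate Core_F) (use assms in auto)
    have hg: "(\<lambda>x. h n x - g x) = (\<lambda>x. - min (g x) (1 / real (Suc n)))" for n
    proof
      fix x
      have "0 \<le> 1 / real (Suc n)" by simp
      then show "h n x - g x = - min (g x) (1 / real (Suc n))"
        unfolding h_def g_def min_def by (smt (verit))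
    qed
    have tF: "(\<lambda>x. min (g x) (1 / real (Suc n))) \<in> F" for n by (rule F_truncate) (use gF g0 in auto)
    have "(\<lambda>n. E (h n) p) \<longlonglongrightarrow> E g p"
    proof (rule E_tendsto_left[OF hF gF pF])
      show "(\<lambda>n. \<E> (\<lambda>x. h n x - g x)) \<longlonglongrightarrow> 0"
        unfolding hg using E_truncate_tendsto_zero[OF gF g0] tF by (simp add: E_bilinear F_closed)
    qed
    moreover have "E (h n) p = 0" for n
      using strict[of "s + 1 / real (Suc n)"] E_sym[OF pF hF[of n]] unfolding h_def p_def by simp
    ultimately have "E g p = 0" by (simp add: LIMSEQ_const_iff)
    then show ?thesis using E_sym[OF pF gF] st unfolding p_def g_def by simp
  qed
qed

subsection \<open>Chain rule for a single function\<close>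

text \<open>The right-hand side no longer depends on b; this is what cancels the four terms in the
  product of two slices.\<close>

lemma E_min_min:
  assumes f: "f \<in> Ccore F" "\<And>x. f x \<ge> 0" and "0 \<le> a" "a \<le> b"
  shows "E (\<lambda>x. min (f x) a) (\<lambda>x. min (f x) b) = E (\<lambda>x. min (f x) a) f"
  using E_truncate_orthogonal[OF assms] F_truncate(1)[OF Core_F[OF f(1)] f(2)] Core_F[OF f(1)] assms(3,4)
  by (simp add: E_diff_right)

text \<open>For i < j all levels of slice i lie below those of slice j, so \<open>E_min_min\<close>
  makes the four terms of E(S i, S j) cancel in pairs. The energies of the slices then act like
  masses placed on the range of \<open>f\<close>, and \<open>E\<close> becomes a sum of products of
  coefficients against them.\<close>

lemma E_slices:
  fixes t :: "nat \<Rightarrow> real"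
  assumes f: "f \<in> Ccore F" "\<And>x. f x \<ge> 0" and t: "mono t" "t 0 \<ge> 0"
  defines "S \<equiv> \<lambda>i x. min (f x) (t (Suc i)) - min (f x) (t i)"
  shows "S i \<in> F"
    and "E (\<lambda>x. \<Sum>i<k. \<alpha> i * S i x) (\<lambda>x. \<Sum>i<k. \<beta> i * S i x) = (\<Sum>i<k. \<alpha> i * \<beta> i * \<E> (S i))"
proof -
  have t0: "t i \<ge> 0" for i using t monoD[OF t(1), of 0 i] by simp
  have pF: "(\<lambda>x. min (f x) (t i)) \<in> F" for i by (rule F_truncate[OF Core_F[OF f(1)] f(2) t0])
  show SF: "S i \<in> F" for i unfolding S_def by (intro F_diff pF)
  have orth: "E (S i) (S j) = 0" if "i < j" for i j
  proof -
    have le: "t i \<le> t j" "t i \<le> t (Suc j)" "t (Suc i) \<le> t j" "t (Suc i) \<le> t (Suc j)"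
      using that by (auto intro!: monoD[OF t(1)])
    show ?thesis
      unfolding S_def using pF by (simp add: E_bilinear F_closed E_min_min[OF f t0 le(1)]
          E_min_min[OF f t0 le(2)] E_min_min[OF f t0 le(3)] E_min_min[OF f t0 le(4)])
  qed
  have orth': "E (S i) (S j) = (if i = j then \<E> (S i) else 0)" for i j
    using orth[of i j] orth[of j i] E_sym[OF SF SF, of i j] by (cases i j rule: linorder_cases) auto
  have "E (\<lambda>x. \<Sum>i<k. \<alpha> i * S i x) (\<lambda>x. \<Sum>i<k. \<beta> i * S i x)
      = (\<Sum>i<k. \<Sum>j<k. \<alpha> i * (\<beta> j * E (S i) (S j)))"
    by (simp add: E_sum E_sum_right F_sum F_scale SF E_scale E_scale_right sum_distrib_left)
  also have "\<dots> = (\<Sum>i<k. \<alpha> i * \<beta> i * \<E> (S i))"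
    by (rule sum.cong[OF refl], subst orth') (simp add: if_distrib sum.delta cong: if_cong)
  finally show "E (\<lambda>x. \<Sum>i<k. \<alpha> i * S i x) (\<lambda>x. \<Sum>i<k. \<beta> i * S i x)
      = (\<Sum>i<k. \<alpha> i * \<beta> i * \<E> (S i))" .
qed

text \<open>With all coefficients equal to 1 the slices telescope to a truncation of
  \<open>f\<close>, so their total mass is at most E(f, f), uniformly in the partition.\<close>

lemma E_slices_le:
  fixes t :: "nat \<Rightarrow> real"
  assumes f: "f \<in> Ccore F" "\<And>x. f x \<ge> 0" and t: "mono t" "t 0 = 0"
  defines "S \<equiv> \<lambda>i x. min (f x) (t (Suc i)) - min (f x) (t i)"
  shows "(\<Sum>i<k. \<E> (S i)) \<le> E f f"
proof -
  have "(\<lambda>x. \<Sum>i<k. 1 * S i x) = (\<lambda>x. min (f x) (t k))"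
    using f(2) t(2) by (auto simp: S_def fun_eq_iff sum_lessThan_telescope[of "\<lambda>i. min (f x) (t i)" for x] min_absorb2)
  then have "(\<Sum>i<k. \<E> (S i)) = \<E> (\<lambda>x. min (f x) (t k))"
    using E_slices(2)[OF f t(1), of "\<lambda>_. 1" k "\<lambda>_. 1"] t(2) by (simp add: S_def)
  also have "\<dots> \<le> E f f"
    by (rule F_truncate) (use f t monoD[OF t(1), of 0 k] Core_F in auto)
  finally show ?thesis .
qed

text \<open>Left-endpoint Riemann sum, on the grid of step R / 2^n, for the integral of \<phi> from
  0 to f x. It approximates \<Phi>(f) when \<Phi> is the primitive of \<phi> that vanishes at 0;
  dyadic grids are chosen because they are nested.\<close>

definition slice_sum :: "('a \<Rightarrow> real) \<Rightarrow> real \<Rightarrow> (real \<Rightarrow> real) \<Rightarrow> nat \<Rightarrow> 'a \<Rightarrow> real" where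
  "slice_sum f R \<phi> n x =
     (\<Sum>i<2^n. \<phi> (R * real i / 2^n) * (min (f x) (R * real (Suc i) / 2^n) - min (f x) (R * real i / 2^n)))"

lemma slice_sum_F:
  assumes f: "f \<in> Ccore F" "\<And>x. f x \<ge> 0" and "R > 0"
  shows "slice_sum f R \<phi> n \<in> F"
proof -
  have m: "mono (\<lambda>i::nat. R * real i / 2^n)"
    using assms(3) by (intro monoI) (simp add: divide_right_mono)
  show ?thesis
    unfolding slice_sum_def by (intro F_sum F_scale E_slices(1)[OF f m]) simp
qed

lemma E_slice_sum:
  assumes f: "f \<in> Ccore F" "\<And>x. f x \<ge> 0" and "R > 0"
  defines "S \<equiv> \<lambda>n i x. min (f x) (R * real (Suc i) / 2^n) - min (f x) (R * real i / 2^n)"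
  shows "E (slice_sum f R \<phi> n) (slice_sum f R \<psi> n)
    = (\<Sum>i<2^n. \<phi> (R * real i / 2^n) * \<psi> (R * real i / 2^n) * \<E> (S n i))"
proof -
  have m: "mono (\<lambda>i::nat. R * real i / 2^n)"
    using assms(3) by (intro monoI) (simp add: divide_right_mono)
  show ?thesis
    unfolding slice_sum_def S_def by (rule E_slices(2)[OF f m]) simp
qed

text \<open>Rewrites a coarse sum on the fine grid, the coefficient of fine cell j being taken at
  the coarse cell \<open>j div 2^(m-n)\<close> that contains it. A difference of two sums thereby
  becomes one combination of orthogonal slices.\<close>

lemma slice_sum_refine:
  assumes "m \<ge> n"
  shows "slice_sum f R \<phi> n x = (\<Sum>j<2^m. \<phi> (R * real (j div 2^(m-n)) / 2^n) *
           (min (f x) (R * real (Suc j) / 2^m) - min (f x) (R * real j / 2^m)))"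
proof -
  define k :: nat where "k = 2^(m-n)"
  have k: "k > 0" "2^n * k = 2^m" using assms by (auto simp: k_def simp flip: power_add)
  have kr: "real k * 2^n = 2^m" using k(2) by (metis mult.commute of_nat_mult of_nat_numeral of_nat_power)
  define s where "s = (\<lambda>j. min (f x) (R * real j / 2^m))"
  have lev: "min (f x) (R * real i / 2^n) = s (i * k)" for i
    unfolding s_def kr[symmetric] using k by simp
  have "slice_sum f R \<phi> n x = (\<Sum>i<2^n. \<phi> (R * real i / 2^n) * (s (Suc i * k) - s (i * k)))"
    unfolding slice_sum_def lev[symmetric] ..
  also have "\<dots> = (\<Sum>i<2^n. \<Sum>j=i*k..<i*k+k. \<phi> (R * real (j div k) / 2^n) * (s (Suc j) - s j))"
  proof (rule sum.cong[OF refl])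
    fix i :: nat
    have "(\<Sum>j=i*k..<i*k+k. \<phi> (R * real (j div k) / 2^n) * (s (Suc j) - s j))
        = (\<Sum>j=i*k..<i*k+k. \<phi> (R * real i / 2^n) * (s (Suc j) - s j))"
    proof (rule sum.cong[OF refl])
      fix j assume "j \<in> {i*k..<i*k+k}"
      then have "j div k = i" by (intro div_nat_eqI) (auto simp: algebra_simps)
      then show "\<phi> (R * real (j div k) / 2^n) * (s (Suc j) - s j) = \<phi> (R * real i / 2^n) * (s (Suc j) - s j)" by simp
    qed
    also have "\<dots> = \<phi> (R * real i / 2^n) * (s (i*k+k) - s (i*k))"
      by (simp add: sum_distrib_left[symmetric] sum_Suc_diff')
    finally show "\<phi> (R * real i / 2^n) * (s (Suc i * k) - s (i * k))
        = (\<Sum>j=i*k..<i*k+k. \<phi> (R * real (j div k) / 2^n) * (s (Suc j) - s j))"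
      by (simp add: add.commute)
  qed
  also have "\<dots> = (\<Sum>j<2^n*k. \<phi> (R * real (j div k) / 2^n) * (s (Suc j) - s j))"
    by (rule sum.nat_group)
  finally show ?thesis by (simp only: k(2) s_def) (simp only: k_def)
qed

text \<open>Chain rule for one function, from two separate estimates. The Taylor bound gives a
  pointwise error at most L (R / 2^n) f, hence L2 convergence. The Lipschitz bound on \<phi>, with
  the orthogonality of slices, bounds the energy of the difference of the sums of order m \<ge> n by
  (L R / 2^n)^2 E(f, f), hence the Cauchy property. Closedness joins the two.\<close>

lemma slice_sum_tendsto:
  assumes f: "f \<in> Ccore F" "\<And>x. f x \<ge> 0" and R: "R > 0" "\<And>x. f x \<le> R" and L: "L \<ge> 0"
    and \<Phi>0: "\<Phi> 0 = 0" and \<Phi>m: "continuous_on UNIV \<Phi>"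
    and tay: "\<And>a b. 0 \<le> a \<Longrightarrow> a \<le> b \<Longrightarrow> b \<le> R \<Longrightarrow> \<bar>\<Phi> b - \<Phi> a - \<phi> a * (b - a)\<bar> \<le> L * (b - a)\<^sup>2"
    and lip: "\<And>a b. 0 \<le> a \<Longrightarrow> a \<le> b \<Longrightarrow> b \<le> R \<Longrightarrow> \<bar>\<phi> b - \<phi> a\<bar> \<le> L * (b - a)"
  shows "(\<lambda>x. \<Phi> (f x)) \<in> F"
    and "(\<lambda>n. \<E> (\<lambda>x. slice_sum f R \<phi> n x - \<Phi> (f x))) \<longlonglongrightarrow> 0"
proof -
  have fF: "f \<in> F" by (rule Core_F[OF f(1)])
  define g where "g = slice_sum f R \<phi>"
  have gF: "g n \<in> F" for n unfolding g_def by (rule slice_sum_F[OF f R(1)])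
  have err: "\<bar>g n x - \<Phi> (f x)\<bar> \<le> L * (R / 2^n) * f x" for n x
  proof -
    define s where "s = (\<lambda>i. min (f x) (R * real i / 2^n))"
    have s0: "s i \<ge> 0" "s i \<le> R" for i using f(2)[of x] R(2)[of x] R(1) by (auto simp: s_def min_le_iff_disj)
    have "s 0 = 0" "s (2^n) = f x" using f(2)[of x] R(2)[of x] by (auto simp: s_def min_absorb2 min_absorb1)
    then have tel: "(\<Sum>i<2^n. \<Phi> (s (Suc i)) - \<Phi> (s i)) = \<Phi> (f x)" "(\<Sum>i<2^n. s (Suc i) - s i) = f x"
      by (auto simp: sum_lessThan_telescope[of "\<lambda>i. \<Phi> (s i)"] sum_lessThan_telescope \<Phi>0)
    have tm: "\<bar>\<phi> (R * real i / 2^n) * (s (Suc i) - s i) - (\<Phi> (s (Suc i)) - \<Phi> (s i))\<bar> \<le> L * (R / 2^n) * (s (Suc i) - s i)" for i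
    proof -
      have mono: "s i \<le> s (Suc i)" using R(1) unfolding s_def by (intro min.mono) (auto simp: divide_right_mono)
      have "R * real (Suc i) / 2^n = R * real i / 2^n + R / 2^n" by (simp add: field_simps)
      moreover have "R / 2^n \<ge> 0" using R(1) by simp
      ultimately have d: "s (Suc i) - s i \<le> R / 2^n" unfolding s_def min_def by (smt (verit))
      \<comment> \<open>Either f x is below the left endpoint and the increment is 0, or
        \<open>s i\<close> is that endpoint.\<close>
      have eq: "\<phi> (R * real i / 2^n) * (s (Suc i) - s i) = \<phi> (s i) * (s (Suc i) - s i)"
      proof (cases "f x \<le> R * real i / 2^n")
        case True
        moreover have "R * real i / 2^n \<le> R * real (Suc i) / 2^n" using R(1) by (simp add: divide_right_mono)
        ultimately have "s i = f x" "s (Suc i) = f x" unfolding s_def by linarith+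
        then show ?thesis by simp
      qed (simp add: s_def)
      have "\<bar>\<Phi> (s (Suc i)) - \<Phi> (s i) - \<phi> (s i) * (s (Suc i) - s i)\<bar> \<le> L * (s (Suc i) - s i)\<^sup>2"
        by (rule tay) (use s0 mono in auto)
      also have "\<dots> \<le> L * (R / 2^n * (s (Suc i) - s i))"
        unfolding power2_eq_square using L d mono by (intro mult_left_mono mult_right_mono) auto
      finally show ?thesis unfolding eq by (simp add: abs_minus_commute mult.assoc)
    qed
    have "\<bar>g n x - \<Phi> (f x)\<bar> = \<bar>\<Sum>i<2^n. \<phi> (R * real i / 2^n) * (s (Suc i) - s i) - (\<Phi> (s (Suc i)) - \<Phi> (s i))\<bar>"
      unfolding g_def slice_sum_def tel(1)[symmetric] s_def by (simp add: sum_subtractf)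
    also have "\<dots> \<le> (\<Sum>i<2^n. L * (R / 2^n) * (s (Suc i) - s i))"
      by (rule order_trans[OF sum_abs sum_mono]) (rule tm)
    also have "\<dots> = L * (R / 2^n) * f x" by (simp only: sum_distrib_left[symmetric] tel(2))
    finally show ?thesis .
  qed
  have [measurable]: "f \<in> borel_measurable M" by (rule F_meas[OF fF])
  have [measurable]: "\<Phi> \<in> borel_measurable borel" using \<Phi>m by (rule borel_measurable_continuous_onI)
  have [measurable]: "g n \<in> borel_measurable M" for n by (rule F_meas[OF gF])
  have f2: "integrable M (\<lambda>x. (f x)\<^sup>2)" using F_L2[OF fF] by (simp add: L2r_def)
  have dL2: "L2r M (\<lambda>x. g n x - \<Phi> (f x))" 
     and dle: "(\<integral>x. (g n x - \<Phi> (f x))\<^sup>2 \<partial>M) \<le> (L * (R / 2^n))\<^sup>2 * (\<integral>x. (f x)\<^sup>2 \<partial>M)" for n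
  proof -
    have b: "(g n x - \<Phi> (f x))\<^sup>2 \<le> (L * (R / 2^n))\<^sup>2 * (f x)\<^sup>2" for x
      unfolding power_mult_distrib[symmetric]
      using power_mono[OF err[of n x] abs_ge_zero, of 2] by (simp only: power2_abs)
    have i: "integrable M (\<lambda>x. (g n x - \<Phi> (f x))\<^sup>2)"
      by (rule Bochner_Integration.integrable_bound[OF integrable_mult_right[OF f2, of "(L * (R / 2^n))\<^sup>2"]])
         (use b in auto)
    then show "L2r M (\<lambda>x. g n x - \<Phi> (f x))" by (simp add: L2r_def)
    have "(\<integral>x. (g n x - \<Phi> (f x))\<^sup>2 \<partial>M) \<le> (\<integral>x. (L * (R / 2^n))\<^sup>2 * (f x)\<^sup>2 \<partial>M)"
      by (rule integral_mono) (use i f2 b in auto)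
    then show "(\<integral>x. (g n x - \<Phi> (f x))\<^sup>2 \<partial>M) \<le> (L * (R / 2^n))\<^sup>2 * (\<integral>x. (f x)\<^sup>2 \<partial>M)" by simp
  qed
  have pw: "(\<lambda>n. (L * (R / 2^n))\<^sup>2 * c) \<longlonglongrightarrow> 0" for c :: real
  proof -
    have "(\<lambda>n. R / 2^n) \<longlonglongrightarrow> 0" using LIMSEQ_divide_realpow_zero[of 2 R] by simp
    then have "(\<lambda>n. (L * (R / 2^n))\<^sup>2 * c) \<longlonglongrightarrow> (L * 0)\<^sup>2 * c" by (intro tendsto_intros)
    then show ?thesis by simp
  qed
  have lim: "(\<lambda>n. \<integral>x. (g n x - \<Phi> (f x))\<^sup>2 \<partial>M) \<longlonglongrightarrow> 0"
    by (rule tendsto_sandwich[OF _ always_eventually tendsto_const pw, of _ "\<integral>x. (f x)\<^sup>2 \<partial>M"])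
       (use dle in auto)
  have \<Phi>L2: "L2r M (\<lambda>x. \<Phi> (f x))"
    using L2r_diff[OF F_L2[OF gF] dL2, of 0 0] by simp
  have cau1: "\<E> (\<lambda>x. g m x - g n x) \<le> (L * (R / 2^n))\<^sup>2 * E f f" if mn: "n \<le> m" for m n
  proof -
    define t where "t = (\<lambda>i::nat. R * real i / 2^m)"
    have t: "mono t" "t 0 = 0"
      using R(1) by (auto simp: t_def intro!: monoI divide_right_mono)
    define S where "S = (\<lambda>i x. min (f x) (t (Suc i)) - min (f x) (t i))"
    define k :: nat where "k = 2^(m-n)"
    have k: "k > 0" "2^n * k = 2^m" using mn by (auto simp: k_def simp flip: power_add)
    have kr: "2^n * real k = 2^m" using k(2) by (metis of_nat_mult of_nat_numeral of_nat_power)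
    \<comment> \<open>The difference of \<phi> between the left endpoints of a fine cell and of the
      coarse cell around it; these are at most R / 2^n apart.\<close>
    define \<alpha> where "\<alpha> = (\<lambda>j. \<phi> (t j) - \<phi> (R * real (j div k) / 2^n))"
    have eq: "(\<lambda>x. g m x - g n x) = (\<lambda>x. \<Sum>j<2^m. \<alpha> j * S j x)"
      unfolding g_def slice_sum_refine[OF mn] slice_sum_def[of f R \<phi> m] \<alpha>_def S_def t_def k_def
      by (simp add: sum_subtractf[symmetric] algebra_simps)
    have al: "(\<alpha> j)\<^sup>2 \<le> (L * (R / 2^n))\<^sup>2" if "j < 2^m" for j
    proof -
      have tj: "R * real (j div k) / 2^n = R * real (k * (j div k)) / 2^m"
        unfolding kr[symmetric] using k by simp
      have d: "t j - R * real (j div k) / 2^n = R * real (j mod k) / 2^m"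
        unfolding tj t_def
        by (metis diff_divide_distrib minus_mult_div_eq_mod of_nat_diff right_diff_distrib' times_div_less_eq_dividend)
      have "real (j mod k) \<le> real k" using k(1) by simp
      then have "R * real (j mod k) / 2^m \<le> R * real k / 2^m" using R(1) by (simp add: divide_right_mono)
      also have "\<dots> = R / 2^n" unfolding kr[symmetric] using k(1) by simp
      finally have d2: "t j - R * real (j div k) / 2^n \<le> R / 2^n" unfolding d .
      have d3: "R * real (j div k) / 2^n \<le> t j" using d R(1) by (smt (verit) divide_nonneg_nonneg mult_nonneg_nonneg of_nat_0_le_iff zero_le_power)
      have tjR: "t j \<le> R"
      proof -
        have "real j \<le> 2^m" using that by (metis less_imp_le of_nat_le_iff of_nat_numeral of_nat_power)
        then show ?thesis unfolding t_def using R(1) by (simp add: field_simps)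
      qed
      have "\<bar>\<alpha> j\<bar> \<le> L * (t j - R * real (j div k) / 2^n)"
        unfolding \<alpha>_def by (rule lip) (use d3 tjR R(1) in auto)
      also have "\<dots> \<le> L * (R / 2^n)" using d2 L by (rule mult_left_mono)
      finally show ?thesis using power_mono[OF _ abs_ge_zero, of "\<alpha> j" "L * (R / 2^n)" 2] by (simp only: power2_abs)
    qed
    have SF: "S i \<in> F" for i unfolding S_def by (rule E_slices(1)[OF f t(1)]) (use t in auto)
    have "\<E> (\<lambda>x. g m x - g n x) = (\<Sum>j<2^m. \<alpha> j * \<alpha> j * \<E> (S j))"
      unfolding eq S_def by (rule E_slices(2)[OF f t(1)]) (use t in auto)
    also have "\<dots> \<le> (\<Sum>j<2^m. (L * (R / 2^n))\<^sup>2 * \<E> (S j))"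
      by (rule sum_mono, rule mult_right_mono) (use al E_nonneg[OF SF] in \<open>auto simp: power2_eq_square\<close>)
    also have "\<dots> = (L * (R / 2^n))\<^sup>2 * (\<Sum>j<2^m. \<E> (S j))" by (rule sum_distrib_left[symmetric])
    also have "\<dots> \<le> (L * (R / 2^n))\<^sup>2 * E f f"
      unfolding S_def by (rule mult_left_mono[OF E_slices_le[OF f t]]) auto
    finally show ?thesis .
  qed
  have cau: "\<exists>N. \<forall>m\<ge>N. \<forall>n\<ge>N. \<E> (\<lambda>x. g m x - g n x) < e" if e: "e > 0" for e
  proof -
    obtain N where N: "\<And>n. n \<ge> N \<Longrightarrow> (L * (R / 2^n))\<^sup>2 * E f f < e"
      using order_tendstoD(2)[OF pw[of "E f f"] e] by (auto simp: eventually_sequentially)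
    have "\<E> (\<lambda>x. g m x - g n x) < e" if "m \<ge> N" "n \<ge> N" for m n
    proof (cases "n \<le> m")
      case True
      then show ?thesis using cau1[OF True] N[OF that(2)] by linarith
    next
      case False
      have "\<E> (\<lambda>x. g m x - g n x) = \<E> (\<lambda>x. g n x - g m x)"
        using gF[of m] gF[of n] by (simp add: E_bilinear F_closed)
      then show ?thesis using cau1[of m n] N[OF that(1)] False by linarith
    qed
    then show ?thesis by blast
  qed
  from closed_form[OF gF \<Phi>L2 lim cau]
  show "(\<lambda>x. \<Phi> (f x)) \<in> F"
    and "(\<lambda>n. \<E> (\<lambda>x. slice_sum f R \<phi> n x - \<Phi> (f x))) \<longlonglongrightarrow> 0"
    unfolding g_def by auto
qed

text \<open>The derivatives of t^2, t and t^3 are 2t, 1 and 3t^2, and 3 (2t)(2t) = 4 * 1 * 3t^2.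
  Hence the identity holds exactly for the slice sums, coefficient by coefficient, and passes to the
  limit.\<close>

lemma square_cube_nonneg:
  assumes f: "f \<in> Ccore F" "\<And>x. f x \<ge> 0"
  shows "(\<lambda>x. (f x)\<^sup>2) \<in> F" and "(\<lambda>x. (f x)^3) \<in> F"
    and "3 * \<E> (\<lambda>x. (f x)\<^sup>2) = 4 * E f (\<lambda>x. (f x)^3)"
proof -
  obtain R where R: "R > 0" "\<And>x. \<bar>f x\<bar> \<le> R" using Core_bounded[OF f(1)] by blast
  have R': "f x \<le> R" for x using R(2)[of x] by simp
  have t1: "(\<lambda>x. f x) \<in> F"
    "(\<lambda>n. \<E> (\<lambda>x. slice_sum f R (\<lambda>_. 1) n x - f x)) \<longlonglongrightarrow> 0"
    using slice_sum_tendsto[OF f R(1) R', of 0 "\<lambda>t. t" "\<lambda>_. 1"] by auto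
  have "\<bar>b\<^sup>2 - a\<^sup>2 - 2 * a * (b - a)\<bar> \<le> 2 * (b - a)\<^sup>2" for a b :: real
  proof -
    have "b\<^sup>2 - a\<^sup>2 - 2 * a * (b - a) = (b - a)\<^sup>2" by (simp add: power2_eq_square algebra_simps)
    then show ?thesis by simp
  qed
  then have t2: "(\<lambda>x. (f x)\<^sup>2) \<in> F"
    "(\<lambda>n. \<E> (\<lambda>x. slice_sum f R (\<lambda>t. 2 * t) n x - (f x)\<^sup>2)) \<longlonglongrightarrow> 0"
    using slice_sum_tendsto[OF f R(1) R', of 2 "\<lambda>t. t\<^sup>2" "\<lambda>t. 2 * t"] continuous_on_power[OF continuous_on_id, of UNIV 2]
    by (auto simp: id_def)
  \<comment> \<open>The constant 6 R serves both bounds: b + 2 a \<le> 3 R here, and 3 (b + a) \<le>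
    6 R for the Lipschitz estimate.\<close>
  have tay3: "\<bar>b^3 - a^3 - 3 * a\<^sup>2 * (b - a)\<bar> \<le> 6 * R * (b - a)\<^sup>2" if "0 \<le> a" "a \<le> b" "b \<le> R" for a b :: real
  proof -
    have "b^3 - a^3 - 3 * a\<^sup>2 * (b - a) = (b + 2 * a) * (b - a)\<^sup>2"
      by (simp add: power2_eq_square power3_eq_cube algebra_simps)
    moreover have "(b + 2 * a) * (b - a)\<^sup>2 \<le> 6 * R * (b - a)\<^sup>2" using that by (intro mult_right_mono) auto
    ultimately show ?thesis using that by simp
  qed
  have lip3: "\<bar>3 * b\<^sup>2 - 3 * a\<^sup>2\<bar> \<le> 6 * R * (b - a)" if "0 \<le> a" "a \<le> b" "b \<le> R" for a b :: real
  proof -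
    have "3 * b\<^sup>2 - 3 * a\<^sup>2 = (3 * (b + a)) * (b - a)" by (simp add: power2_eq_square algebra_simps)
    moreover have "(3 * (b + a)) * (b - a) \<le> 6 * R * (b - a)" using that by (intro mult_right_mono) auto
    ultimately show ?thesis using that by simp
  qed
  have t3: "(\<lambda>x. (f x)^3) \<in> F"
    "(\<lambda>n. \<E> (\<lambda>x. slice_sum f R (\<lambda>t. 3 * t\<^sup>2) n x - (f x)^3)) \<longlonglongrightarrow> 0"
    using slice_sum_tendsto[OF f R(1) R', of "6 * R" "\<lambda>t. t^3" "\<lambda>t. 3 * t\<^sup>2"] tay3 lip3 R(1)
      continuous_on_power[OF continuous_on_id, of UNIV 3] by (auto simp: id_def)
  show "(\<lambda>x. (f x)\<^sup>2) \<in> F" "(\<lambda>x. (f x)^3) \<in> F" by fact+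
  note sF = slice_sum_F[OF f R(1)]
  have eq: "3 * \<E> (slice_sum f R (\<lambda>t. 2 * t) n)
     = 4 * E (slice_sum f R (\<lambda>_. 1) n) (slice_sum f R (\<lambda>t. 3 * t\<^sup>2) n)" for n
    unfolding E_slice_sum[OF f R(1)] sum_distrib_left
    by (rule sum.cong[OF refl]) (simp add: power2_eq_square)
  have lim1: "(\<lambda>n. 3 * \<E> (slice_sum f R (\<lambda>t. 2 * t) n))
      \<longlonglongrightarrow> 3 * \<E> (\<lambda>x. (f x)\<^sup>2)"
    by (intro tendsto_mult_left E_tendsto_diag sF t2)
  have lim2: "(\<lambda>n. 4 * E (slice_sum f R (\<lambda>_. 1) n) (slice_sum f R (\<lambda>t. 3 * t\<^sup>2) n))
      \<longlonglongrightarrow> 4 * E (\<lambda>x. f x) (\<lambda>x. (f x)^3)"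
    by (intro tendsto_mult_left E_tendsto sF t1 t3)
  show "3 * \<E> (\<lambda>x. (f x)\<^sup>2) = 4 * E f (\<lambda>x. (f x)^3)"
    by (rule LIMSEQ_unique[OF lim1[unfolded eq] lim2])
qed

subsection \<open>The core is an algebra\<close>

lemma Core_contraction:
  assumes "f \<in> Ccore F"
  shows "(\<lambda>x. max 0 (min 1 (f x))) \<in> Ccore F"
proof (rule CoreI)
  show "(\<lambda>x. max 0 (min 1 (f x))) \<in> F" by (rule unit_contraction[OF Core_F[OF assms]])
  show "continuous_on UNIV (\<lambda>x. max 0 (min 1 (f x)))" by (intro continuous_intros Core_cont assms)
  show "compact_support (\<lambda>x. max 0 (min 1 (f x)))"
    by (rule compact_support_mono[OF Core_supp[OF assms]]) auto
qed

text \<open>Dividing by a bound R makes the upper truncation of the unit contraction inactive,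
  leaving only the truncation at 0.\<close>

lemma Core_positive_part:
  assumes "f \<in> Ccore F"
  shows "(\<lambda>x. max 0 (f x)) \<in> Ccore F"
proof -
  obtain R where R: "R > 0" "\<And>x. \<bar>f x\<bar> \<le> R" using Core_bounded[OF assms] by blast
  have "max 0 (f x) = R * max 0 (min 1 (inverse R * f x))" for x
  proof -
    have "inverse R * f x \<le> 1" using R(1) abs_le_D1[OF R(2)[of x]] by (simp add: field_simps)
    moreover have "R * (inverse R * f x) = f x" using R(1) by simp
    moreover have "0 \<le> inverse R * f x \<longleftrightarrow> 0 \<le> f x" using R(1) by (simp add: zero_le_mult_iff)
    ultimately show ?thesis by (auto simp: max_def min_def)
  qed
  then show ?thesis using Core_scale[OF Core_contraction[OF Core_scale[OF assms]], of R "inverse R"] by simp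
qed

lemma Core_split:
  assumes "f \<in> Ccore F"
  obtains p q where "p \<in> Ccore F" "\<And>x. p x \<ge> 0" "q \<in> Ccore F" "\<And>x. q x \<ge> 0" "f = (\<lambda>x. p x - q x)"
proof (rule that)
  show "(\<lambda>x. max 0 (f x)) \<in> Ccore F" by (rule Core_positive_part[OF assms])
  show "(\<lambda>x. max 0 (- f x)) \<in> Ccore F" by (rule Core_positive_part[OF Core_minus[OF assms]])
qed auto

lemma Core_square_nonneg:
  assumes "f \<in> Ccore F" "\<And>x. f x \<ge> 0"
  shows "(\<lambda>x. f x * f x) \<in> Ccore F"
proof (rule CoreI)
  show "(\<lambda>x. f x * f x) \<in> F" using square_cube_nonneg(1)[OF assms] by (simp add: power2_eq_square)
  show "continuous_on UNIV (\<lambda>x. f x * f x)" by (intro continuous_intros Core_cont assms)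
  show "compact_support (\<lambda>x. f x * f x)" by (rule compact_support_mono[OF Core_supp[OF assms(1)]]) auto
qed

text \<open>Squares are available on the positive cone only. Polarization gives products of two
  nonnegative functions, and splitting both factors into positive and negative parts gives all of
  them.\<close>

lemma Core_mult:
  assumes "f \<in> Ccore F" "g \<in> Ccore F"
  shows "(\<lambda>x. f x * g x) \<in> Ccore F"
proof -
  have nn: "(\<lambda>x. p x * q x) \<in> Ccore F"
    if p: "p \<in> Ccore F" "\<And>x. p x \<ge> 0" and q: "q \<in> Ccore F" "\<And>x. q x \<ge> 0" for p q
  proof -
    have "(\<lambda>x. (1/2) * (((p x + q x) * (p x + q x) - p x * p x) - q x * q x)) \<in> Ccore F"
      by (intro Core_scale Core_diff Core_square_nonneg Core_add) (use p q in auto)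
    moreover have "(\<lambda>x. (1/2) * (((p x + q x) * (p x + q x) - p x * p x) - q x * q x)) = (\<lambda>x. p x * q x)"
      by (auto simp: algebra_simps)
    ultimately show ?thesis by simp
  qed
  obtain p q where f: "p \<in> Ccore F" "\<And>x. p x \<ge> 0" "q \<in> Ccore F" "\<And>x. q x \<ge> 0" "f = (\<lambda>x. p x - q x)"
    using Core_split[OF assms(1)] by metis
  obtain r s where g: "r \<in> Ccore F" "\<And>x. r x \<ge> 0" "s \<in> Ccore F" "\<And>x. s x \<ge> 0" "g = (\<lambda>x. r x - s x)"
    using Core_split[OF assms(2)] by metis
  have "(\<lambda>x. (p x * r x + q x * s x) - (p x * s x + q x * r x)) \<in> Ccore F"
    by (intro Core_diff Core_add nn f(1-4) g(1-4))
  moreover have "(\<lambda>x. (p x * r x + q x * s x) - (p x * s x + q x * r x)) = (\<lambda>x. f x * g x)"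
    unfolding f(5) g(5) by (auto simp: algebra_simps)
  ultimately show ?thesis by simp
qed

lemmas Core_closed = Core_add Core_scale Core_diff Core_minus Core_mult

subsection \<open>The Leibniz defect\<close>

text \<open>The defect of the Leibniz rule for the energy measure turns out to be a totally symmetric
  quadrilinear form, so it suffices that it vanishes on the diagonal of the positive cone.\<close>

definition defect :: "('a \<Rightarrow> real) \<Rightarrow> ('a \<Rightarrow> real) \<Rightarrow> ('a \<Rightarrow> real) \<Rightarrow> ('a \<Rightarrow> real) \<Rightarrow> real" where
  "defect f g h k =
     E (\<lambda>x. f x * g x) (\<lambda>x. h x * k x) + E (\<lambda>x. f x * h x) (\<lambda>x. g x * k x) + E (\<lambda>x. f x * k x) (\<lambda>x. g x * h x)
     - E f (\<lambda>x. g x * (h x * k x)) - E g (\<lambda>x. f x * (h x * k x))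
     - E h (\<lambda>x. f x * (g x * k x)) - E k (\<lambda>x. f x * (g x * h x))"

lemma defect_swap12:
  assumes "f \<in> Ccore F" "g \<in> Ccore F" "h \<in> Ccore F" "k \<in> Ccore F"
  shows "defect f g h k = defect g f h k"
proof -
  have "E (\<lambda>x. f x * h x) (\<lambda>x. g x * k x) = E (\<lambda>x. g x * k x) (\<lambda>x. f x * h x)"
    "E (\<lambda>x. f x * k x) (\<lambda>x. g x * h x) = E (\<lambda>x. g x * h x) (\<lambda>x. f x * k x)"
    by (intro E_sym Core_F Core_mult assms)+
  moreover have "(\<lambda>x. f x * g x) = (\<lambda>x. g x * f x)" "(\<lambda>x. f x * (g x * k x)) = (\<lambda>x. g x * (f x * k x))"
    "(\<lambda>x. f x * (g x * h x)) = (\<lambda>x. g x * (f x * h x))"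
    by (auto simp: mult_ac)
  ultimately show ?thesis unfolding defect_def by simp
qed

lemma defect_swap23:
  assumes "f \<in> Ccore F" "g \<in> Ccore F" "h \<in> Ccore F" "k \<in> Ccore F"
  shows "defect f g h k = defect f h g k"
proof -
  have "(\<lambda>x. h x * k x) = (\<lambda>x. k x * h x)" "(\<lambda>x. g x * h x) = (\<lambda>x. h x * g x)"
    "(\<lambda>x. g x * (h x * k x)) = (\<lambda>x. h x * (g x * k x))"
    by (auto simp: mult_ac)
  then show ?thesis unfolding defect_def by (simp add: mult_ac)
qed

lemma defect_swap34:
  assumes "f \<in> Ccore F" "g \<in> Ccore F" "h \<in> Ccore F" "k \<in> Ccore F"
  shows "defect f g h k = defect f g k h"
proof -
  have "(\<lambda>x. h x * k x) = (\<lambda>x. k x * h x)" "(\<lambda>x. g x * (h x * k x)) = (\<lambda>x. g x * (k x * h x))"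
    "(\<lambda>x. f x * (h x * k x)) = (\<lambda>x. f x * (k x * h x))"
    by (auto simp: mult_ac)
  then show ?thesis unfolding defect_def by simp
qed

lemmas defect_swaps = defect_swap12 defect_swap23 defect_swap34

text \<open>Computed in the first slot alone; adjacent transpositions carry linearity to the
  remaining slots.\<close>

lemma defect_linear1:
  assumes "f \<in> Ccore F" "f' \<in> Ccore F" "g \<in> Ccore F" "h \<in> Ccore F" "k \<in> Ccore F"
  shows "defect (\<lambda>x. f x + c * f' x) g h k = defect f g h k + c * defect f' g h k"
  using assms unfolding defect_def
  by (simp add: distrib_right mult.assoc E_add E_add_right E_scale E_scale_right Core_F Core_closed)
     (simp add: algebra_simps)

lemma defect_linear2:
  assumes "f \<in> Ccore F" "f' \<in> Ccore F" "g \<in> Ccore F" "h \<in> Ccore F" "k \<in> Ccore F"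
  shows "defect g (\<lambda>x. f x + c * f' x) h k = defect g f h k + c * defect g f' h k"
  using assms by (simp add: defect_swap12[of g] defect_linear1 Core_closed)

lemma defect_linear3:
  assumes "f \<in> Ccore F" "f' \<in> Ccore F" "g \<in> Ccore F" "h \<in> Ccore F" "k \<in> Ccore F"
  shows "defect g h (\<lambda>x. f x + c * f' x) k = defect g h f k + c * defect g h f' k"
  using assms by (simp add: defect_swap23[of g h] defect_linear2 Core_closed)

lemma defect_linear4:
  assumes "f \<in> Ccore F" "f' \<in> Ccore F" "g \<in> Ccore F" "h \<in> Ccore F" "k \<in> Ccore F"
  shows "defect g h k (\<lambda>x. f x + c * f' x) = defect g h k f + c * defect g h k f'"
  using assms by (simp add: defect_swap34[of g h k] defect_linear3 Core_closed)

text \<open>With equal arguments the defect collapses to 3 E(f^2, f^2) - 4 E(f, f^3).\<close>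

lemma defect_diag:
  assumes "f \<in> Ccore F" "\<And>x. f x \<ge> 0"
  shows "defect f f f f = 0"
  using square_cube_nonneg(3)[OF assms] unfolding defect_def
  by (simp add: power2_eq_square power3_eq_cube mult.assoc)

text \<open>The positive cone spans the core, so a multilinear form can be tested on it one slot at
  a time.\<close>

lemma linear_vanishes_on_Core:
  assumes "\<And>p. p \<in> Ccore F \<Longrightarrow> (\<And>x. p x \<ge> 0) \<Longrightarrow> L p = (0::real)"
    and "\<And>p q c. p \<in> Ccore F \<Longrightarrow> q \<in> Ccore F \<Longrightarrow> L (\<lambda>x. p x + c * q x) = L p + c * L q"
    and "f \<in> Ccore F"
  shows "L f = 0"
proof -
  obtain p q where f: "p \<in> Ccore F" "\<And>x. p x \<ge> 0" "q \<in> Ccore F" "\<And>x. q x \<ge> 0" "f = (\<lambda>x. p x - q x)"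
    using Core_split[OF assms(3)] by metis
  then show ?thesis using assms(1)[of p] assms(1)[of q] assms(2)[of p q "-1"] by simp
qed

text \<open>The diagonal value at p + c q is a quartic polynomial in c, known to vanish only for c
  \<ge> 0, where the argument stays in the cone. That suffices to extract the middle coefficient
  \<open>defect p p q q\<close>. The last two slots and then the first two are polarized, each time
  passing from the cone to the whole core.\<close>

lemma defect_zero:
  assumes C: "f \<in> Ccore F" "g \<in> Ccore F" "h \<in> Ccore F" "k \<in> Ccore F"
  shows "defect f g h k = 0"
proof -
  have pp: "defect p p q q = 0"
    if p: "p \<in> Ccore F" "\<And>x. p x \<ge> 0" and q: "q \<in> Ccore F" "\<And>x. q x \<ge> 0" for p q
  proof -
    have "4 * c * defect p p p q + 6 * c\<^sup>2 * defect p p q q + 4 * c^3 * defect p q q q = 0" if "c \<ge> 0" for c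
    proof -
      define r where "r = (\<lambda>x. p x + c * q x)"
      have r: "r \<in> Ccore F" "\<And>x. r x \<ge> 0" unfolding r_def using p q that by (auto intro!: Core_closed)
      have s: "defect p p q p = defect p p p q" "defect p q p p = defect p p p q" "defect q p p p = defect p p p q"
        "defect p q p q = defect p p q q" "defect q p p q = defect p p q q" "defect p q q p = defect p p q q"
        "defect q p q p = defect p p q q" "defect q q p p = defect p p q q"
        "defect q p q q = defect p q q q" "defect q q p q = defect p q q q" "defect q q q p = defect p q q q"
        using p(1) q(1) by (metis defect_swaps)+
      have "0 = defect r r r r" using defect_diag[OF r] by simp
      also have "\<dots> = defect p p p p + 4 * c * defect p p p q + 6 * c\<^sup>2 * defect p p q q
          + 4 * c^3 * defect p q q q + c^4 * defect q q q q"
        using p(1) q(1) r(1)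
        by (simp add: r_def defect_linear1 defect_linear2 defect_linear3 defect_linear4 Core_closed s)
           (simp add: algebra_simps power2_eq_square power3_eq_cube power4_eq_xxxx)
      finally show ?thesis using defect_diag[OF p] defect_diag[OF q] by simp
    qed
    \<comment> \<open>Three distinct positive values of c determine the three middle coefficients,
      by a Vandermonde argument.\<close>
    from this[of 1] this[of 2] this[of 3] show ?thesis by simp
  qed
  have 1: "defect p p q r = 0"
    if p: "p \<in> Ccore F" "\<And>x. p x \<ge> 0" and q: "q \<in> Ccore F" "\<And>x. q x \<ge> 0" and r: "r \<in> Ccore F" "\<And>x. r x \<ge> 0" for p q r
  proof -
    have "defect p p (\<lambda>x. q x + 1 * r x) (\<lambda>x. q x + 1 * r x) = 0"
      by (rule pp) (use p q r in \<open>auto intro!: Core_closed\<close>)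
    moreover have "defect p p (\<lambda>x. q x + 1 * r x) (\<lambda>x. q x + 1 * r x)
        = defect p p q q + 1 * defect p p q r + (1 * defect p p r q + 1 * 1 * defect p p r r)"
      using p(1) q(1) r(1) by (simp only: defect_linear3 defect_linear4 Core_closed distrib_left)
    ultimately show ?thesis using pp[OF p q] pp[OF p r] defect_swap34[OF p(1) p(1) q(1) r(1)] by simp
  qed
  have 2: "defect p p q r = 0"
    if p: "p \<in> Ccore F" "\<And>x. p x \<ge> 0" and q: "q \<in> Ccore F" and r: "r \<in> Ccore F" for p q r
  proof (rule linear_vanishes_on_Core[of "defect p p q", OF _ _ r])
    fix r assume r: "r \<in> Ccore F" "\<And>x. r x \<ge> 0"
    show "defect p p q r = 0"
      by (rule linear_vanishes_on_Core[of "\<lambda>q. defect p p q r", OF _ _ q])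
         (use 1[OF p _ _ r] defect_linear3 p r in auto)
  qed (use defect_linear4 p q in auto)
  have 3: "defect p q h k = 0" if p: "p \<in> Ccore F" "\<And>x. p x \<ge> 0" and q: "q \<in> Ccore F" "\<And>x. q x \<ge> 0" for p q
  proof -
    have "defect (\<lambda>x. p x + 1 * q x) (\<lambda>x. p x + 1 * q x) h k = 0"
      by (rule 2) (use p q C in \<open>auto intro!: Core_closed\<close>)
    moreover have "defect (\<lambda>x. p x + 1 * q x) (\<lambda>x. p x + 1 * q x) h k
        = defect p p h k + 1 * defect p q h k + (1 * defect q p h k + 1 * 1 * defect q q h k)"
      using p(1) q(1) C by (simp only: defect_linear1 defect_linear2 Core_closed distrib_left)
    ultimately show ?thesis using 2[OF p C(3,4)] 2[OF q C(3,4)] defect_swap12[OF p(1) q(1) C(3,4)] by simp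
  qed
  show ?thesis
  proof (rule linear_vanishes_on_Core[of "\<lambda>f. defect f g h k", OF _ _ C(1)])
    fix p assume p: "p \<in> Ccore F" "\<And>x. p x \<ge> 0"
    show "defect p g h k = 0"
      by (rule linear_vanishes_on_Core[of "\<lambda>g. defect p g h k", OF _ _ C(2)])
         (use 3[OF p] defect_linear2 p C in auto)
  qed (use defect_linear1 C in auto)
qed

text \<open>\<open>wgam \<phi> f g\<close> is the integral of \<open>\<phi>\<close> against the energy measure of \<open>f\<close> and \<open>g\<close>.\<close>

definition wgam :: "('a \<Rightarrow> real) \<Rightarrow> ('a \<Rightarrow> real) \<Rightarrow> ('a \<Rightarrow> real) \<Rightarrow> real" where
  "wgam \<phi> f g = (E (\<lambda>x. \<phi> x * f x) g + E (\<lambda>x. \<phi> x * g x) f - E \<phi> (\<lambda>x. f x * g x)) / 2"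

lemma wgam_diag: "wgam \<phi> f f = E (\<lambda>x. \<phi> x * f x) f - E \<phi> (\<lambda>x. (f x)\<^sup>2) / 2"
  unfolding wgam_def by (simp add: power2_eq_square field_simps)

lemma wgam_sym: "wgam \<phi> f g = wgam \<phi> g f"
  unfolding wgam_def by (simp add: mult.commute add.commute)

lemma wgam_add:
  assumes "\<phi> \<in> Ccore F" "f \<in> Ccore F" "g \<in> Ccore F" "h \<in> Ccore F"
  shows "wgam \<phi> (\<lambda>x. f x + g x) h = wgam \<phi> f h + wgam \<phi> g h"
  using assms unfolding wgam_def
  by (simp add: distrib_left distrib_right E_add E_add_right Core_F Core_closed add_divide_distrib diff_divide_distrib)

lemma wgam_scale:
  assumes "\<phi> \<in> Ccore F" "f \<in> Ccore F" "h \<in> Ccore F"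
  shows "wgam \<phi> (\<lambda>x. c * f x) h = c * wgam \<phi> f h"
  using assms unfolding wgam_def
  by (simp add: mult.assoc mult.left_commute[of _ c] E_scale E_scale_right Core_F Core_closed) (simp add: algebra_simps)

lemma wgam_diff:
  assumes "\<phi> \<in> Ccore F" "f \<in> Ccore F" "g \<in> Ccore F" "h \<in> Ccore F"
  shows "wgam \<phi> (\<lambda>x. f x - g x) h = wgam \<phi> f h - wgam \<phi> g h"
  using wgam_add[OF assms(1,2) Core_scale[OF assms(3), of "-1"] assms(4)] wgam_scale[OF assms(1,3,4), of "-1"] by simp

lemma wgam_add_right:
  assumes "\<phi> \<in> Ccore F" "f \<in> Ccore F" "g \<in> Ccore F" "h \<in> Ccore F"
  shows "wgam \<phi> h (\<lambda>x. f x + g x) = wgam \<phi> h f + wgam \<phi> h g"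
  using wgam_add[OF assms] by (simp add: wgam_sym[of \<phi> h])

lemma wgam_diff_right:
  assumes "\<phi> \<in> Ccore F" "f \<in> Ccore F" "g \<in> Ccore F" "h \<in> Ccore F"
  shows "wgam \<phi> h (\<lambda>x. f x - g x) = wgam \<phi> h f - wgam \<phi> h g"
  using wgam_diff[OF assms] by (simp add: wgam_sym[of \<phi> h])

lemma wgam_scale_right:
  assumes "\<phi> \<in> Ccore F" "f \<in> Ccore F" "h \<in> Ccore F"
  shows "wgam \<phi> h (\<lambda>x. c * f x) = c * wgam \<phi> h f"
  using wgam_scale[OF assms] by (simp add: wgam_sym[of \<phi> h])

lemmas wgam_bilinear = wgam_add wgam_add_right wgam_diff wgam_diff_right wgam_scale wgam_scale_right

text \<open>Expanded by definition, twice the difference of the two sides is exactly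
  \<open>defect \<phi> f g h\<close>; the term E(\<phi> f g, h) occurs on both sides once and in the
  second summand once more.\<close>

lemma wgam_leibniz:
  assumes "\<phi> \<in> Ccore F" "f \<in> Ccore F" "g \<in> Ccore F" "h \<in> Ccore F"
  shows "wgam \<phi> (\<lambda>x. f x * g x) h = wgam (\<lambda>x. \<phi> x * f x) g h + wgam (\<lambda>x. \<phi> x * g x) f h"
proof -
  have "E h (\<lambda>x. \<phi> x * (f x * g x)) = E (\<lambda>x. \<phi> x * (f x * g x)) h"
    "E g (\<lambda>x. \<phi> x * (f x * h x)) = E (\<lambda>x. \<phi> x * (f x * h x)) g"
    "E f (\<lambda>x. \<phi> x * (g x * h x)) = E (\<lambda>x. \<phi> x * (g x * h x)) f"
    using assms by (auto intro!: E_sym Core_F Core_mult)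
  moreover have "(\<lambda>x. \<phi> x * (g x * f x)) = (\<lambda>x. \<phi> x * (f x * g x))" by (auto simp: mult_ac)
  ultimately show ?thesis
    using defect_zero[OF assms] unfolding defect_def wgam_def by (simp add: mult.assoc field_simps)
qed

subsection \<open>Cut-off functions\<close>

lemma compact_neighbourhood:
  fixes K :: "'a set"
  assumes "compact K"
  obtains V K' where "open V" "compact K'" "K \<subseteq> V" "V \<subseteq> K'"
proof -
  have "\<exists>U C. open U \<and> compact C \<and> x \<in> U \<and> U \<subseteq> C" for x :: 'a
    using lc unfolding locally_compact_space_def by (auto simp flip: open_openin)
  then obtain U C where UC: "\<And>x. open (U x)" "\<And>x. compact (C x)" "\<And>x. x \<in> U x" "\<And>x. U x \<subseteq> (C x :: 'a set)"
    by metis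
  obtain D where D: "D \<subseteq> K" "finite D" "K \<subseteq> (\<Union>x\<in>D. U x)"
    using compactE_image[OF assms, of K U] UC by (metis UN_I subsetI)
  show ?thesis
  proof (rule that)
    show "open (\<Union>x\<in>D. U x)" using UC(1) by blast
    show "compact (\<Union>x\<in>D. C x)" using D(2) UC(2) by (intro compact_UN) auto
    show "K \<subseteq> (\<Union>x\<in>D. U x)" by (rule D(3))
    show "(\<Union>x\<in>D. U x) \<subseteq> (\<Union>x\<in>D. C x)" using UC(4) by (intro UN_mono) auto
  qed
qed

text \<open>A continuous Urysohn function \<psi>, equal to 1 on a compact neighbourhood of K, need
  not lie in F. Regularity gives a core function g within 1/2 of \<psi>, and the unit contraction of
  2 g equals 1 exactly wherever \<psi> = 1. The value 1 is wanted on an open set because strong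
  locality requires constancy there.\<close>

lemma cutoff:
  assumes "compact K"
  obtains \<theta> U where "\<theta> \<in> Ccore F" "open U" "K \<subseteq> U" "\<And>x. x \<in> U \<Longrightarrow> \<theta> x = 1" "\<And>x. 0 \<le> \<theta> x" "\<And>x. \<theta> x \<le> 1"
proof -
  obtain U K1 where U: "open U" "compact K1" "K \<subseteq> U" "U \<subseteq> K1" using compact_neighbourhood[OF assms] .
  obtain V K2 where V: "open V" "compact K2" "K1 \<subseteq> V" "V \<subseteq> K2" using compact_neighbourhood[OF U(2)] .
  \<comment> \<open>The distance to the empty set is 0 by convention, so V = UNIV needs its own
    value.\<close>
  define h where "h = (\<lambda>x. if V = UNIV then 1 else infdist x (- V))"
  have hc: "continuous_on UNIV h" unfolding h_def by (cases "V = UNIV") (auto intro!: continuous_intros)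
  have hpos: "h x > 0" if "x \<in> V" for x
  proof (cases "V = UNIV")
    case False
    then have "h x = infdist x (- V)" by (simp add: h_def)
    moreover have "infdist x (- V) \<noteq> 0"
      using in_closed_iff_infdist_zero[of "- V" x] that False V(1) by (auto simp: closed_Compl)
    ultimately show ?thesis using infdist_nonneg[of x "- V"] by simp
  qed (simp add: h_def)
  have h0: "h x = 0" if "x \<notin> V" for x using that by (auto simp: h_def)
  have hnn: "h x \<ge> 0" for x by (simp add: h_def infdist_nonneg)
  obtain \<delta> where \<delta>: "\<delta> > 0" "\<And>x. x \<in> K1 \<Longrightarrow> h x \<ge> \<delta>"
  proof (cases "K1 = {}")
    case True then show ?thesis using that[of 1] by auto
  next
    case False
    obtain x where "x \<in> K1" "\<forall>y\<in>K1. h x \<le> h y"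
      using continuous_attains_inf[OF U(2) False, of h] continuous_on_subset[OF hc] by auto
    then show ?thesis using that[of "h x"] hpos V(3) by auto
  qed
  define \<psi> where "\<psi> = (\<lambda>x. min 1 (h x / \<delta>))"
  have \<psi>c: "continuous_on UNIV \<psi>" unfolding \<psi>_def using \<delta>(1) by (intro continuous_intros hc) auto
  have "{x. \<psi> x \<noteq> 0} \<subseteq> K2" using h0 V(4) by (force simp: \<psi>_def)
  then have "closure {x. \<psi> x \<noteq> 0} \<subseteq> K2" using compact_imp_closed[OF V(2)] by (rule closure_minimal)
  then have "compact_support \<psi>"
    unfolding compact_support_def by (metis V(2) closed_closure compact_Int_closed inf.absorb_iff2)
  then obtain g where g: "g \<in> Ccore F" "\<And>x. \<bar>\<psi> x - g x\<bar> < 1/2"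
    using regular \<psi>c unfolding regular_form_def by (metis half_gt_zero zero_less_one)
  show ?thesis
  proof (rule that[of "\<lambda>x. max 0 (min 1 (2 * g x))" U])
    show "(\<lambda>x. max 0 (min 1 (2 * g x))) \<in> Ccore F" by (intro Core_contraction Core_scale g)
    fix x assume "x \<in> U"
    then have "\<psi> x = 1" using \<delta> U(4) by (auto simp: \<psi>_def min_def field_simps)
    then have "g x > 1/2" using g(2)[of x] by linarith
    then show "max 0 (min 1 (2 * g x)) = 1" by auto
  qed (use U in auto)
qed

section \<open>Almost everywhere statements from compact sets and core test functions\<close>

lemma compact_exhaustion:
  obtains K :: "nat \<Rightarrow> 'a set" where "\<And>n. compact (K n)" "\<And>x. \<exists>N. \<forall>n\<ge>N. x \<in> K n"
proof -
  define \<F> where "\<F> = {U :: 'a set. open U \<and> (\<exists>C. compact C \<and> U \<subseteq> C)}"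
  obtain \<F>' where \<F>': "\<F>' \<subseteq> \<F>" "countable \<F>'" "\<Union>\<F>' = \<Union>\<F>"
    using Lindelof[of \<F>] by (auto simp: \<F>_def)
  have "x \<in> \<Union>\<F>" for x
    using compact_neighbourhood[of "{x}"] unfolding \<F>_def by (metis (mono_tags, lifting) Union_iff compact_sing insert_subset mem_Collect_eq)
  then have un: "\<Union>\<F>' = UNIV" using \<F>'(3) by auto
  have "\<forall>U\<in>\<F>'. \<exists>C. compact C \<and> U \<subseteq> C" using \<F>'(1) by (auto simp: \<F>_def)
  then obtain C where C: "\<And>U. U \<in> \<F>' \<Longrightarrow> compact (C U) \<and> U \<subseteq> C U" by metis
  have ne: "\<F>' \<noteq> {}" using un by auto
  define K where "K = (\<lambda>n. \<Union>i\<le>n. C (from_nat_into \<F>' i))"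
  show ?thesis
  proof (rule that[of K])
    show "compact (K n)" for n
      unfolding K_def by (intro compact_UN) (use C from_nat_into[OF ne] in auto)
    fix x
    have "x \<in> \<Union>\<F>'" unfolding un by simp
    then obtain U where U: "U \<in> \<F>'" "x \<in> U" by (elim UnionE)
    obtain N where "from_nat_into \<F>' N = U" using from_nat_into_surj[OF \<F>'(2) U(1)] by (elim exE)
    then have "\<forall>n\<ge>N. x \<in> K n" unfolding K_def using C[OF U(1)] U(2) by auto
    then show "\<exists>N. \<forall>n\<ge>N. x \<in> K n" ..
  qed
qed

lemma AE_compactI:
  assumes "\<And>K. compact K \<Longrightarrow> AE x in M. x \<in> K \<longrightarrow> P x"
  shows "AE x in M. P x"
proof -
  obtain K :: "nat \<Rightarrow> 'a set" where K: "\<And>n. compact (K n)" "\<And>x. \<exists>N. \<forall>n\<ge>N. x \<in> K n"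
    by (rule compact_exhaustion) blast
  have "AE x in M. \<forall>n. x \<in> K n \<longrightarrow> P x" using assms[OF K(1)] by (subst AE_all_countable) blast
  then show ?thesis by (rule AE_mp) (use K(2) in \<open>auto intro!: AE_I2\<close>)
qed

text \<open>A set of finite measure has an indicator in L2, which is an L2 limit of core functions
  and, along a subsequence, an almost everywhere limit. The single function \<theta>, a cut-off for
  K, dominates all approximants and so prepares dominated convergence against densities that are
  only locally integrable.\<close>

lemma indicator_approximation:
  assumes A: "A \<in> sets M" "A \<subseteq> K" "compact K"
  obtains \<phi> \<theta> where "\<And>n::nat. \<phi> n \<in> Ccore F" "\<theta> \<in> Ccore F" "\<And>n x. 0 \<le> \<phi> n x" "\<And>n x. \<phi> n x \<le> \<theta> x"
    "\<And>x. \<theta> x \<le> 1" "AE x in M. (\<lambda>n. \<phi> n x) \<longlonglongrightarrow> indicator A x"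
proof -
  have [measurable]: "A \<in> sets M" by fact
  obtain \<theta> U where \<theta>: "\<theta> \<in> Ccore F" "open U" "K \<subseteq> U" "\<And>x. x \<in> U \<Longrightarrow> \<theta> x = 1" "\<And>x. 0 \<le> \<theta> x" "\<And>x. \<theta> x \<le> 1"
    by (rule cutoff[OF A(3)]) blast
  have fin: "emeasure M A < \<infinity>"
    using emeasure_mono[OF A(2)] finite_compact[OF A(3)] compact_imp_closed[OF A(3)]
    by (metis borel_closed le_less_trans sets_M)
  define a where "a = (\<lambda>x. indicator A x :: real)"
  have "(\<lambda>x. (a x)\<^sup>2) = a" by (auto simp: a_def indicator_def)
  then have aL2: "L2r M a" using fin unfolding L2r_def a_def by (auto simp: integrable_indicator_iff)
  have ex: "\<exists>c\<in>Ccore F. (\<integral>x. (c x - a x)\<^sup>2 \<partial>M) < e" if e: "e > 0" for e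
  proof -
    have dense: "\<forall>u. L2r M u \<longrightarrow> (\<forall>e>0. \<exists>v\<in>F. (\<integral>x. (u x - v x)\<^sup>2 \<partial>M) < e)"
      using form by (simp add: sym_dirichlet_form_def)
    obtain v where v: "v \<in> F" "(\<integral>x. (a x - v x)\<^sup>2 \<partial>M) < e / 4"
      using dense aL2 e by (metis divide_pos_pos zero_less_numeral)
    have "sqrt (e / 4) > 0" using e by simp
    then obtain c where c: "c \<in> Ccore F" "E1r M E (\<lambda>x. v x - c x) < sqrt (e / 4)"
      using regular v(1) unfolding regular_form_def by meson
    have cF: "c \<in> F" by (rule Core_F[OF c(1)])
    have "\<E> (\<lambda>x. v x - c x) + (\<integral>x. (v x - c x)\<^sup>2 \<partial>M) < e / 4"
      using c(2) unfolding E1r_def by simp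
    then have "(\<integral>x. (v x - c x)\<^sup>2 \<partial>M) < e / 4" using E_nonneg[OF F_diff[OF v(1) cF]] by linarith
    moreover have "(\<integral>x. (c x - a x)\<^sup>2 \<partial>M) \<le> 2 * (\<integral>x. (c x - v x)\<^sup>2 \<partial>M) + 2 * (\<integral>x. (a x - v x)\<^sup>2 \<partial>M)"
      by (intro L2r_integral_diff_le F_L2 cF v(1) aL2)
    ultimately show ?thesis using v(2) c(1) by (intro bexI[of _ c]) (auto simp: power2_commute[of "c _"])
  qed
  have "\<exists>c. \<forall>n::nat. c n \<in> Ccore F \<and> (\<integral>x. (c n x - a x)\<^sup>2 \<partial>M) < inverse (real (Suc n))"
  proof (rule choice, rule allI)
    fix n :: nat
    have "inverse (real (Suc n)) > 0" by simp
    from ex[OF this] show "\<exists>c. c \<in> Ccore F \<and> (\<integral>x. (c x - a x)\<^sup>2 \<partial>M) < inverse (real (Suc n))" by blast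
  qed
  then obtain c where c: "\<And>n::nat. c n \<in> Ccore F" "\<And>n. (\<integral>x. (c n x - a x)\<^sup>2 \<partial>M) < inverse (real (Suc n))"
    by blast
  have cL2: "L2r M (\<lambda>x. c n x - a x)" for n by (intro L2r_diff F_L2 Core_F c aL2)
  have "(\<lambda>n. \<integral>x. norm ((c n x - a x)\<^sup>2) \<partial>M) \<longlonglongrightarrow> 0"
    by (rule tendsto_sandwich[OF _ _ tendsto_const LIMSEQ_inverse_real_of_nat])
       (use less_imp_le[OF c(2)] in auto)
  then obtain r :: "nat \<Rightarrow> nat" where r: "AE x in M. (\<lambda>n. (c (r n) x - a x)\<^sup>2) \<longlonglongrightarrow> 0"
    using tendsto_L1_AE_subseq[of M "\<lambda>n x. (c n x - a x)\<^sup>2"] cL2 by (auto simp: L2r_def)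
  \<comment> \<open>Contraction to [0, 1] and multiplication by \<theta> both fix the limit, as
    \<theta> = 1 on K and A lies in K.\<close>
  define \<phi> where "\<phi> = (\<lambda>n x. max 0 (min 1 (c (r n) x)) * \<theta> x)"
  show ?thesis
  proof (rule that[of \<phi> \<theta>])
    show "\<phi> n \<in> Ccore F" for n unfolding \<phi>_def by (intro Core_mult Core_contraction c \<theta>)
    show "0 \<le> \<phi> n x" "\<phi> n x \<le> \<theta> x" for n x
      unfolding \<phi>_def using \<theta>(5)[of x] by (auto intro!: mult_left_le_one_le)
    show "AE x in M. (\<lambda>n. \<phi> n x) \<longlonglongrightarrow> indicator A x"
      using r
    proof (rule AE_mp, intro AE_I2 impI)
      fix x assume l: "(\<lambda>n. (c (r n) x - a x)\<^sup>2) \<longlonglongrightarrow> 0"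
      have "(\<lambda>n. c (r n) x - a x) \<longlonglongrightarrow> 0"
        by (rule tendsto_zero_of_square_le_mult[OF _ l, of _ 1]) auto
      then have "(\<lambda>n. c (r n) x) \<longlonglongrightarrow> a x" by (simp add: LIM_zero_iff)
      then have "(\<lambda>n. \<phi> n x) \<longlonglongrightarrow> max 0 (min 1 (a x)) * \<theta> x"
        unfolding \<phi>_def by (intro tendsto_intros)
      moreover have "max 0 (min 1 (a x)) * \<theta> x = indicator A x"
        using \<theta>(3,4) A(2) by (auto simp: a_def indicator_def)
      ultimately show "(\<lambda>n. \<phi> n x) \<longlonglongrightarrow> indicator A x" by simp
    qed
  qed (use \<theta> in auto)
qed

lemma Core_meas: "f \<in> Ccore F \<Longrightarrow> f \<in> borel_measurable M"
  by (intro F_meas Core_F)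

text \<open>The fundamental lemma of the calculus of variations for core test functions:
  approximating the indicators of the positive and of the negative set inside a compact K forces
  both to carry no mass of \<eta>. Identities between densities are reduced to identities for
  \<open>E\<close> by it.\<close>

lemma AE_zero_of_Core_integrals:
  assumes [measurable]: "\<eta> \<in> borel_measurable M"
    and int: "\<And>\<phi>. \<phi> \<in> Ccore F \<Longrightarrow> integrable M (\<lambda>x. \<phi> x * \<eta> x)"
    and zero: "\<And>\<phi>. \<phi> \<in> Ccore F \<Longrightarrow> (\<integral>x. \<phi> x * \<eta> x \<partial>M) = 0"
  shows "AE x in M. \<eta> x = (0::real)"
proof (rule AE_compactI)
  fix K :: "'a set" assume K: "compact K"
  have [measurable]: "K \<in> sets M" using compact_imp_closed[OF K] by (simp add: sets_M)
  have A0: "integrable M (\<lambda>x. indicator A x * \<eta> x)" "(\<integral>x. indicator A x * \<eta> x \<partial>M) = 0"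
    if A: "A \<in> sets M" "A \<subseteq> K" for A
  proof -
    obtain \<phi> \<theta> where \<phi>: "\<And>n::nat. \<phi> n \<in> Ccore F" "\<theta> \<in> Ccore F" "\<And>n x. 0 \<le> \<phi> n x" "\<And>n x. \<phi> n x \<le> \<theta> x"
      "\<And>x. \<theta> x \<le> 1" "AE x in M. (\<lambda>n. \<phi> n x) \<longlonglongrightarrow> indicator A x"
      by (rule indicator_approximation[OF A K]) blast
    have [measurable]: "A \<in> sets M" "\<And>n. \<phi> n \<in> borel_measurable M" using A Core_meas[OF \<phi>(1)] by auto
    have w: "integrable M (\<lambda>x. \<bar>\<theta> x * \<eta> x\<bar>)" using int[OF \<phi>(2)] by simp
    have lim: "AE x in M. (\<lambda>n. \<phi> n x * \<eta> x) \<longlonglongrightarrow> indicator A x * \<eta> x"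
      using \<phi>(6) by (rule AE_mp) (auto intro!: AE_I2 tendsto_intros)
    have bd: "AE x in M. norm (\<phi> n x * \<eta> x) \<le> \<bar>\<theta> x * \<eta> x\<bar>" for n
    proof (rule AE_I2)
      fix x
      have "\<theta> x \<ge> 0" using \<phi>(3,4) order_trans by blast
      then show "norm (\<phi> n x * \<eta> x) \<le> \<bar>\<theta> x * \<eta> x\<bar>"
        using \<phi>(3)[of n x] \<phi>(4)[of n x] by (auto simp: abs_mult intro!: mult_right_mono)
    qed
    show "integrable M (\<lambda>x. indicator A x * \<eta> x)"
      by (rule integrable_dominated_convergence[OF _ _ w lim bd]) auto
    have "(\<lambda>n. \<integral>x. \<phi> n x * \<eta> x \<partial>M) \<longlonglongrightarrow> (\<integral>x. indicator A x * \<eta> x \<partial>M)"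
      by (rule integral_dominated_convergence[OF _ _ w lim bd]) auto
    then show "(\<integral>x. indicator A x * \<eta> x \<partial>M) = 0" using zero[OF \<phi>(1)] by (simp add: LIMSEQ_const_iff)
  qed
  have pos: "AE x in M. indicator {x \<in> K. \<eta> x > 0} x * \<eta> x = 0"
    using A0[of "{x \<in> K. \<eta> x > 0}"]
    by (subst integral_nonneg_eq_0_iff_AE[symmetric]) (auto simp: indicator_def)
  have "AE x in M. - (indicator {x \<in> K. \<eta> x < 0} x * \<eta> x) = 0"
    using A0[of "{x \<in> K. \<eta> x < 0}"]
    by (subst integral_nonneg_eq_0_iff_AE[symmetric]) (auto simp: indicator_def)
  with pos show "AE x in M. x \<in> K \<longrightarrow> \<eta> x = 0"
    by eventually_elim (auto simp: indicator_def split: if_splits)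
qed

subsection \<open>Densities of energy measures\<close>

lemma dens_CD:
  assumes "dens_C M E F f \<gamma>"
  shows "\<gamma> \<in> borel_measurable M" "\<gamma> x \<ge> 0"
    and "\<phi> \<in> Ccore F \<Longrightarrow> integrable M (\<lambda>x. \<phi> x * \<gamma> x)"
    and "\<phi> \<in> Ccore F \<Longrightarrow> (\<integral>x. \<phi> x * \<gamma> x \<partial>M) = wgam \<phi> f f"
  using assms unfolding dens_C_def wgam_diag by auto

lemma dens_C_exists: "f \<in> Ccore F \<Longrightarrow> \<exists>\<gamma>. dens_C M E F f \<gamma>"
  using edom by (auto simp: energy_dominant_def)

text \<open>Transfers a linear relation between the functionals \<open>wgam\<close> to the densities
  themselves. The list of triples (coefficient, function, density) covers relations of any
  length.\<close>

lemma dens_C_combination: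
  fixes s :: "(real \<times> ('a \<Rightarrow> real) \<times> ('a \<Rightarrow> real)) list"
  assumes dens: "\<And>c f \<gamma>. (c, f, \<gamma>) \<in> set s \<Longrightarrow> dens_C M E F f \<gamma>"
    and zero: "\<And>\<phi>. \<phi> \<in> Ccore F \<Longrightarrow> (\<Sum>(c, f, \<gamma>)\<leftarrow>s. c * wgam \<phi> f f) = 0"
  shows "AE x in M. (\<Sum>(c, f, \<gamma>)\<leftarrow>s. c * \<gamma> x) = 0"
proof (rule AE_zero_of_Core_integrals)
  show "(\<lambda>x. \<Sum>(c, f, \<gamma>)\<leftarrow>s. c * \<gamma> x) \<in> borel_measurable M"
    using dens by (induction s) (auto dest!: dens_CD(1) intro!: borel_measurable_add borel_measurable_times)
  have *: "integrable M (\<lambda>x. \<phi> x * (\<Sum>(c, f, \<gamma>)\<leftarrow>s. c * \<gamma> x)) \<and>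
      (\<integral>x. \<phi> x * (\<Sum>(c, f, \<gamma>)\<leftarrow>s. c * \<gamma> x) \<partial>M) = (\<Sum>(c, f, \<gamma>)\<leftarrow>s. c * wgam \<phi> f f)"
    if \<phi>: "\<phi> \<in> Ccore F" for \<phi>
    using dens
  proof (induction s)
    case (Cons p s)
    obtain c f \<gamma> where p: "p = (c, f, \<gamma>)" by (cases p) auto
    have d: "dens_C M E F f \<gamma>" using Cons.prems p by auto
    have IH: "integrable M (\<lambda>x. \<phi> x * (\<Sum>(c, f, \<gamma>)\<leftarrow>s. c * \<gamma> x))"
      "(\<integral>x. \<phi> x * (\<Sum>(c, f, \<gamma>)\<leftarrow>s. c * \<gamma> x) \<partial>M) = (\<Sum>(c, f, \<gamma>)\<leftarrow>s. c * wgam \<phi> f f)"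
      using Cons by auto
    have i: "integrable M (\<lambda>x. c * (\<phi> x * \<gamma> x))" using dens_CD(3)[OF d \<phi>] by auto
    have eq: "(\<lambda>x. \<phi> x * (\<Sum>(c, f, \<gamma>)\<leftarrow>(p # s). c * \<gamma> x))
        = (\<lambda>x. c * (\<phi> x * \<gamma> x) + \<phi> x * (\<Sum>(c, f, \<gamma>)\<leftarrow>s. c * \<gamma> x))"
      by (auto simp: p algebra_simps)
    show ?case
      unfolding eq using Bochner_Integration.integral_add[OF i IH(1)] Bochner_Integration.integrable_add[OF i IH(1)]
        dens_CD(4)[OF d \<phi>] IH(2) by (simp add: p)
  qed simp
  show "integrable M (\<lambda>x. \<phi> x * (\<Sum>(c, f, \<gamma>)\<leftarrow>s. c * \<gamma> x))" if "\<phi> \<in> Ccore F" for \<phi>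
    using *[OF that] by simp
  show "(\<integral>x. \<phi> x * (\<Sum>(c, f, \<gamma>)\<leftarrow>s. c * \<gamma> x) \<partial>M) = 0" if "\<phi> \<in> Ccore F" for \<phi>
    using *[OF that] zero[OF that] by simp
qed

text \<open>The defining identity only tests \<gamma> with core functions, and the constant 1 need
  not be one. If \<theta> = 1 near the support of f, then \<theta> f = f, and E(\<theta>, f^2) = 0
  by strong locality, so \<theta> \<gamma> has integral E(f, f). Along an exhaustion Fatou's lemma
  gives integrability and dominated convergence the value.\<close>

lemma dens_C_integral:
  assumes f: "f \<in> Ccore F" and d: "dens_C M E F f \<gamma>"
  shows "integrable M \<gamma>" and "(\<integral>x. \<gamma> x \<partial>M) = E f f"
proof -
  have [measurable]: "\<gamma> \<in> borel_measurable M" by (rule dens_CD[OF d])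
  obtain K :: "nat \<Rightarrow> 'a set" where K: "\<And>n. compact (K n)" "\<And>x. \<exists>N. \<forall>n\<ge>N. x \<in> K n"
    by (rule compact_exhaustion) blast
  define S where "S = closure {x. f x \<noteq> 0}"
  have S: "compact S" using Core_supp[OF f] by (simp add: S_def compact_support_def)
  have "\<exists>\<theta> U. \<theta> \<in> Ccore F \<and> open U \<and> K n \<union> S \<subseteq> U \<and> (\<forall>x\<in>U. \<theta> x = 1) \<and> (\<forall>x. 0 \<le> \<theta> x \<and> \<theta> x \<le> 1)" for n
    by (rule cutoff[OF compact_Un[OF K(1)[of n] S]]) blast
  then obtain \<theta> U where \<theta>: "\<And>n. \<theta> n \<in> Ccore F" "\<And>n. open (U n)" "\<And>n. K n \<union> S \<subseteq> U n"
    "\<And>n x. x \<in> U n \<Longrightarrow> \<theta> n x = 1" "\<And>n x. 0 \<le> \<theta> n x" "\<And>n x. \<theta> n x \<le> 1"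
    by metis
  have [measurable]: "\<theta> n \<in> borel_measurable M" for n by (rule Core_meas[OF \<theta>(1)])
  have val: "(\<integral>x. \<theta> n x * \<gamma> x \<partial>M) = E f f" for n
  proof -
    have "f x = \<theta> n x * f x" for x
    proof (cases "f x = 0")
      case False
      then have "x \<in> S" unfolding S_def using closure_subset[of "{x. f x \<noteq> 0}"] by auto
      then have "\<theta> n x = 1" using \<theta>(3)[of n] by (intro \<theta>(4)) auto
      then show ?thesis by simp
    qed simp
    then have 1: "(\<lambda>x. \<theta> n x * f x) = f" by auto
    have "E (\<theta> n) (\<lambda>x. (f x)\<^sup>2) = 0"
    proof (rule strong_locality[OF \<theta>(1) _ \<theta>(2) _ \<theta>(4)])
      show "(\<lambda>x. (f x)\<^sup>2) \<in> Ccore F" unfolding power2_eq_square by (intro Core_mult f)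
      show "closure {x. (f x)\<^sup>2 \<noteq> 0} \<subseteq> U n" using \<theta>(3)[of n] by (simp add: S_def)
    qed
    then show ?thesis using dens_CD(4)[OF d \<theta>(1)[of n]] 1 by (simp add: wgam_diag)
  qed
  have lim: "(\<lambda>n. \<theta> n x) \<longlonglongrightarrow> 1" for x
  proof -
    obtain N where "\<forall>n\<ge>N. x \<in> K n" using K(2) by blast
    then have "eventually (\<lambda>n. \<theta> n x = 1) sequentially"
      unfolding eventually_sequentially using \<theta>(3,4) by (metis UnCI subsetD)
    then show ?thesis by (rule tendsto_eventually)
  qed
  have lim\<gamma>: "(\<lambda>n. \<theta> n x * \<gamma> x) \<longlonglongrightarrow> \<gamma> x" for x
    using tendsto_mult_right[OF lim[of x], of "\<gamma> x"] by simp
  have "(\<integral>\<^sup>+x. ennreal (\<gamma> x) \<partial>M) \<le> liminf (\<lambda>n. \<integral>\<^sup>+x. ennreal (\<theta> n x * \<gamma> x) \<partial>M)"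
  proof -
    have "ennreal (\<gamma> x) = liminf (\<lambda>n. ennreal (\<theta> n x * \<gamma> x))" for x
      by (rule lim_imp_Liminf[symmetric]) (auto intro!: lim\<gamma>)
    then have "(\<integral>\<^sup>+x. ennreal (\<gamma> x) \<partial>M) = (\<integral>\<^sup>+x. liminf (\<lambda>n. ennreal (\<theta> n x * \<gamma> x)) \<partial>M)" by simp
    also have "\<dots> \<le> liminf (\<lambda>n. \<integral>\<^sup>+x. ennreal (\<theta> n x * \<gamma> x) \<partial>M)" by (rule nn_integral_liminf) measurable
    finally show ?thesis .
  qed
  also have "(\<integral>\<^sup>+x. ennreal (\<theta> n x * \<gamma> x) \<partial>M) = ennreal (E f f)" for n
    using nn_integral_eq_integral[OF dens_CD(3)[OF d \<theta>(1)[of n]]] val[of n] \<theta>(5) dens_CD(2)[OF d] by simp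
  then have "liminf (\<lambda>n. \<integral>\<^sup>+x. ennreal (\<theta> n x * \<gamma> x) \<partial>M) = ennreal (E f f)"
    by (simp add: Liminf_const)
  finally have "(\<integral>\<^sup>+x. ennreal (norm (\<gamma> x)) \<partial>M) < \<infinity>"
    using dens_CD(2)[OF d] by (simp add: le_less_trans[OF _ ennreal_less_top] less_top)
  then show int: "integrable M \<gamma>" by (intro integrableI_bounded) auto
  have "(\<lambda>n. \<integral>x. \<theta> n x * \<gamma> x \<partial>M) \<longlonglongrightarrow> (\<integral>x. \<gamma> x \<partial>M)"
  proof (rule integral_dominated_convergence[OF _ _ int])
    show "AE x in M. norm (\<theta> n x * \<gamma> x) \<le> \<gamma> x" for n
      using \<theta>(5,6) dens_CD(2)[OF d] by (intro AE_I2) (auto simp: abs_mult intro!: mult_left_le_one_le)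
  qed (use lim\<gamma> in auto)
  then show "(\<integral>x. \<gamma> x \<partial>M) = E f f" unfolding val by (simp add: LIMSEQ_const_iff)
qed

section \<open>L1 continuity of the density and its extension to the whole domain\<close>

text \<open>Since \<Gamma>(f - g, f + g) = \<Gamma>(f) - \<Gamma>(g), the density of (f - g) + b (f
  + g) is \<gamma>u + 2 b (\<gamma> - \<delta>) + b^2 \<gamma>v, and it is nonnegative. Taking b = c
  and b = -c gives the bound; keeping c fixed means that only two exceptional null sets
  occur.\<close>

lemma dens_C_L1_bound:
  assumes f: "f \<in> Ccore F" "dens_C M E F f \<gamma>" and g: "g \<in> Ccore F" "dens_C M E F g \<delta>" and c: "c > 0"
    and u: "dens_C M E F (\<lambda>x. f x - g x) \<gamma>u" and v: "dens_C M E F (\<lambda>x. f x + g x) \<gamma>v"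
  shows "AE x in M. 2 * c * \<bar>\<gamma> x - \<delta> x\<bar> \<le> \<gamma>u x + c\<^sup>2 * \<gamma>v x"
proof -
  have ae: "AE x in M. 0 \<le> \<gamma>u x + 2 * b * (\<gamma> x - \<delta> x) + b\<^sup>2 * \<gamma>v x" for b
  proof -
    define p where "p = (\<lambda>x. (f x - g x) + b * (f x + g x))"
    have "p \<in> Ccore F" unfolding p_def by (intro Core_closed f g)
    then obtain \<gamma>p where p: "dens_C M E F p \<gamma>p" using dens_C_exists by blast
    have "AE x in M. (\<Sum>(c, f, \<gamma>)\<leftarrow>[(1, p, \<gamma>p), (-1, (\<lambda>x. f x - g x), \<gamma>u), (-2 * b, f, \<gamma>), (2 * b, g, \<delta>),
        (-(b\<^sup>2), (\<lambda>x. f x + g x), \<gamma>v)]. c * \<gamma> x) = 0"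
    proof (rule dens_C_combination)
      fix \<phi> assume "\<phi> \<in> Ccore F"
      then show "(\<Sum>(c, f, \<gamma>)\<leftarrow>[(1, p, \<gamma>p), (-1, (\<lambda>x. f x - g x), \<gamma>u), (-2 * b, f, \<gamma>), (2 * b, g, \<delta>),
        (-(b\<^sup>2), (\<lambda>x. f x + g x), \<gamma>v)]. c * wgam \<phi> f f) = 0"
        using f(1) g(1) wgam_sym[of \<phi> g f] unfolding p_def
        by (simp add: wgam_bilinear Core_closed) (simp add: algebra_simps power2_eq_square)
    qed (use p u v f g in auto)
    then show ?thesis
    proof (rule AE_mp, intro AE_I2 impI)
      fix x assume "(\<Sum>(c, f, \<gamma>)\<leftarrow>[(1, p, \<gamma>p), (-1, (\<lambda>x. f x - g x), \<gamma>u), (-2 * b, f, \<gamma>), (2 * b, g, \<delta>),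
        (-(b\<^sup>2), (\<lambda>x. f x + g x), \<gamma>v)]. c * \<gamma> x) = 0"
      then show "0 \<le> \<gamma>u x + 2 * b * (\<gamma> x - \<delta> x) + b\<^sup>2 * \<gamma>v x"
        using dens_CD(2)[OF p, of x] by (simp add: algebra_simps)
    qed
  qed
  show ?thesis using ae[of c] ae[of "-c"] by eventually_elim (use c in \<open>auto simp: abs_if algebra_simps\<close>)
qed

lemma dens_C_L1_le:
  assumes f: "f \<in> Ccore F" "dens_C M E F f \<gamma>" and g: "g \<in> Ccore F" "dens_C M E F g \<delta>" and c: "c > 0"
  shows "(\<integral>x. \<bar>\<gamma> x - \<delta> x\<bar> \<partial>M)
    \<le> (\<E> (\<lambda>x. f x - g x) / c + c * \<E> (\<lambda>x. f x + g x)) / 2"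
proof -
  have uv: "(\<lambda>x. f x - g x) \<in> Ccore F" "(\<lambda>x. f x + g x) \<in> Ccore F" by (intro Core_closed f g)+
  obtain \<gamma>u \<gamma>v where d: "dens_C M E F (\<lambda>x. f x - g x) \<gamma>u" "dens_C M E F (\<lambda>x. f x + g x) \<gamma>v"
    using dens_C_exists uv by blast
  note i = dens_C_integral[OF f] dens_C_integral[OF g] dens_C_integral[OF uv(1) d(1)] dens_C_integral[OF uv(2) d(2)]
  have "(\<integral>x. 2 * c * \<bar>\<gamma> x - \<delta> x\<bar> \<partial>M) \<le> (\<integral>x. \<gamma>u x + c\<^sup>2 * \<gamma>v x \<partial>M)"
    by (rule integral_mono_AE[OF _ _ dens_C_L1_bound[OF f g c d]]) (use i in auto)
  also have "\<dots> = \<E> (\<lambda>x. f x - g x) + c\<^sup>2 * \<E> (\<lambda>x. f x + g x)"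
    using i by simp
  finally show ?thesis using c by (simp add: field_simps power2_eq_square)
qed

lemma dens_C_L1_tendsto:
  assumes u: "\<And>n. u n \<in> Ccore F" "\<And>n. dens_C M E F (u n) (\<gamma> n)"
    and w: "\<And>n. w n \<in> Ccore F" "\<And>n. dens_C M E F (w n) (\<delta> n)"
    and lim: "(\<lambda>n. \<E> (\<lambda>x. u n x - w n x)) \<longlonglongrightarrow> 0"
    and B: "\<And>n. \<E> (\<lambda>x. u n x + w n x) \<le> B"
  shows "(\<lambda>n::nat. \<integral>x. \<bar>\<gamma> n x - \<delta> n x\<bar> \<partial>M) \<longlonglongrightarrow> 0"
proof (rule LIMSEQ_I)
  fix e :: real assume e: "e > 0"
  have B0: "B \<ge> 0" using order_trans[OF E_nonneg B[of 0]] Core_F Core_add u w by blast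
  \<comment> \<open>Makes c times the bounded energy of u n + w n less than e; the energy of u n - w
    n is then required to be below e c, to survive the division by c.\<close>
  define c where "c = e / (B + 1)"
  have c: "c > 0" "c * B < e" unfolding c_def using e B0 by (auto simp: field_simps)
  have ce: "e * c > 0" using e c by simp
  obtain N where N: "\<And>n. n \<ge> N \<Longrightarrow> \<E> (\<lambda>x. u n x - w n x) < e * c"
    using order_tendstoD(2)[OF lim ce] by (auto simp: eventually_sequentially)
  show "\<exists>N. \<forall>n\<ge>N. norm ((\<integral>x. \<bar>\<gamma> n x - \<delta> n x\<bar> \<partial>M) - 0) < e"
  proof (intro exI allI impI)
    fix n assume n: "n \<ge> N"
    define a where "a = \<E> (\<lambda>x. u n x - w n x) / c"
    define b where "b = c * \<E> (\<lambda>x. u n x + w n x)"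
    have "a < e" unfolding a_def using N[OF n] c by (simp add: field_simps)
    moreover have "b \<le> c * B" unfolding b_def using B c by (intro mult_left_mono) auto
    ultimately have "(a + b) / 2 < e" using c(2) by simp
    then have "(\<integral>x. \<bar>\<gamma> n x - \<delta> n x\<bar> \<partial>M) < e"
      by (rule le_less_trans[OF dens_C_L1_le[OF u(1)[of n] u(2)[of n] w(1)[of n] w(2)[of n] c(1), folded a_def b_def]])
    then show "norm ((\<integral>x. \<bar>\<gamma> n x - \<delta> n x\<bar> \<partial>M) - 0) < e" by simp
  qed
qed

lemma dens_C_L1_tendsto_same_limit:
  assumes u: "\<And>n. u n \<in> Ccore F" "\<And>n. dens_C M E F (u n) (\<gamma> n)"
    and w: "\<And>n. w n \<in> Ccore F" "\<And>n. dens_C M E F (w n) (\<delta> n)" and f: "f \<in> F"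
    and lu: "(\<lambda>n. \<E> (\<lambda>x. u n x - f x)) \<longlonglongrightarrow> 0"
    and lw: "(\<lambda>n. \<E> (\<lambda>x. w n x - f x)) \<longlonglongrightarrow> 0"
  shows "(\<lambda>n::nat. \<integral>x. \<bar>\<gamma> n x - \<delta> n x\<bar> \<partial>M) \<longlonglongrightarrow> 0"
proof -
  have uF: "u n \<in> F" and wF: "w n \<in> F" for n using Core_F u w by auto
  obtain K where K: "\<forall>n. norm (\<E> (u n)) \<le> K"
    using E_tendsto_diag[OF uF f lu, THEN convergentI, THEN convergent_imp_Bseq] by (auto simp: Bseq_def)
  obtain L where L: "\<forall>n. norm (\<E> (w n)) \<le> L"
    using E_tendsto_diag[OF wF f lw, THEN convergentI, THEN convergent_imp_Bseq] by (auto simp: Bseq_def)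
  have KL: "\<bar>\<E> (u n)\<bar> \<le> K" "\<bar>\<E> (w n)\<bar> \<le> L" for n using K L by auto
  show ?thesis
  proof (rule dens_C_L1_tendsto[OF u w])
    have z: "(\<lambda>n. 2 * \<E> (\<lambda>x. u n x - f x) + 2 * \<E> (\<lambda>x. w n x - f x)) \<longlonglongrightarrow> 0"
      using lu lw by (auto intro!: tendsto_eq_intros)
    show "(\<lambda>n. \<E> (\<lambda>x. u n x - w n x)) \<longlonglongrightarrow> 0"
      by (rule tendsto_sandwich[OF always_eventually always_eventually tendsto_const z])
         (use E_nonneg F_diff uF wF E_diff_le[OF uF wF f] in auto)
    show "\<E> (\<lambda>x. u n x + w n x) \<le> 2 * K + 2 * L" for n
      using E_add_le[OF uF[of n] wF[of n]] KL[of n] by linarith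
  qed
qed

lemma dens_FD:
  assumes "f \<in> F" "dens_F M E F f \<gamma>"
  obtains u \<delta> where "\<And>n. u n \<in> Ccore F" "\<And>n. dens_C M E F (u n) (\<delta> n)"
    "(\<lambda>n. \<E> (\<lambda>x. u n x - f x)) \<longlonglongrightarrow> 0"
    "(\<lambda>n::nat. \<integral>x. \<bar>\<delta> n x - \<gamma> x\<bar> \<partial>M) \<longlonglongrightarrow> 0"
proof -
  obtain u \<delta> where u: "\<forall>n. u n \<in> Ccore F \<and> dens_C M E F (u n) (\<delta> n)"
    "(\<lambda>n. E1r M E (\<lambda>x. u n x - f x)) \<longlonglongrightarrow> 0"
    "(\<lambda>n::nat. \<integral>x. \<bar>\<delta> n x - \<gamma> x\<bar> \<partial>M) \<longlonglongrightarrow> 0"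
    using assms(2) unfolding dens_F_def by blast
  have "(\<lambda>n. \<E> (\<lambda>x. u n x - f x)) \<longlonglongrightarrow> 0"
    using u(2) E1r_tendsto_iff[of "\<lambda>n x. u n x - f x"] F_diff[OF Core_F assms(1)] u(1) by auto
  then show ?thesis using that[of u \<delta>] u by blast
qed

text \<open>\<open>dens_F\<close> asks for one approximating sequence; here every core sequence
  converging in energy is shown to serve.\<close>

lemma dens_F_L1_tendsto:
  assumes f: "f \<in> F" "dens_F M E F f \<gamma>" and u: "\<And>n. u n \<in> Ccore F" "\<And>n. dens_C M E F (u n) (\<delta> n)"
    and lu: "(\<lambda>n. \<E> (\<lambda>x. u n x - f x)) \<longlonglongrightarrow> 0"
  shows "(\<lambda>n::nat. \<integral>x. \<bar>\<delta> n x - \<gamma> x\<bar> \<partial>M) \<longlonglongrightarrow> 0"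
proof -
  obtain w \<eta> where w: "\<And>n. w n \<in> Ccore F" "\<And>n. dens_C M E F (w n) (\<eta> n)"
    "(\<lambda>n. \<E> (\<lambda>x. w n x - f x)) \<longlonglongrightarrow> 0"
    "(\<lambda>n::nat. \<integral>x. \<bar>\<eta> n x - \<gamma> x\<bar> \<partial>M) \<longlonglongrightarrow> 0"
    by (rule dens_FD[OF f]) blast
  have i: "integrable M (\<delta> n)" "integrable M (\<eta> n)" "integrable M \<gamma>" for n
    using dens_C_integral(1) u w f(2) unfolding dens_F_def by blast+
  have z: "(\<lambda>n. (\<integral>x. \<bar>\<delta> n x - \<eta> n x\<bar> \<partial>M) + (\<integral>x. \<bar>\<eta> n x - \<gamma> x\<bar> \<partial>M)) \<longlonglongrightarrow> 0"
    using tendsto_add[OF dens_C_L1_tendsto_same_limit[OF u w(1,2) f(1) lu w(3)] w(4)] by simp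
  have le: "(\<integral>x. \<bar>\<delta> n x - \<gamma> x\<bar> \<partial>M) \<le> (\<integral>x. \<bar>\<delta> n x - \<eta> n x\<bar> \<partial>M) + (\<integral>x. \<bar>\<eta> n x - \<gamma> x\<bar> \<partial>M)" for n
  proof -
    have "(\<integral>x. \<bar>\<delta> n x - \<gamma> x\<bar> \<partial>M) \<le> (\<integral>x. \<bar>\<delta> n x - \<eta> n x\<bar> + \<bar>\<eta> n x - \<gamma> x\<bar> \<partial>M)"
      by (rule integral_mono) (use i in auto)
    then show ?thesis using i by simp
  qed
  show ?thesis
    by (rule tendsto_sandwich[OF always_eventually always_eventually tendsto_const z]) (use le in auto)
qed

lemma dens_F_unique:
  assumes "f \<in> F" "dens_F M E F f \<gamma>" "dens_F M E F f \<delta>"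
  shows "AE x in M. \<gamma> x = \<delta> x"
proof -
  obtain w \<eta> where w: "\<And>n. w n \<in> Ccore F" "\<And>n. dens_C M E F (w n) (\<eta> n)"
    "(\<lambda>n. \<E> (\<lambda>x. w n x - f x)) \<longlonglongrightarrow> 0"
    "(\<lambda>n::nat. \<integral>x. \<bar>\<eta> n x - \<gamma> x\<bar> \<partial>M) \<longlonglongrightarrow> 0"
    by (rule dens_FD[OF assms(1,2)]) blast
  have i: "integrable M (\<eta> n)" "integrable M \<gamma>" "integrable M \<delta>" for n
    using dens_C_integral(1) w assms unfolding dens_F_def by blast+
  have "(\<lambda>n. (\<integral>x. \<bar>\<eta> n x - \<gamma> x\<bar> \<partial>M) + (\<integral>x. \<bar>\<eta> n x - \<delta> x\<bar> \<partial>M)) \<longlonglongrightarrow> 0"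
    using tendsto_add[OF w(4) dens_F_L1_tendsto[OF assms(1,3) w(1,2,3)]] by simp
  moreover have "(\<integral>x. \<bar>\<gamma> x - \<delta> x\<bar> \<partial>M) \<le> (\<integral>x. \<bar>\<eta> n x - \<gamma> x\<bar> \<partial>M) + (\<integral>x. \<bar>\<eta> n x - \<delta> x\<bar> \<partial>M)" for n
  proof -
    have "(\<integral>x. \<bar>\<gamma> x - \<delta> x\<bar> \<partial>M) \<le> (\<integral>x. \<bar>\<eta> n x - \<gamma> x\<bar> + \<bar>\<eta> n x - \<delta> x\<bar> \<partial>M)"
      by (rule integral_mono) (use i in auto)
    then show ?thesis using i by simp
  qed
  ultimately have "(\<integral>x. \<bar>\<gamma> x - \<delta> x\<bar> \<partial>M) \<le> 0" by (intro LIMSEQ_le_const) auto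
  then have "(\<integral>x. \<bar>\<gamma> x - \<delta> x\<bar> \<partial>M) = 0" by (intro antisym) auto
  then show ?thesis using integral_nonneg_eq_0_iff_AE[of M "\<lambda>x. \<bar>\<gamma> x - \<delta> x\<bar>"] i by auto
qed

lemma Core_approximation:
  assumes "f \<in> F" "\<And>n::nat. e n > 0"
  obtains u where "\<And>n. u n \<in> Ccore F" "\<And>n. \<E> (\<lambda>x. u n x - f x) < e n"
    "\<And>n. (\<integral>x. (u n x - f x)\<^sup>2 \<partial>M) < e n"
proof -
  have "\<exists>u. u \<in> Ccore F \<and> \<E> (\<lambda>x. u x - f x) < e n \<and> (\<integral>x. (u x - f x)\<^sup>2 \<partial>M) < e n" for n
  proof -
    have "sqrt (e n) > 0" using assms(2) by simp
    then obtain u where u: "u \<in> Ccore F" "E1r M E (\<lambda>x. f x - u x) < sqrt (e n)"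
      using regular assms(1) unfolding regular_form_def by meson
    have uF: "u \<in> F" by (rule Core_F[OF u(1)])
    have "\<E> (\<lambda>x. f x - u x) + (\<integral>x. (f x - u x)\<^sup>2 \<partial>M) < e n"
      using u(2) unfolding E1r_def by simp
    moreover have "\<E> (\<lambda>x. f x - u x) = \<E> (\<lambda>x. u x - f x)"
      using assms(1) uF by (simp add: E_bilinear F_closed)
    moreover have "(\<integral>x. (u x - f x)\<^sup>2 \<partial>M) = (\<integral>x. (f x - u x)\<^sup>2 \<partial>M)" by (simp add: power2_commute)
    moreover have "\<E> (\<lambda>x. u x - f x) \<ge> 0" by (intro E_nonneg F_diff uF assms)
    moreover have "(\<integral>x. (u x - f x)\<^sup>2 \<partial>M) \<ge> 0" by simp
    ultimately show ?thesis using u(1) by (intro exI[of _ u]) linarith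
  qed
  then have "\<exists>u. \<forall>n. u n \<in> Ccore F \<and> \<E> (\<lambda>x. u n x - f x) < e n \<and> (\<integral>x. (u n x - f x)\<^sup>2 \<partial>M) < e n"
    by (intro choice) blast
  then show ?thesis using that by blast
qed

text \<open>A Riesz-Fischer argument: approximants with errors below 16^(-n) have densities whose
  successive L1 distances are of order 4^(-n), hence summable. The densities then converge almost
  everywhere, with an integrable dominating function.\<close>

lemma dens_F_exists:
  assumes f: "f \<in> F"
  shows "\<exists>\<gamma>. dens_F M E F f \<gamma>"
proof -
  obtain u where u: "\<And>n. u n \<in> Ccore F" "\<And>n. \<E> (\<lambda>x. u n x - f x) < (1/16)^n"
    "\<And>n. (\<integral>x. (u n x - f x)\<^sup>2 \<partial>M) < (1/16)^n"
    by (rule Core_approximation[where e = "\<lambda>n. (1/16)^n", OF f]) (simp, blast)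
  have uF: "u n \<in> F" for n by (rule Core_F[OF u(1)])
  have pz: "(\<lambda>n. (1/16)^n) \<longlonglongrightarrow> (0::real)" by (rule LIMSEQ_power_zero) simp
  have lE: "(\<lambda>n. \<E> (\<lambda>x. u n x - f x)) \<longlonglongrightarrow> 0"
    by (rule tendsto_sandwich[OF always_eventually always_eventually tendsto_const pz])
       (use E_nonneg F_diff uF f less_imp_le[OF u(2)] in auto)
  have lL: "(\<lambda>n. \<integral>x. (u n x - f x)\<^sup>2 \<partial>M) \<longlonglongrightarrow> 0"
    by (rule tendsto_sandwich[OF always_eventually always_eventually tendsto_const pz])
       (use less_imp_le[OF u(3)] in auto)
  have lE1: "(\<lambda>n. E1r M E (\<lambda>x. u n x - f x)) \<longlonglongrightarrow> 0"
    using lE lL E1r_tendsto_iff[of "\<lambda>n x. u n x - f x"] F_diff uF f by auto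
  have "\<exists>\<gamma>. \<forall>n. dens_C M E F (u n) (\<gamma> n)" by (rule choice) (use dens_C_exists u in auto)
  then obtain \<gamma> where \<gamma>: "\<And>n. dens_C M E F (u n) (\<gamma> n)" by blast
  have i [simp]: "integrable M (\<gamma> n)" for n by (rule dens_C_integral[OF u(1) \<gamma>])
  have [measurable]: "\<gamma> n \<in> borel_measurable M" for n by (rule dens_CD[OF \<gamma>])
  obtain K where K: "\<forall>n. norm (\<E> (u n)) \<le> K"
    using E_tendsto_diag[OF uF f lE, THEN convergentI, THEN convergent_imp_Bseq] by (auto simp: Bseq_def)
  define d where "d = (\<lambda>n x. \<gamma> (Suc n) x - \<gamma> n x)"
  have di [simp]: "integrable M (d n)" for n unfolding d_def by simp
  have [measurable]: "d n \<in> borel_measurable M" for n by (rule borel_measurable_integrable) simp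
  have step: "(\<integral>x. \<bar>d n x\<bar> \<partial>M) \<le> (2 + 2 * K) * (1/4)^n" for n
  proof -
    \<comment> \<open>The weight in \<open>dens_C_L1_le\<close>: the energy of the difference is of
      order c^2 and becomes c after division, while the bounded energy of the sum is multiplied by
      c.\<close>
    define c :: real where "c = (1/4)^n"
    have c: "c > 0" "(1/16)^n = c * c" by (auto simp: c_def simp flip: power_mult_distrib)
    have c': "(1/16)^Suc n \<le> c * c" using c by simp
    define a where "a = \<E> (\<lambda>x. u (Suc n) x - u n x)"
    define b where "b = \<E> (\<lambda>x. u (Suc n) x + u n x)"
    have "a \<le> 4 * (c * c)"
      using E_diff_le[OF uF[of "Suc n"] uF[of n] f] u(2)[of n] u(2)[of "Suc n"] c(2) c' unfolding a_def by linarith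
    then have a: "a / c \<le> 4 * c" using c by (simp add: field_simps)
    have "\<E> (u n) \<le> K" "\<E> (u (Suc n)) \<le> K" using K by (auto simp: abs_le_iff)
    then have "b \<le> 4 * K" using E_add_le[OF uF[of "Suc n"] uF[of n]] unfolding b_def by linarith
    then have b: "c * b \<le> 4 * (c * K)" using c by simp
    have "(\<integral>x. \<bar>d n x\<bar> \<partial>M) \<le> (a / c + c * b) / 2"
      unfolding d_def a_def b_def by (rule dens_C_L1_le[OF u(1) \<gamma> u(1) \<gamma> c(1)])
    also have "\<dots> \<le> (4 * c + 4 * (c * K)) / 2" using a b by (intro divide_right_mono add_mono) auto
    also have "\<dots> = (2 + 2 * K) * c" by (simp add: algebra_simps)
    finally show ?thesis by (simp add: c_def)
  qed
  have sum1: "summable (\<lambda>n. \<integral>x. norm (d n x) \<partial>M)"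
    by (rule summable_comparison_test'[of "\<lambda>n. (2 + 2 * K) * (1/4)^n" 0])
       (use step in \<open>auto intro!: summable_mult summable_geometric\<close>)
  have AEs: "AE x in M. summable (\<lambda>n. norm (d n x))"
  proof -
    have "(\<integral>\<^sup>+x. (\<Sum>n. ennreal (norm (d n x))) \<partial>M) = (\<Sum>n. \<integral>\<^sup>+x. ennreal (norm (d n x)) \<partial>M)"
      by (rule nn_integral_suminf) measurable
    also have "\<dots> = (\<Sum>n. ennreal (\<integral>x. norm (d n x) \<partial>M))"
      by (simp add: nn_integral_eq_integral)
    also have "\<dots> = ennreal (\<Sum>n. \<integral>x. norm (d n x) \<partial>M)" by (rule suminf_ennreal2[OF _ sum1]) simp
    finally have "(\<integral>\<^sup>+x. (\<Sum>n. ennreal (norm (d n x))) \<partial>M) \<noteq> \<infinity>" by simp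
    then have "AE x in M. (\<Sum>n. ennreal (norm (d n x))) \<noteq> \<infinity>"
      by (intro nn_integral_PInf_AE) auto
    then show ?thesis
    proof eventually_elim
      case (elim x)
      then show ?case using summable_suminf_not_top[of "\<lambda>n. norm (d n x)"] by simp
    qed
  qed
  define w where "w = (\<lambda>x. \<Sum>n. norm (d n x))"
  have wi: "integrable M w" unfolding w_def
    by (rule integrable_suminf) (use AEs sum1 in auto)
  \<comment> \<open>\<open>dens_F\<close> demands nonnegativity at every point. Where the series
    converges the sum is a limit of nonnegative values and the maximum changes nothing.\<close>
  define g where "g = (\<lambda>x. max 0 (\<gamma> 0 x + (\<Sum>n. d n x)))"
  have "integrable M (\<lambda>x. \<Sum>n. d n x)" by (rule integrable_suminf) (use AEs sum1 in auto)
  then have gi: "integrable M g" unfolding g_def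
    by (intro integrable_max Bochner_Integration.integrable_add) auto
  have ae: "AE x in M. (\<lambda>n. \<gamma> n x) \<longlonglongrightarrow> g x \<and> (\<forall>n. \<gamma> n x \<le> \<gamma> 0 x + w x)"
    using AEs
  proof (rule AE_mp, intro AE_I2 impI)
    fix x assume s: "summable (\<lambda>n. norm (d n x))"
    have tel: "\<gamma> n x = \<gamma> 0 x + (\<Sum>k<n. d k x)" for n
      unfolding d_def by (simp add: sum_lessThan_telescope[of "\<lambda>k. \<gamma> k x"])
    have "(\<lambda>n. \<Sum>k<n. d k x) \<longlonglongrightarrow> (\<Sum>k. d k x)" by (intro summable_LIMSEQ summable_norm_cancel[OF s])
    then have l: "(\<lambda>n. \<gamma> n x) \<longlonglongrightarrow> \<gamma> 0 x + (\<Sum>k. d k x)"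
      by (subst tel) (intro tendsto_intros)
    then have "0 \<le> \<gamma> 0 x + (\<Sum>k. d k x)" by (rule LIMSEQ_le_const) (use dens_CD(2)[OF \<gamma>] in auto)
    then have "g x = \<gamma> 0 x + (\<Sum>k. d k x)" by (simp add: g_def)
    moreover have "\<gamma> n x \<le> \<gamma> 0 x + w x" for n
    proof -
      have "(\<Sum>k<n. d k x) \<le> (\<Sum>k<n. norm (d k x))" by (intro sum_mono) auto
      also have "\<dots> \<le> w x" unfolding w_def by (rule sum_le_suminf[OF s]) auto
      finally show ?thesis using tel[of n] by simp
    qed
    ultimately show "(\<lambda>n. \<gamma> n x) \<longlonglongrightarrow> g x \<and> (\<forall>n. \<gamma> n x \<le> \<gamma> 0 x + w x)" using l by simp
  qed
  have [measurable]: "g \<in> borel_measurable M" "w \<in> borel_measurable M" using gi wi by auto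
  have "(\<lambda>n. \<integral>x. \<bar>\<gamma> n x - g x\<bar> \<partial>M) \<longlonglongrightarrow> (\<integral>x. 0 \<partial>M)"
  proof (rule integral_dominated_convergence[where w = "\<lambda>x. \<gamma> 0 x + w x + g x"])
    show "AE x in M. (\<lambda>n. \<bar>\<gamma> n x - g x\<bar>) \<longlonglongrightarrow> 0"
      using ae by (rule AE_mp) (auto intro!: AE_I2 tendsto_rabs_zero LIM_zero)
    show "AE x in M. norm \<bar>\<gamma> n x - g x\<bar> \<le> \<gamma> 0 x + w x + g x" for n
      using ae
    proof (rule AE_mp, intro AE_I2 impI)
      fix x assume "(\<lambda>n. \<gamma> n x) \<longlonglongrightarrow> g x \<and> (\<forall>n. \<gamma> n x \<le> \<gamma> 0 x + w x)"
      then have "\<gamma> n x \<le> \<gamma> 0 x + w x" by blast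
      moreover have "\<gamma> n x \<ge> 0" by (rule dens_CD[OF \<gamma>])
      moreover have "g x \<ge> 0" by (simp add: g_def)
      ultimately show "norm \<bar>\<gamma> n x - g x\<bar> \<le> \<gamma> 0 x + w x + g x" by simp
    qed
  qed (use gi wi in auto)
  then have "(\<lambda>n. \<integral>x. \<bar>\<gamma> n x - g x\<bar> \<partial>M) \<longlonglongrightarrow> 0" by simp
  then have "dens_F M E F f g"
    unfolding dens_F_def using gi u(1) \<gamma> lE1 \<open>(\<lambda>n. \<integral>x. \<bar>\<gamma> n x - g x\<bar> \<partial>M) \<longlonglongrightarrow> 0\<close>
    by (intro conjI exI[of _ u] exI[of _ \<gamma>]) (auto simp: g_def)
  then show ?thesis by blast
qed

lemma gam_dens_F: "f \<in> F \<Longrightarrow> dens_F M E F f (gam M E F f)"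
  unfolding gam_def by (rule someI_ex[OF dens_F_exists])

lemma gam_nonneg: "f \<in> F \<Longrightarrow> gam M E F f x \<ge> 0"
  and gam_integrable: "f \<in> F \<Longrightarrow> integrable M (gam M E F f)"
  using gam_dens_F[of f] unfolding dens_F_def by auto

text \<open>Consistency of the two notions on the core: a constant sequence turns a density in the
  sense of \<open>dens_C\<close> into one in the sense of \<open>dens_F\<close>, and uniqueness
  identifies it with the chosen \<open>gam\<close> almost everywhere.\<close>

lemma gam_dens_C:
  assumes f: "f \<in> Ccore F"
  shows "dens_C M E F f (gam M E F f)"
proof -
  have fF: "f \<in> F" by (rule Core_F[OF f])
  obtain \<gamma> where \<gamma>: "dens_C M E F f \<gamma>" using dens_C_exists[OF f] by blast
  have "E1r M E (\<lambda>_. 0) = 0" by (simp add: E1r_def)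
  then have "dens_F M E F f \<gamma>"
    unfolding dens_F_def using dens_C_integral(1)[OF f \<gamma>] dens_CD(1,2)[OF \<gamma>] f \<gamma>
    by (intro conjI exI[of _ "\<lambda>_. f"] exI[of _ "\<lambda>_. \<gamma>"]) auto
  then have ae: "AE x in M. \<gamma> x = gam M E F f x" using dens_F_unique[OF fF _ gam_dens_F[OF fF]] by blast
  have [measurable]: "gam M E F f \<in> borel_measurable M" "\<gamma> \<in> borel_measurable M"
    using gam_integrable[OF fF] dens_CD(1)[OF \<gamma>] by auto
  show ?thesis
    unfolding dens_C_def
  proof (intro conjI ballI allI)
    fix \<phi> assume \<phi>: "\<phi> \<in> Ccore F"
    have [measurable]: "\<phi> \<in> borel_measurable M" by (rule Core_meas[OF \<phi>])
    have ae': "AE x in M. \<phi> x * \<gamma> x = \<phi> x * gam M E F f x" using ae by eventually_elim simp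
    show "integrable M (\<lambda>x. \<phi> x * gam M E F f x)"
      using dens_CD(3)[OF \<gamma> \<phi>] by (subst integrable_cong_AE[OF _ _ ae', symmetric]) auto
    show "(\<integral>x. \<phi> x * gam M E F f x \<partial>M) = E (\<lambda>x. \<phi> x * f x) f - E \<phi> (\<lambda>x. (f x)\<^sup>2) / 2"
      using dens_CD(4)[OF \<gamma> \<phi>] unfolding wgam_diag
      by (subst integral_cong_AE[OF _ _ ae', symmetric]) auto
  qed (use gam_nonneg[OF fF] in auto)
qed

lemma gam_integral: "f \<in> Ccore F \<Longrightarrow> (\<integral>x. gam M E F f x \<partial>M) = E f f"
  by (rule dens_C_integral(2)[OF _ gam_dens_C])

lemma gam_L1_tendsto:
  assumes "f \<in> F" "\<And>n. u n \<in> Ccore F" "(\<lambda>n. \<E> (\<lambda>x. u n x - f x)) \<longlonglongrightarrow> 0"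
  shows "(\<lambda>n::nat. \<integral>x. \<bar>gam M E F (u n) x - gam M E F f x\<bar> \<partial>M) \<longlonglongrightarrow> 0"
  by (rule dens_F_L1_tendsto[OF assms(1) gam_dens_F[OF assms(1)] assms(2) gam_dens_C[OF assms(2)] assms(3)])

subsection \<open>Polarized densities\<close>

lemma gam2_integrable: "f \<in> Ccore F \<Longrightarrow> g \<in> Ccore F \<Longrightarrow> integrable M (gam2 M E F f g)"
  unfolding gam2_def by (intro integrable_divide Bochner_Integration.integrable_diff gam_integrable Core_F Core_closed) auto

lemma
  assumes f: "f \<in> Ccore F" and g: "g \<in> Ccore F" and \<phi>: "\<phi> \<in> Ccore F"
  shows gam2_Core_integrable: "integrable M (\<lambda>x. \<phi> x * gam2 M E F f g x)"
    and gam2_Core_integral: "(\<integral>x. \<phi> x * gam2 M E F f g x \<partial>M) = wgam \<phi> f g"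
proof -
  have p: "(\<lambda>x. f x + g x) \<in> Ccore F" "(\<lambda>x. f x - g x) \<in> Ccore F" by (intro Core_closed f g)+
  note i = dens_CD(3,4)[OF gam_dens_C[OF p(1)] \<phi>] dens_CD(3,4)[OF gam_dens_C[OF p(2)] \<phi>]
  have eq: "(\<lambda>x. \<phi> x * gam2 M E F f g x) =
     (\<lambda>x. (\<phi> x * gam M E F (\<lambda>y. f y + g y) x - \<phi> x * gam M E F (\<lambda>y. f y - g y) x) / 4)"
    unfolding gam2_def by (auto simp: algebra_simps)
  show "integrable M (\<lambda>x. \<phi> x * gam2 M E F f g x)" unfolding eq using i by auto
  show "(\<integral>x. \<phi> x * gam2 M E F f g x \<partial>M) = wgam \<phi> f g"
    unfolding eq using i f g \<phi> wgam_sym[of \<phi> g f] by (simp add: wgam_bilinear Core_closed)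
qed

text \<open>Not a formal identity: the densities of f - g and of g - f are chosen independently, so
  even symmetry has to be tested against the core.\<close>

lemma gam2_sym:
  assumes "f \<in> Ccore F" "g \<in> Ccore F"
  shows "AE x in M. gam2 M E F f g x = gam2 M E F g f x"
proof -
  have "AE x in M. gam2 M E F f g x - gam2 M E F g f x = 0"
    by (rule AE_zero_of_Core_integrals)
       (use assms gam2_integrable gam2_Core_integrable gam2_Core_integral in
         \<open>auto simp: right_diff_distrib wgam_sym[of _ f g]\<close>)
  then show ?thesis by eventually_elim simp
qed

lemma gam2_diag:
  assumes "f \<in> Ccore F"
  shows "AE x in M. gam2 M E F f f x = gam M E F f x"
proof -
  have "AE x in M. gam2 M E F f f x - gam M E F f x = 0"
    by (rule AE_zero_of_Core_integrals)
       (use assms gam2_integrable gam2_Core_integrable gam2_Core_integral gam_integrable Core_F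
         dens_CD(3,4)[OF gam_dens_C] in \<open>auto simp: right_diff_distrib\<close>)
  then show ?thesis by eventually_elim simp
qed

lemma gam2_linear:
  assumes "f \<in> Ccore F" "g \<in> Ccore F" "h \<in> Ccore F"
  shows "AE x in M. gam2 M E F (\<lambda>x. f x + c * g x) h x = gam2 M E F f h x + c * gam2 M E F g h x"
proof -
  have "AE x in M. gam2 M E F (\<lambda>x. f x + c * g x) h x - (gam2 M E F f h x + c * gam2 M E F g h x) = 0"
  proof (rule AE_zero_of_Core_integrals)
    have p: "(\<lambda>x. f x + c * g x) \<in> Ccore F" by (intro Core_closed assms)
    show "(\<lambda>x. gam2 M E F (\<lambda>x. f x + c * g x) h x - (gam2 M E F f h x + c * gam2 M E F g h x)) \<in> borel_measurable M"
      using gam2_integrable[OF p assms(3)] gam2_integrable assms by auto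
    fix \<phi> assume \<phi>: "\<phi> \<in> Ccore F"
    have eq: "(\<lambda>x. \<phi> x * (gam2 M E F (\<lambda>x. f x + c * g x) h x - (gam2 M E F f h x + c * gam2 M E F g h x)))
      = (\<lambda>x. \<phi> x * gam2 M E F (\<lambda>x. f x + c * g x) h x - (\<phi> x * gam2 M E F f h x + c * (\<phi> x * gam2 M E F g h x)))"
      by (auto simp: algebra_simps)
    note i = gam2_Core_integrable[OF p assms(3) \<phi>] gam2_Core_integrable[OF assms(1,3) \<phi>] gam2_Core_integrable[OF assms(2,3) \<phi>]
      gam2_Core_integral[OF p assms(3) \<phi>] gam2_Core_integral[OF assms(1,3) \<phi>] gam2_Core_integral[OF assms(2,3) \<phi>]
    show "integrable M (\<lambda>x. \<phi> x * (gam2 M E F (\<lambda>x. f x + c * g x) h x - (gam2 M E F f h x + c * gam2 M E F g h x)))"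
      unfolding eq using i by simp
    show "(\<integral>x. \<phi> x * (gam2 M E F (\<lambda>x. f x + c * g x) h x - (gam2 M E F f h x + c * gam2 M E F g h x)) \<partial>M) = 0"
      unfolding eq using i assms \<phi> by (simp add: wgam_bilinear Core_closed)
  qed
  then show ?thesis by eventually_elim simp
qed

text \<open>The factors f and g are absorbed into the test function: \<phi> f and \<phi> g are again
  in the core, and \<open>wgam_leibniz\<close> is the integrated statement.\<close>

lemma gam2_leibniz:
  assumes "f \<in> Ccore F" "g \<in> Ccore F" "h \<in> Ccore F"
  shows "AE x in M. gam2 M E F (\<lambda>x. f x * g x) h x = f x * gam2 M E F g h x + g x * gam2 M E F f h x"
proof -
  have "AE x in M. gam2 M E F (\<lambda>x. f x * g x) h x - (f x * gam2 M E F g h x + g x * gam2 M E F f h x) = 0"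
  proof (rule AE_zero_of_Core_integrals)
    have p: "(\<lambda>x. f x * g x) \<in> Ccore F" by (intro Core_closed assms)
    have [measurable]: "f \<in> borel_measurable M" "g \<in> borel_measurable M" using Core_meas assms by auto
    show "(\<lambda>x. gam2 M E F (\<lambda>x. f x * g x) h x - (f x * gam2 M E F g h x + g x * gam2 M E F f h x)) \<in> borel_measurable M"
      using gam2_integrable[OF p assms(3)] gam2_integrable assms by auto
    fix \<phi> assume \<phi>: "\<phi> \<in> Ccore F"
    have \<phi>2: "(\<lambda>x. \<phi> x * f x) \<in> Ccore F" "(\<lambda>x. \<phi> x * g x) \<in> Ccore F" by (intro Core_closed assms \<phi>)+
    have eq: "(\<lambda>x. \<phi> x * (gam2 M E F (\<lambda>x. f x * g x) h x - (f x * gam2 M E F g h x + g x * gam2 M E F f h x)))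
      = (\<lambda>x. \<phi> x * gam2 M E F (\<lambda>x. f x * g x) h x
          - ((\<phi> x * f x) * gam2 M E F g h x + (\<phi> x * g x) * gam2 M E F f h x))"
      by (auto simp: algebra_simps)
    note i = gam2_Core_integrable[OF p assms(3) \<phi>] gam2_Core_integrable[OF assms(2,3) \<phi>2(1)] gam2_Core_integrable[OF assms(1,3) \<phi>2(2)]
      gam2_Core_integral[OF p assms(3) \<phi>] gam2_Core_integral[OF assms(2,3) \<phi>2(1)] gam2_Core_integral[OF assms(1,3) \<phi>2(2)]
    show "integrable M (\<lambda>x. \<phi> x * (gam2 M E F (\<lambda>x. f x * g x) h x - (f x * gam2 M E F g h x + g x * gam2 M E F f h x)))"
      unfolding eq using i by simp
    show "(\<integral>x. \<phi> x * (gam2 M E F (\<lambda>x. f x * g x) h x - (f x * gam2 M E F g h x + g x * gam2 M E F f h x)) \<partial>M) = 0"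
      unfolding eq using i wgam_leibniz[OF \<phi> assms] by simp
  qed
  then show ?thesis by eventually_elim simp
qed

end

section \<open>The Hilbert module\<close>

lemma PS_Nil [simp]: "[] \<in> PS F"
  by (simp add: PS_def)

lemma PS_Cons: "(a, b) # s \<in> PS F \<longleftrightarrow>
    a \<in> Cc F \<and> b \<in> borel_measurable borel \<and> bounded (range b) \<and> s \<in> PS F"
  by (auto simp: PS_def)

lemma PS_append [simp]: "s @ t \<in> PS F \<longleftrightarrow> s \<in> PS F \<and> t \<in> PS F"
  by (auto simp: PS_def)

lemma bounded_range_iff: "bounded (range (f :: 'b \<Rightarrow> complex)) \<longleftrightarrow> (\<exists>C. \<forall>x. cmod (f x) \<le> C)"
  by (auto simp: bounded_iff)

lemma bounded_range_mult:
  fixes f g :: "'b \<Rightarrow> complex"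
  assumes "bounded (range f)" "bounded (range g)"
  shows "bounded (range (\<lambda>x. f x * g x))"
proof -
  obtain C D where "\<And>x. cmod (f x) \<le> C" "\<And>x. cmod (g x) \<le> D" using assms unfolding bounded_range_iff by metis
  then have "cmod (f x * g x) \<le> C * D" for x
    unfolding norm_mult by (intro mult_mono) (auto intro: order_trans[OF norm_ge_zero])
  then show ?thesis unfolding bounded_range_iff by blast
qed

lemma rmul_Cons [simp]: "rmul ((a, b) # s) c = (a, \<lambda>x. b x * c x) # rmul s c"
  and rmul_Nil [simp]: "rmul [] c = []"
  and rmul_append [simp]: "rmul (s @ t) c = rmul s c @ rmul t c"
  by (auto simp: rmul_def)

lemma rmul_PS:
  assumes "s \<in> PS F" "c \<in> borel_measurable borel" "bounded (range c)"
  shows "rmul s c \<in> PS F"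
  using assms(1)
proof (induction s)
  case (Cons p s)
  then show ?case
    using assms(2,3) by (cases p) (auto simp: PS_Cons bounded_range_mult)
qed simp

lemma rmul_rmul: "rmul (rmul s c) d = rmul (rmul s d) c"
  by (induction s) (auto simp: mult_ac)

text \<open>Energy density of a complex first and a real second argument. Splitting the second
  argument of \<open>gamc\<close> into real and imaginary part reduces tests in the module to real
  functions.\<close>

definition gamh ::
  "'a::{metric_space,second_countable_topology} measure \<Rightarrow> (('a\<Rightarrow>real) \<Rightarrow> ('a\<Rightarrow>real) \<Rightarrow> real) \<Rightarrow> ('a\<Rightarrow>real) set
    \<Rightarrow> ('a \<Rightarrow> complex) \<Rightarrow> ('a \<Rightarrow> real) \<Rightarrow> 'a \<Rightarrow> complex" where
  "gamh M E F a k x = complex_of_real (gam2 M E F (\<lambda>y. Re (a y)) k x) + \<i> * complex_of_real (gam2 M E F (\<lambda>y. Im (a y)) k x)"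

lemma gamc_gamh:
  "gamc M E F a c x = gamh M E F a (\<lambda>y. Re (c y)) x - \<i> * gamh M E F a (\<lambda>y. Im (c y)) x"
  by (simp add: gamc_def gamh_def algebra_simps)

text \<open>\<open>pairing s k\<close> is the density of the inner product of \<open>s\<close> with \<open>k \<otimes> 1\<close>, for real \<open>k\<close>.\<close>

definition pairing ::
  "'a::{metric_space,second_countable_topology} measure \<Rightarrow> (('a\<Rightarrow>real) \<Rightarrow> ('a\<Rightarrow>real) \<Rightarrow> real) \<Rightarrow> ('a\<Rightarrow>real) set
    \<Rightarrow> (('a \<Rightarrow> complex) \<times> ('a \<Rightarrow> complex)) list \<Rightarrow> ('a \<Rightarrow> real) \<Rightarrow> 'a \<Rightarrow> complex" where
  "pairing M E F s k x = (\<Sum>(a, b)\<leftarrow>s. b x * gamh M E F a k x)"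

text \<open>The integrand of \<open>preinner\<close>. Before integration, right multiplication of a
  tensor by c is nothing but the pointwise factor c x, or its conjugate in the second
  argument.\<close>

definition inner_dens ::
  "'a::{metric_space,second_countable_topology} measure \<Rightarrow> (('a\<Rightarrow>real) \<Rightarrow> ('a\<Rightarrow>real) \<Rightarrow> real) \<Rightarrow> ('a\<Rightarrow>real) set
    \<Rightarrow> (('a \<Rightarrow> complex) \<times> ('a \<Rightarrow> complex)) list \<Rightarrow> (('a \<Rightarrow> complex) \<times> ('a \<Rightarrow> complex)) list \<Rightarrow> 'a \<Rightarrow> complex" where
  "inner_dens M E F s t x = (\<Sum>(a, b)\<leftarrow>s. \<Sum>(c, d)\<leftarrow>t. b x * cnj (d x) * gamc M E F a c x)"

lemma pairing_simps [simp]: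
  "pairing M E F [] k x = 0"
  "pairing M E F ((a, b) # s) k x = b x * gamh M E F a k x + pairing M E F s k x"
  "pairing M E F (s @ t) k x = pairing M E F s k x + pairing M E F t k x"
  by (auto simp: pairing_def)

lemma pairing_rmul: "pairing M E F (rmul s c) k x = c x * pairing M E F s k x"
  by (induction s) (auto simp: algebra_simps)

lemma inner_dens_pairing:
  "inner_dens M E F s t x = (\<Sum>(c, d)\<leftarrow>t. cnj (d x) *
     (pairing M E F s (\<lambda>y. Re (c y)) x - \<i> * pairing M E F s (\<lambda>y. Im (c y)) x))"
proof (induction s)
  case Nil
  show ?case by (induction t) (auto simp: inner_dens_def)
next
  case (Cons p s)
  obtain a b where p: "p = (a, b)" by (cases p) auto
  have "(\<Sum>(c, d)\<leftarrow>t. b x * cnj (d x) * gamc M E F a c x) = (\<Sum>(c, d)\<leftarrow>t. cnj (d x) *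
     (b x * gamh M E F a (\<lambda>y. Re (c y)) x - \<i> * (b x * gamh M E F a (\<lambda>y. Im (c y)) x)))"
    by (induction t) (auto simp: gamc_gamh algebra_simps)
  then have "inner_dens M E F (p # s) t x = (\<Sum>(c, d)\<leftarrow>t. cnj (d x) *
     (b x * gamh M E F a (\<lambda>y. Re (c y)) x - \<i> * (b x * gamh M E F a (\<lambda>y. Im (c y)) x))) + inner_dens M E F s t x"
    by (simp add: inner_dens_def p)
  then show ?case
    unfolding Cons.IH by (simp add: p sum_list_addf[symmetric] case_prod_unfold algebra_simps)
qed

lemma inner_dens_rmul_left: "inner_dens M E F (rmul s c) t x = c x * inner_dens M E F s t x"
proof -
  have "inner_dens M E F (rmul s c) t x = (\<Sum>(c', d)\<leftarrow>t. c x * (cnj (d x) *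
     (pairing M E F s (\<lambda>y. Re (c' y)) x - \<i> * pairing M E F s (\<lambda>y. Im (c' y)) x)))"
    unfolding inner_dens_pairing pairing_rmul by (simp add: algebra_simps)
  also have "\<dots> = c x * inner_dens M E F s t x"
    unfolding inner_dens_pairing by (simp add: sum_list_const_mult case_prod_unfold)
  finally show ?thesis .
qed

lemma inner_dens_rmul_right: "inner_dens M E F s (rmul t c) x = cnj (c x) * inner_dens M E F s t x"
  unfolding inner_dens_pairing by (induction t) (auto simp: algebra_simps)

context local_dirichlet
begin

lemma CcD: "a \<in> Cc F \<Longrightarrow> (\<lambda>x. Re (a x)) \<in> Ccore F" "a \<in> Cc F \<Longrightarrow> (\<lambda>x. Im (a x)) \<in> Ccore F"
  by (auto simp: Cc_def)

lemma Cc_meas: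
  assumes "a \<in> Cc F"
  shows "a \<in> borel_measurable borel"
proof -
  have "continuous_on UNIV (\<lambda>x. Complex (Re (a x)) (Im (a x)))"
    unfolding complex_eq by (intro continuous_intros Core_cont CcD assms)
  then show ?thesis by (auto intro: borel_measurable_continuous_onI)
qed

lemma Cc_bounded:
  assumes "a \<in> Cc F"
  shows "bounded (range a)"
proof -
  obtain R where R: "\<And>x. \<bar>Re (a x)\<bar> \<le> R" using Core_bounded[OF CcD(1)[OF assms]] by metis
  obtain S where S: "\<And>x. \<bar>Im (a x)\<bar> \<le> S" using Core_bounded[OF CcD(2)[OF assms]] by metis
  have "cmod (a x) \<le> R + S" for x using cmod_le[of "a x"] R[of x] S[of x] by linarith
  then show ?thesis unfolding bounded_range_iff by blast
qed

lemma PS_single: "[(a, b)] \<in> PS F \<longleftrightarrow> a \<in> Cc F \<and> b \<in> borel_measurable borel \<and> bounded (range b)"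
  by (simp add: PS_Cons)

lemma PS_one: "a \<in> Cc F \<Longrightarrow> [(a, \<lambda>_. 1)] \<in> PS F"
  by (simp add: PS_single)

lemma PS_Cc: "a \<in> Cc F \<Longrightarrow> b \<in> Cc F \<Longrightarrow> [(a, b)] \<in> PS F"
  by (simp add: PS_single Cc_meas Cc_bounded)

lemma gamc_integrable:
  assumes "a \<in> Cc F" "c \<in> Cc F"
  shows "integrable M (gamc M E F a c)"
proof -
  have "integrable M (\<lambda>x. gamc M E F a c x)"
    unfolding gamc_def by (intro Bochner_Integration.integrable_add integrable_mult_right integrable_of_real Bochner_Integration.integrable_diff
      gam2_integrable CcD assms)
  then show ?thesis by simp
qed

lemma bounded_mult_integrable:
  fixes f g :: "'a \<Rightarrow> complex"
  assumes "integrable M f" "g \<in> borel_measurable borel" "bounded (range g)"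
  shows "integrable M (\<lambda>x. g x * f x)"
proof -
  obtain C where C: "\<And>x. cmod (g x) \<le> C" using assms(3) unfolding bounded_range_iff by blast
  have [measurable]: "g \<in> borel_measurable M" using assms(2) by (simp cong: measurable_cong_sets add: sets_M)
  have [measurable]: "f \<in> borel_measurable M" using assms(1) by auto
  show ?thesis
    by (rule Bochner_Integration.integrable_bound[of _ "\<lambda>x. C * cmod (f x)"])
       (use assms(1) C in \<open>auto simp: norm_mult intro!: mult_right_mono order_trans[OF _ abs_ge_self]\<close>)
qed

lemma
  assumes "s \<in> PS F" "t \<in> PS F"
  shows inner_dens_integrable: "integrable M (inner_dens M E F s t)"
    and preinner_integral: "preinner M E F s t = (\<integral>x. inner_dens M E F s t x \<partial>M)"
proof -
  have one: "integrable M (\<lambda>x. b x * cnj (d x) * gamc M E F a c x)"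
    if "a \<in> Cc F" "c \<in> Cc F" "b \<in> borel_measurable borel" "d \<in> borel_measurable borel" "bounded (range b)" "bounded (range d)"
    for a b c d
  proof (rule bounded_mult_integrable[OF gamc_integrable[OF that(1,2)]])
    have "bounded (range (\<lambda>x. cnj (d x)))" using that(6) unfolding bounded_range_iff by simp
    then show "bounded (range (\<lambda>x. b x * cnj (d x)))" by (rule bounded_range_mult[OF that(5)])
    have "(\<lambda>x. cnj (d x)) \<in> borel_measurable borel"
      by (rule measurable_compose[OF that(4) borel_measurable_continuous_onI]) (intro continuous_intros)
    then show "(\<lambda>x. b x * cnj (d x)) \<in> borel_measurable borel" using that(3) by measurable
  qed
  have row: "integrable M (\<lambda>x. \<Sum>(c, d)\<leftarrow>t. b x * cnj (d x) * gamc M E F a c x) \<and>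
      (\<Sum>(c, d)\<leftarrow>t. \<integral>x. b x * cnj (d x) * gamc M E F a c x \<partial>M) = (\<integral>x. (\<Sum>(c, d)\<leftarrow>t. b x * cnj (d x) * gamc M E F a c x) \<partial>M)"
    if "a \<in> Cc F" "b \<in> borel_measurable borel" "bounded (range b)" for a b
    using assms(2)
  proof (induction t)
    case (Cons q t)
    obtain c d where q: "q = (c, d)" by (cases q) auto
    have "integrable M (\<lambda>x. b x * cnj (d x) * gamc M E F a c x)"
      using one that Cons.prems by (auto simp: q PS_Cons)
    then show ?case using Cons by (auto simp: q PS_Cons)
  qed simp
  have "integrable M (\<lambda>x. inner_dens M E F s t x) \<and> preinner M E F s t = (\<integral>x. inner_dens M E F s t x \<partial>M)"
    using assms(1)
  proof (induction s)
    case (Cons p s)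
    obtain a b where p: "p = (a, b)" by (cases p) auto
    then show ?case using Cons row[of a b] by (auto simp: PS_Cons inner_dens_def preinner_def)
  next
    case Nil
    have "inner_dens M E F [] t = (\<lambda>_. 0)" by (auto simp: inner_dens_def)
    then show ?case by (simp add: preinner_def)
  qed
  then show "integrable M (inner_dens M E F s t)" "preinner M E F s t = (\<integral>x. inner_dens M E F s t x \<partial>M)"
    by auto
qed

end

section \<open>Null vectors and identities in the completed module\<close>

locale hilbert_dirichlet = local_dirichlet M E F
  for M :: "'a::{metric_space,second_countable_topology} measure"
    and E :: "('a \<Rightarrow> real) \<Rightarrow> ('a \<Rightarrow> real) \<Rightarrow> real"
    and F :: "('a \<Rightarrow> real) set" +
  fixes \<iota> :: "(('a \<Rightarrow> complex) \<times> ('a \<Rightarrow> complex)) list \<Rightarrow> 'h::{real_inner,complete_space}"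
  assumes rep: "hilbert_rep M E F \<iota>"
begin

lemma inner_iota:
  assumes "s \<in> PS F" "t \<in> PS F"
  shows "inner (\<iota> s) (\<iota> t) = (\<integral>x. Re (inner_dens M E F s t x) \<partial>M)"
  using rep assms unfolding hilbert_rep_def
  by (simp add: preinner_integral integral_Re inner_dens_integrable)

lemma iota_append: "s \<in> PS F \<Longrightarrow> t \<in> PS F \<Longrightarrow> \<iota> (s @ t) = \<iota> s + \<iota> t"
  using rep unfolding hilbert_rep_def by blast

lemma iota_dense: "closure (\<iota> ` PS F) = UNIV"
  using rep unfolding hilbert_rep_def by blast

lemma iota_Nil [simp]: "\<iota> [] = 0"
  using iota_append[of "[]" "[]"] by simp

text \<open>If all pairings with real core functions vanish, so does the inner density with every
  tensor; the vector is then orthogonal to a dense set, itself included.\<close>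

lemma iota_null:
  assumes s: "s \<in> PS F" and z: "\<And>k. k \<in> Ccore F \<Longrightarrow> AE x in M. pairing M E F s k x = 0"
  shows "\<iota> s = 0"
proof -
  have "inner (\<iota> s) (\<iota> t) = 0" if t: "t \<in> PS F" for t
  proof -
    have "AE x in M. inner_dens M E F s t x = 0"
      using t unfolding inner_dens_pairing
    proof (induction t)
      case (Cons q t)
      obtain c d where q: "q = (c, d)" by (cases q) auto
      have c: "c \<in> Cc F" "t \<in> PS F" using Cons.prems by (auto simp: q PS_Cons)
      show ?case using z[OF CcD(1)[OF c(1)]] z[OF CcD(2)[OF c(1)]] Cons.IH[OF c(2)]
        by eventually_elim (simp add: q)
    qed simp
    then have "(\<integral>x. Re (inner_dens M E F s t x) \<partial>M) = (\<integral>x. 0 \<partial>M)"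
      by (intro integral_cong_AE) (use inner_dens_integrable[OF s t] in auto)
    then show ?thesis using inner_iota[OF s t] by simp
  qed
  then have "\<iota> ` PS F \<subseteq> {v. inner (\<iota> s) v = 0}" by auto
  moreover have "closed {v. inner (\<iota> s) v = 0}" by (intro closed_Collect_eq continuous_intros)
  ultimately have "closure (\<iota> ` PS F) \<subseteq> {v. inner (\<iota> s) v = 0}" by (rule closure_minimal)
  then have "inner (\<iota> s) (\<iota> s) = 0" unfolding iota_dense by blast
  then show ?thesis by simp
qed

lemma PS_uminus: "s \<in> PS F \<Longrightarrow> rmul s (\<lambda>_. -1) \<in> PS F"
  by (rule rmul_PS) auto

lemma iota_uminus:
  assumes "s \<in> PS F"
  shows "\<iota> (rmul s (\<lambda>_. -1)) = - \<iota> s"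
proof -
  have "\<iota> (s @ rmul s (\<lambda>_. -1)) = 0"
    by (rule iota_null) (use assms PS_uminus in \<open>auto simp: pairing_rmul\<close>)
  then show ?thesis
    using iota_append[OF assms PS_uminus[OF assms]] by (simp add: eq_neg_iff_add_eq_0 add.commute)
qed

lemma iota_diff:
  assumes "s \<in> PS F" "t \<in> PS F"
  shows "\<iota> (s @ rmul t (\<lambda>_. -1)) = \<iota> s - \<iota> t"
  using iota_append[OF assms(1) PS_uminus[OF assms(2)]] iota_uminus[OF assms(2)] by simp

text \<open>The way equations in the module are verified: two lists represent the same vector as
  soon as their pairing densities agree. Lists have no subtraction, so a difference is written as
  concatenation with a copy multiplied by -1.\<close>

lemma iota_cong:
  assumes "s \<in> PS F" "t \<in> PS F" "\<And>k. k \<in> Ccore F \<Longrightarrow> AE x in M. pairing M E F s k x = pairing M E F t k x"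
  shows "\<iota> s = \<iota> t"
proof -
  have "\<iota> (s @ rmul t (\<lambda>_. -1)) = 0"
  proof (rule iota_null)
    fix k assume "k \<in> Ccore F"
    from assms(3)[OF this] show "AE x in M. pairing M E F (s @ rmul t (\<lambda>_. -1)) k x = 0"
      by eventually_elim (simp add: pairing_rmul)
  qed (use assms PS_uminus in auto)
  then show ?thesis using iota_diff[OF assms(1,2)] by simp
qed

subsection \<open>Multiplication\<close>

text \<open>Positivity of the density is read off from the norms of \<open>s 1\<^sub>A\<close> for Borel sets \<open>A\<close>.\<close>

lemma inner_dens_nonneg:
  assumes s: "s \<in> PS F"
  shows "AE x in M. 0 \<le> Re (inner_dens M E F s s x)"
proof -
  define A where "A = {x. Re (inner_dens M E F s s x) < 0}"
  have m [measurable]: "inner_dens M E F s s \<in> borel_measurable M" using inner_dens_integrable[OF s s] by auto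
  have "{x \<in> space M. Re (inner_dens M E F s s x) < 0} \<in> sets M" by measurable
  then have A [measurable]: "A \<in> sets M" by (simp add: A_def)
  define c :: "'a \<Rightarrow> complex" where "c = indicator A"
  have c: "c \<in> borel_measurable borel" "bounded (range c)"
    using A unfolding c_def bounded_range_iff by (auto simp: sets_M indicator_def intro!: exI[of _ 1])
  have cs: "rmul s c \<in> PS F" by (rule rmul_PS[OF s c])
  have eq: "Re (inner_dens M E F (rmul s c) (rmul s c) x) = indicator A x * Re (inner_dens M E F s s x)" for x
    by (simp add: inner_dens_rmul_left inner_dens_rmul_right c_def indicator_def)
  have i: "integrable M (\<lambda>x. - (indicator A x * Re (inner_dens M E F s s x)))"
    using integrable_Re[OF inner_dens_integrable[OF cs cs]] unfolding eq by simp
  have nn: "0 \<le> - (indicator A x * Re (inner_dens M E F s s x))" for x by (auto simp: A_def indicator_def)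
  have "0 \<le> inner (\<iota> (rmul s c)) (\<iota> (rmul s c))" by simp
  then have "(\<integral>x. - (indicator A x * Re (inner_dens M E F s s x)) \<partial>M) \<le> 0"
    unfolding inner_iota[OF cs cs] eq by simp
  moreover have "0 \<le> (\<integral>x. - (indicator A x * Re (inner_dens M E F s s x)) \<partial>M)"
    using nn by (intro Bochner_Integration.integral_nonneg)
  ultimately have "(\<integral>x. - (indicator A x * Re (inner_dens M E F s s x)) \<partial>M) = 0" by linarith
  then have "AE x in M. - (indicator A x * Re (inner_dens M E F s s x)) = 0"
    using integral_nonneg_eq_0_iff_AE[OF i] nn by auto
  then show ?thesis by eventually_elim (auto simp: A_def indicator_def split: if_splits)
qed

lemma norm_iota_sq:
  assumes "s \<in> PS F"
  shows "(norm (\<iota> s))\<^sup>2 = (\<integral>x. Re (inner_dens M E F s s x) \<partial>M)"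
  using inner_iota[OF assms assms] by (simp add: power2_norm_eq_inner)

text \<open>The squared modulus of c comes out as a pointwise factor of the inner density, and since
  that density is nonnegative almost everywhere the factor may be replaced by C^2 under the
  integral.\<close>

lemma norm_rmul_le:
  assumes s: "s \<in> PS F" and c: "c \<in> borel_measurable borel" "\<And>x. cmod (c x) \<le> C"
  shows "norm (\<iota> (rmul s c)) \<le> C * norm (\<iota> s)"
proof -
  have C0: "C \<ge> 0" using c(2) norm_ge_zero order_trans by blast
  have cs: "rmul s c \<in> PS F" by (rule rmul_PS[OF s c(1)]) (use c(2) in \<open>auto simp: bounded_range_iff\<close>)
  have eq: "Re (inner_dens M E F (rmul s c) (rmul s c) x) = (cmod (c x))\<^sup>2 * Re (inner_dens M E F s s x)" for x
  proof -
    have "inner_dens M E F (rmul s c) (rmul s c) x = (c x * cnj (c x)) * inner_dens M E F s s x"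
      by (simp add: inner_dens_rmul_left inner_dens_rmul_right)
    then show ?thesis by (simp add: complex_norm_square[symmetric] del: of_real_power)
  qed
  have "(norm (\<iota> (rmul s c)))\<^sup>2 = (\<integral>x. (cmod (c x))\<^sup>2 * Re (inner_dens M E F s s x) \<partial>M)"
    unfolding norm_iota_sq[OF cs] eq ..
  also have "\<dots> \<le> (\<integral>x. C\<^sup>2 * Re (inner_dens M E F s s x) \<partial>M)"
  proof (rule integral_mono_AE)
    show "integrable M (\<lambda>x. (cmod (c x))\<^sup>2 * Re (inner_dens M E F s s x))"
      using integrable_Re[OF inner_dens_integrable[OF cs cs]] unfolding eq .
    show "integrable M (\<lambda>x. C\<^sup>2 * Re (inner_dens M E F s s x))" using inner_dens_integrable[OF s s] by auto
    show "AE x in M. (cmod (c x))\<^sup>2 * Re (inner_dens M E F s s x) \<le> C\<^sup>2 * Re (inner_dens M E F s s x)"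
      using inner_dens_nonneg[OF s] by eventually_elim (use c(2) in \<open>auto intro!: mult_right_mono power_mono\<close>)
  qed
  also have "\<dots> = (C * norm (\<iota> s))\<^sup>2" using norm_iota_sq[OF s] by (simp add: power_mult_distrib)
  finally show ?thesis by (rule power2_le_imp_le) (use C0 in auto)
qed

lemma norm_rmul_diff_le:
  assumes "s \<in> PS F" "t \<in> PS F" and c: "c \<in> borel_measurable borel" "\<And>x. cmod (c x) \<le> C"
  shows "norm (\<iota> (rmul s c) - \<iota> (rmul t c)) \<le> C * norm (\<iota> s - \<iota> t)"
proof -
  have b: "bounded (range c)" using c(2) by (auto simp: bounded_range_iff)
  have comm: "rmul (rmul t (\<lambda>_. -1)) c = rmul (rmul t c) (\<lambda>_. -1)" by (rule rmul_rmul)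
  have "norm (\<iota> (rmul (s @ rmul t (\<lambda>_. -1)) c)) \<le> C * norm (\<iota> (s @ rmul t (\<lambda>_. -1)))"
    by (rule norm_rmul_le) (use assms PS_uminus in auto)
  moreover have "\<iota> (rmul (s @ rmul t (\<lambda>_. -1)) c) = \<iota> (rmul s c) - \<iota> (rmul t c)"
    unfolding rmul_append comm by (rule iota_diff) (use rmul_PS assms b in auto)
  ultimately show ?thesis using iota_diff[OF assms(1,2)] by simp
qed

text \<open>\<open>mulH\<close> is a choice among possible limits. The norm bound makes the images
  Cauchy and their limit independent of the approximating sequence, so the chosen value is the limit
  along any sequence at hand.\<close>

lemma mulH_tendsto:
  assumes c: "c \<in> borel_measurable borel" "bounded (range c)"
    and S: "\<And>n. S n \<in> PS F" "(\<lambda>n. \<iota> (S n)) \<longlonglongrightarrow> \<omega>"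
  shows "(\<lambda>n. \<iota> (rmul (S n) c)) \<longlonglongrightarrow> mulH F \<iota> c \<omega>"
proof -
  obtain C where C: "\<And>x. cmod (c x) \<le> C" using c(2) unfolding bounded_range_iff by blast
  have same: "(\<lambda>n. \<iota> (rmul (S n) c) - \<iota> (rmul (T n) c)) \<longlonglongrightarrow> 0"
    if T: "\<And>n. T n \<in> PS F" "(\<lambda>n. \<iota> (T n)) \<longlonglongrightarrow> \<omega>" for T
  proof (rule Lim_null_comparison)
    show "\<forall>\<^sub>F n in sequentially. norm (\<iota> (rmul (S n) c) - \<iota> (rmul (T n) c)) \<le> C * norm (\<iota> (S n) - \<iota> (T n))"
      using norm_rmul_diff_le[OF S(1) T(1) c(1) C] by simp
    show "(\<lambda>n. C * norm (\<iota> (S n) - \<iota> (T n))) \<longlonglongrightarrow> 0"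
      using S(2) T(2) by (auto intro!: tendsto_eq_intros)
  qed
  have "Cauchy (\<lambda>n. \<iota> (rmul (S n) c))"
  proof (rule CauchyI)
    fix e :: real assume e: "e > 0"
    have "Cauchy (\<lambda>n. \<iota> (S n))" using S(2) by (rule LIMSEQ_imp_Cauchy)
    moreover have C0: "C \<ge> 0" using C norm_ge_zero order_trans by blast
    then have "e / (C + 1) > 0" using e by simp
    ultimately obtain N where N: "\<And>m n. m \<ge> N \<Longrightarrow> n \<ge> N \<Longrightarrow> norm (\<iota> (S m) - \<iota> (S n)) < e / (C + 1)"
      by (meson CauchyD)
    have "norm (\<iota> (rmul (S m) c) - \<iota> (rmul (S n) c)) < e" if "m \<ge> N" "n \<ge> N" for m n
    proof -
      have "norm (\<iota> (rmul (S m) c) - \<iota> (rmul (S n) c)) \<le> C * norm (\<iota> (S m) - \<iota> (S n))"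
        by (rule norm_rmul_diff_le[OF S(1) S(1) c(1) C])
      also have "\<dots> \<le> C * (e / (C + 1))" using N[OF that] C0 by (intro mult_left_mono) auto
      also have "\<dots> < e" using C0 e by (simp add: field_simps)
      finally show ?thesis .
    qed
    then show "\<exists>N. \<forall>m\<ge>N. \<forall>n\<ge>N. norm (\<iota> (rmul (S m) c) - \<iota> (rmul (S n) c)) < e" by blast
  qed
  then obtain v where v: "(\<lambda>n. \<iota> (rmul (S n) c)) \<longlonglongrightarrow> v" using Cauchy_convergent convergent_def by blast
  have "\<exists>v. \<exists>S. (\<forall>n. S n \<in> PS F) \<and> (\<lambda>n. \<iota> (S n)) \<longlonglongrightarrow> \<omega> \<and> (\<lambda>n. \<iota> (rmul (S n) c)) \<longlonglongrightarrow> v"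
    using S v by blast
  then have "\<exists>S. (\<forall>n. S n \<in> PS F) \<and> (\<lambda>n. \<iota> (S n)) \<longlonglongrightarrow> \<omega> \<and> (\<lambda>n. \<iota> (rmul (S n) c)) \<longlonglongrightarrow> mulH F \<iota> c \<omega>"
    unfolding mulH_def by (rule someI_ex)
  then obtain T where T: "\<And>n. T n \<in> PS F" "(\<lambda>n. \<iota> (T n)) \<longlonglongrightarrow> \<omega>"
    "(\<lambda>n. \<iota> (rmul (T n) c)) \<longlonglongrightarrow> mulH F \<iota> c \<omega>" by blast
  from tendsto_add[OF same[OF T(1,2)] T(3)] show ?thesis by simp
qed

lemma mulH_iota:
  assumes "c \<in> borel_measurable borel" "bounded (range c)" "s \<in> PS F"
  shows "mulH F \<iota> c (\<iota> s) = \<iota> (rmul s c)"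
  using mulH_tendsto[OF assms(1,2), of "\<lambda>_. s" "\<iota> s"] assms(3) by (simp add: LIMSEQ_const_iff)

lemma mulH_zero:
  assumes "c \<in> borel_measurable borel" "bounded (range c)"
  shows "mulH F \<iota> c 0 = 0"
  using mulH_iota[OF assms, of "[]"] by simp

lemma iota_approximation:
  obtains S where "\<And>n::nat. S n \<in> PS F" "(\<lambda>n. \<iota> (S n)) \<longlonglongrightarrow> \<omega>"
proof -
  have "\<omega> \<in> closure (\<iota> ` PS F)" unfolding iota_dense by simp
  then obtain y where y: "\<And>n. y n \<in> \<iota> ` PS F" "y \<longlonglongrightarrow> \<omega>" unfolding closure_sequential by blast
  have "\<exists>S. \<forall>n. S n \<in> PS F \<and> y n = \<iota> (S n)" by (rule choice) (use y(1) in blast)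
  then obtain S where S: "\<And>n. S n \<in> PS F" "\<And>n. y n = \<iota> (S n)" by blast
  have "y = (\<lambda>n. \<iota> (S n))" using S(2) by auto
  then show ?thesis using that[of S] S(1) y(2) by simp
qed

text \<open>A real factor passes freely between the two arguments of the inner density; the general
  case follows by density.\<close>

lemma mulH_symmetric:
  assumes c: "c \<in> borel_measurable borel" "bounded (range c)" "\<And>x. cnj (c x) = c x"
  shows "inner (mulH F \<iota> c \<omega>) \<eta> = inner \<omega> (mulH F \<iota> c \<eta>)"
proof -
  obtain S where S: "\<And>n::nat. S n \<in> PS F" "(\<lambda>n. \<iota> (S n)) \<longlonglongrightarrow> \<omega>" by (rule iota_approximation) blast
  obtain T where T: "\<And>n::nat. T n \<in> PS F" "(\<lambda>n. \<iota> (T n)) \<longlonglongrightarrow> \<eta>" by (rule iota_approximation) blast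
  have "inner (\<iota> (rmul (S n) c)) (\<iota> (T n)) = inner (\<iota> (S n)) (\<iota> (rmul (T n) c))" for n
    using inner_iota[OF rmul_PS[OF S(1) c(1,2)] T(1), of n n] inner_iota[OF S(1) rmul_PS[OF T(1) c(1,2)], of n n]
    by (simp add: inner_dens_rmul_left inner_dens_rmul_right c(3))
  moreover have "(\<lambda>n. inner (\<iota> (rmul (S n) c)) (\<iota> (T n))) \<longlonglongrightarrow> inner (mulH F \<iota> c \<omega>) \<eta>"
    by (intro tendsto_inner mulH_tendsto c S T)
  moreover have "(\<lambda>n. inner (\<iota> (S n)) (\<iota> (rmul (T n) c))) \<longlonglongrightarrow> inner \<omega> (mulH F \<iota> c \<eta>)"
    by (intro tendsto_inner mulH_tendsto c S T)
  ultimately show ?thesis by (simp add: LIMSEQ_unique)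
qed

end

section \<open>The complexified domain\<close>

context local_dirichlet
begin

lemma FcD: "f \<in> Fc F \<Longrightarrow> (\<lambda>x. Re (f x)) \<in> F" "f \<in> Fc F \<Longrightarrow> (\<lambda>x. Im (f x)) \<in> F"
  by (auto simp: Fc_def)

lemma Cc_Fc: "f \<in> Cc F \<Longrightarrow> f \<in> Fc F"
  by (auto simp: Fc_def Cc_def Core_F)

lemma Fc_diff: "f \<in> Fc F \<Longrightarrow> g \<in> Fc F \<Longrightarrow> (\<lambda>x. f x - g x) \<in> Fc F"
  by (auto simp: Fc_def F_diff)

lemma Cc_diff: "f \<in> Cc F \<Longrightarrow> g \<in> Cc F \<Longrightarrow> (\<lambda>x. f x - g x) \<in> Cc F"
  by (auto simp: Cc_def Core_diff)

lemma Cc_of_real: "(\<lambda>x. complex_of_real (a x)) \<in> Cc F \<longleftrightarrow> a \<in> Ccore F"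
  by (auto simp: Cc_def)

lemma Cc_real_mult: "a \<in> Ccore F \<Longrightarrow> f \<in> Cc F \<Longrightarrow> (\<lambda>x. complex_of_real (a x) * f x) \<in> Cc F"
  by (auto simp: Cc_def Core_mult)

lemma E1c_tendsto_iff:
  assumes g: "\<And>n. g n \<in> Fc F"
  shows "(\<lambda>n. E1c M E (g n)) \<longlonglongrightarrow> 0 \<longleftrightarrow>
    ((\<lambda>n. \<E> (\<lambda>x. Re (g n x))) \<longlonglongrightarrow> 0 \<and> (\<lambda>n. \<integral>x. (Re (g n x))\<^sup>2 \<partial>M) \<longlonglongrightarrow> 0) \<and>
    ((\<lambda>n. \<E> (\<lambda>x. Im (g n x))) \<longlonglongrightarrow> 0 \<and> (\<lambda>n. \<integral>x. (Im (g n x))\<^sup>2 \<partial>M) \<longlonglongrightarrow> 0)"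
proof -
  define a where "a = (\<lambda>n. \<E> (\<lambda>x. Re (g n x)))"
  define b where "b = (\<lambda>n. \<E> (\<lambda>x. Im (g n x)))"
  define c where "c = (\<lambda>n. \<integral>x. (Re (g n x))\<^sup>2 \<partial>M)"
  define d where "d = (\<lambda>n. \<integral>x. (Im (g n x))\<^sup>2 \<partial>M)"
  have nn: "a n \<ge> 0" "b n \<ge> 0" "c n \<ge> 0" "d n \<ge> 0" for n
    unfolding a_def b_def c_def d_def using E_nonneg FcD g by auto
  have eq: "E1c M E (g n) = sqrt (a n + b n + (c n + d n))" for n
    using F_L2[OF FcD(1)[OF g]] F_L2[OF FcD(2)[OF g]]
    unfolding E1c_def a_def b_def c_def d_def by (simp add: Ec_def cmod_power2 L2r_def)
  have "(\<lambda>n. E1c M E (g n)) \<longlonglongrightarrow> 0 \<longleftrightarrow> (a \<longlonglongrightarrow> 0 \<and> c \<longlonglongrightarrow> 0) \<and> (b \<longlonglongrightarrow> 0 \<and> d \<longlonglongrightarrow> 0)"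
  proof
    assume "(\<lambda>n. E1c M E (g n)) \<longlonglongrightarrow> 0"
    from tendsto_power[OF this, of 2] have *: "(\<lambda>n. a n + b n + (c n + d n)) \<longlonglongrightarrow> 0"
      unfolding eq using nn by simp
    show "(a \<longlonglongrightarrow> 0 \<and> c \<longlonglongrightarrow> 0) \<and> (b \<longlonglongrightarrow> 0 \<and> d \<longlonglongrightarrow> 0)"
      by (intro conjI; rule tendsto_sandwich[OF always_eventually always_eventually tendsto_const *])
         (use nn in \<open>auto intro: add_increasing add_increasing2 add_nonneg_nonneg\<close>)
  next
    assume "(a \<longlonglongrightarrow> 0 \<and> c \<longlonglongrightarrow> 0) \<and> (b \<longlonglongrightarrow> 0 \<and> d \<longlonglongrightarrow> 0)"
    then have "(\<lambda>n. sqrt (a n + b n + (c n + d n))) \<longlonglongrightarrow> sqrt (0 + 0 + (0 + 0))"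
      by (intro tendsto_intros) auto
    then show "(\<lambda>n. E1c M E (g n)) \<longlonglongrightarrow> 0" unfolding eq by simp
  qed
  then show ?thesis unfolding a_def b_def c_def d_def .
qed

lemma Cc_approximation:
  assumes "f \<in> Fc F"
  obtains u where "\<And>n::nat. u n \<in> Cc F" "(\<lambda>n. E1c M E (\<lambda>x. u n x - f x)) \<longlonglongrightarrow> 0"
proof -
  have pos: "inverse (real (Suc n)) > 0" for n by simp
  obtain p where p: "\<And>n. p n \<in> Ccore F" "\<And>n. \<E> (\<lambda>x. p n x - Re (f x)) < inverse (real (Suc n))"
    "\<And>n. (\<integral>x. (p n x - Re (f x))\<^sup>2 \<partial>M) < inverse (real (Suc n))"
    by (rule Core_approximation[where e = "\<lambda>n. inverse (real (Suc n))", OF FcD(1)[OF assms] pos]) blast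
  obtain q where q: "\<And>n. q n \<in> Ccore F" "\<And>n. \<E> (\<lambda>x. q n x - Im (f x)) < inverse (real (Suc n))"
    "\<And>n. (\<integral>x. (q n x - Im (f x))\<^sup>2 \<partial>M) < inverse (real (Suc n))"
    by (rule Core_approximation[where e = "\<lambda>n. inverse (real (Suc n))", OF FcD(2)[OF assms] pos]) blast
  define u where "u = (\<lambda>n x. Complex (p n x) (q n x))"
  have u: "u n \<in> Cc F" for n using p(1) q(1) by (simp add: u_def Cc_def)
  have pF: "(\<lambda>x. p n x - Re (f x)) \<in> F" "(\<lambda>x. q n x - Im (f x)) \<in> F" for n
    by (intro F_diff Core_F p(1) q(1) FcD assms)+
  have "(\<lambda>n. E1c M E (\<lambda>x. u n x - f x)) \<longlonglongrightarrow> 0"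
    unfolding E1c_tendsto_iff[OF Fc_diff[OF Cc_Fc[OF u] assms]]
    by (intro conjI; rule tendsto_sandwich[OF always_eventually always_eventually tendsto_const LIMSEQ_inverse_real_of_nat])
       (use less_imp_le[OF p(2)] less_imp_le[OF p(3)] less_imp_le[OF q(2)] less_imp_le[OF q(3)] E_nonneg pF in
         \<open>auto simp: u_def\<close>)
  then show ?thesis using that u by blast
qed

text \<open>Linearity with coefficient -1 at the zero function says that the density equals itself
  minus itself. The imaginary part of a real coefficient produces such terms.\<close>

lemma gam2_zero:
  assumes "k \<in> Ccore F"
  shows "AE x in M. gam2 M E F (\<lambda>_. 0) k x = 0"
  using gam2_linear[OF Core_zero Core_zero assms, of "-1"] by simp

lemma gam_zero: "AE x in M. gam M E F (\<lambda>_. 0) x = 0"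
proof -
  have "(\<integral>x. gam M E F (\<lambda>_. 0) x \<partial>M) = 0" by (simp add: gam_integral)
  then show ?thesis
    using integral_nonneg_eq_0_iff_AE[OF gam_integrable[OF F_zero]] gam_nonneg[OF F_zero] by auto
qed

lemma gamh_diff:
  assumes "a \<in> Cc F" "b \<in> Cc F" "k \<in> Ccore F"
  shows "AE x in M. gamh M E F (\<lambda>x. a x - b x) k x = gamh M E F a k x - gamh M E F b k x"
  using gam2_linear[OF CcD(1)[OF assms(1)] CcD(1)[OF assms(2)] assms(3), of "-1"]
    gam2_linear[OF CcD(2)[OF assms(1)] CcD(2)[OF assms(2)] assms(3), of "-1"]
  by eventually_elim (simp add: gamh_def complex_eq_iff)

lemma gamh_leibniz:
  assumes "a \<in> Ccore F" "f \<in> Cc F" "k \<in> Ccore F"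
  shows "AE x in M. gamh M E F (\<lambda>x. complex_of_real (a x) * f x) k x
    = a x * gamh M E F f k x + f x * gamh M E F (\<lambda>x. complex_of_real (a x)) k x"
  using gam2_leibniz[OF assms(1) CcD(1)[OF assms(2)] assms(3)] gam2_leibniz[OF assms(1) CcD(2)[OF assms(2)] assms(3)]
    gam2_zero[OF assms(3)]
  by eventually_elim (simp add: gamh_def complex_eq_iff algebra_simps)

end

context hilbert_dirichlet
begin

subsection \<open>The derivation\<close>

text \<open>The mixed terms between the real and the imaginary part of a occur only in the imaginary
  part of \<open>gamc\<close> on the diagonal.\<close>

lemma norm_iota_single:
  assumes a: "a \<in> Cc F" and b: "b \<in> borel_measurable borel" "bounded (range b)"
  shows "integrable M (\<lambda>x. (cmod (b x))\<^sup>2 * (gam M E F (\<lambda>y. Re (a y)) x + gam M E F (\<lambda>y. Im (a y)) x))"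
    and "(norm (\<iota> [(a, b)]))\<^sup>2
      = (\<integral>x. (cmod (b x))\<^sup>2 * (gam M E F (\<lambda>y. Re (a y)) x + gam M E F (\<lambda>y. Im (a y)) x) \<partial>M)"
proof -
  have s: "[(a, b)] \<in> PS F" using assms by (simp add: PS_single)
  have [measurable]: "b \<in> borel_measurable M" using b(1) by (simp cong: measurable_cong_sets add: sets_M)
  have [measurable]: "gam M E F (\<lambda>y. Re (a y)) \<in> borel_measurable M" "gam M E F (\<lambda>y. Im (a y)) \<in> borel_measurable M"
    using gam_integrable[OF Core_F[OF CcD(1)[OF a]]] gam_integrable[OF Core_F[OF CcD(2)[OF a]]] by auto
  have i: "integrable M (\<lambda>x. Re (inner_dens M E F [(a, b)] [(a, b)] x))"
    by (rule integrable_Re[OF inner_dens_integrable[OF s s]])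
  have ae: "AE x in M. Re (inner_dens M E F [(a, b)] [(a, b)] x)
      = (cmod (b x))\<^sup>2 * (gam M E F (\<lambda>y. Re (a y)) x + gam M E F (\<lambda>y. Im (a y)) x)"
    using gam2_diag[OF CcD(1)[OF a]] gam2_diag[OF CcD(2)[OF a]]
  proof eventually_elim
    case (elim x)
    have "inner_dens M E F [(a, b)] [(a, b)] x = complex_of_real ((cmod (b x))\<^sup>2) * gamc M E F a a x"
      by (simp add: inner_dens_def complex_norm_square del: of_real_power)
    then show ?case using elim by (simp add: gamc_def del: of_real_power)
  qed
  show "integrable M (\<lambda>x. (cmod (b x))\<^sup>2 * (gam M E F (\<lambda>y. Re (a y)) x + gam M E F (\<lambda>y. Im (a y)) x))"
    by (rule integrable_cong_AE_imp[OF i]) (use ae in \<open>auto elim: AE_mp\<close>)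
  show "(norm (\<iota> [(a, b)]))\<^sup>2
      = (\<integral>x. (cmod (b x))\<^sup>2 * (gam M E F (\<lambda>y. Re (a y)) x + gam M E F (\<lambda>y. Im (a y)) x) \<partial>M)"
    unfolding norm_iota_sq[OF s] by (rule integral_cong_AE[OF _ _ ae]) (use i in auto)
qed

lemma norm_iota_one:
  assumes a: "a \<in> Cc F"
  shows "(norm (\<iota> [(a, \<lambda>_. 1)]))\<^sup>2
    = \<E> (\<lambda>x. Re (a x)) + \<E> (\<lambda>x. Im (a x))"
  using norm_iota_single(2)[OF a, of "\<lambda>_. 1"] gam_integral[OF CcD(1)[OF a]] gam_integral[OF CcD(2)[OF a]]
    gam_integrable[OF Core_F[OF CcD(1)[OF a]]] gam_integrable[OF Core_F[OF CcD(2)[OF a]]]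
  by simp

lemma iota_diff_left:
  assumes "a \<in> Cc F" "a' \<in> Cc F" "b \<in> borel_measurable borel" "bounded (range b)"
  shows "\<iota> [(\<lambda>x. a x - a' x, b)] = \<iota> [(a, b)] - \<iota> [(a', b)]"
proof -
  have PS: "[(a, b)] \<in> PS F" "[(a', b)] \<in> PS F" "[(\<lambda>x. a x - a' x, b)] \<in> PS F"
    using assms Cc_diff by (simp_all add: PS_single)
  have "\<iota> [(\<lambda>x. a x - a' x, b)] = \<iota> ([(a, b)] @ rmul [(a', b)] (\<lambda>_. -1))"
  proof (rule iota_cong)
    fix k assume "k \<in> Ccore F"
    from gamh_diff[OF assms(1,2) this]
    show "AE x in M. pairing M E F [(\<lambda>x. a x - a' x, b)] k x = pairing M E F ([(a, b)] @ rmul [(a', b)] (\<lambda>_. -1)) k x"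
      by eventually_elim (simp add: right_diff_distrib)
  qed (use PS PS_uminus[OF PS(2)] in \<open>auto simp: PS_Cons\<close>)
  then show ?thesis using iota_diff[OF PS(1,2)] by simp
qed

lemma iota_diff_right:
  assumes "a \<in> Cc F" "b \<in> borel_measurable borel" "bounded (range b)" "b' \<in> borel_measurable borel" "bounded (range b')"
  shows "\<iota> [(a, \<lambda>x. b x - b' x)] = \<iota> [(a, b)] - \<iota> [(a, b')]"
proof -
  have PS: "[(a, b)] \<in> PS F" "[(a, b')] \<in> PS F" "[(a, \<lambda>x. b x - b' x)] \<in> PS F"
    using assms bounded_minus_comp[of b UNIV b'] by (auto simp: PS_single)
  have "\<iota> [(a, \<lambda>x. b x - b' x)] = \<iota> ([(a, b)] @ rmul [(a, b')] (\<lambda>_. -1))"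
    by (rule iota_cong) (use PS PS_uminus[OF PS(2)] in \<open>auto simp: PS_Cons algebra_simps\<close>)
  then show ?thesis using iota_diff[OF PS(1,2)] by simp
qed

text \<open>Both summands are right multiples, of \<partial>f by a and of \<partial>a by f.
  Rearranged, the identity says that the left action (a f) \<otimes> 1 - a \<otimes> f coincides
  with the right action f \<otimes> a, which is why \<open>mulH\<close> can be built from right
  multiplication.\<close>

lemma iota_leibniz:
  assumes "a \<in> Ccore F" "f \<in> Cc F"
  shows "\<iota> [(\<lambda>x. complex_of_real (a x) * f x, \<lambda>_. 1)]
    = \<iota> [(f, \<lambda>x. complex_of_real (a x))] + \<iota> [(\<lambda>x. complex_of_real (a x), f)]"
proof -
  have c: "(\<lambda>x. complex_of_real (a x)) \<in> Cc F" using assms(1) by (simp add: Cc_of_real)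
  have "\<iota> [(\<lambda>x. complex_of_real (a x) * f x, \<lambda>_. 1)]
    = \<iota> ([(f, \<lambda>x. complex_of_real (a x))] @ [(\<lambda>x. complex_of_real (a x), f)])"
  proof (rule iota_cong)
    fix k assume "k \<in> Ccore F"
    from gamh_leibniz[OF assms this]
    show "AE x in M. pairing M E F [(\<lambda>x. complex_of_real (a x) * f x, \<lambda>_. 1)] k x
      = pairing M E F ([(f, \<lambda>x. complex_of_real (a x))] @ [(\<lambda>x. complex_of_real (a x), f)]) k x"
      by eventually_elim simp
  qed (use PS_one[OF Cc_real_mult[OF assms]] PS_Cc[OF assms(2) c] PS_Cc[OF c assms(2)] in \<open>auto simp: PS_Cons\<close>)
  then show ?thesis using iota_append[OF PS_Cc[OF assms(2) c] PS_Cc[OF c assms(2)]] by simp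
qed

lemma norm_iota_one_diff:
  assumes "a \<in> Cc F" "b \<in> Cc F"
  shows "(norm (\<iota> [(a, \<lambda>_. 1)] - \<iota> [(b, \<lambda>_. 1)]))\<^sup>2
    = \<E> (\<lambda>x. Re (a x) - Re (b x)) + \<E> (\<lambda>x. Im (a x) - Im (b x))"
  using norm_iota_one[OF Cc_diff[OF assms]] iota_diff_left[OF assms, of "\<lambda>_. 1"] by simp

text \<open>Two sequences are compared so that the choice w = u gives the Cauchy property and a
  general w the independence of the limit from the sequence.\<close>

lemma iota_one_diff_tendsto:
  assumes f: "f \<in> Fc F" and u: "\<And>n. u n \<in> Cc F" "(\<lambda>n. E1c M E (\<lambda>x. u n x - f x)) \<longlonglongrightarrow> 0"
    and w: "\<And>n. w n \<in> Cc F" "(\<lambda>n. E1c M E (\<lambda>x. w n x - f x)) \<longlonglongrightarrow> 0"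
  shows "\<forall>e>0. \<exists>N. \<forall>m\<ge>N. \<forall>n\<ge>N. norm (\<iota> [(u m, \<lambda>_. 1)] - \<iota> [(w n, \<lambda>_. 1)]) < e"
proof (intro allI impI)
  fix e :: real assume e: "e > 0"
  define p where "p = (\<lambda>(v :: nat \<Rightarrow> 'a \<Rightarrow> complex) n. \<E> (\<lambda>x. Re (v n x) - Re (f x))
      + \<E> (\<lambda>x. Im (v n x) - Im (f x)) :: real)"
  have lim: "p u \<longlonglongrightarrow> 0" "p w \<longlonglongrightarrow> 0"
    using u(2) w(2) unfolding E1c_tendsto_iff[OF Fc_diff[OF Cc_Fc[OF u(1)] f]] E1c_tendsto_iff[OF Fc_diff[OF Cc_Fc[OF w(1)] f]]
    by (auto simp: p_def intro!: tendsto_eq_intros)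
  have e4: "e\<^sup>2 / 4 > 0" using e by simp
  obtain N1 where N1: "\<And>n. n \<ge> N1 \<Longrightarrow> p u n < e\<^sup>2 / 4"
    using order_tendstoD(2)[OF lim(1) e4] by (auto simp: eventually_sequentially)
  obtain N2 where N2: "\<And>n. n \<ge> N2 \<Longrightarrow> p w n < e\<^sup>2 / 4"
    using order_tendstoD(2)[OF lim(2) e4] by (auto simp: eventually_sequentially)
  show "\<exists>N. \<forall>m\<ge>N. \<forall>n\<ge>N. norm (\<iota> [(u m, \<lambda>_. 1)] - \<iota> [(w n, \<lambda>_. 1)]) < e"
  proof (intro exI[of _ "max N1 N2"] allI impI)
    fix m n assume mn: "m \<ge> max N1 N2" "n \<ge> max N1 N2"
    have "(norm (\<iota> [(u m, \<lambda>_. 1)] - \<iota> [(w n, \<lambda>_. 1)]))\<^sup>2 \<le> 2 * p u m + 2 * p w n"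
      unfolding norm_iota_one_diff[OF u(1) w(1)] p_def
      using E_diff_le[OF FcD(1)[OF Cc_Fc[OF u(1)[of m]]] FcD(1)[OF Cc_Fc[OF w(1)[of n]]] FcD(1)[OF f]]
        E_diff_le[OF FcD(2)[OF Cc_Fc[OF u(1)[of m]]] FcD(2)[OF Cc_Fc[OF w(1)[of n]]] FcD(2)[OF f]]
      by simp
    also have "\<dots> < e\<^sup>2" using N1[of m] N2[of n] mn by simp
    finally show "norm (\<iota> [(u m, \<lambda>_. 1)] - \<iota> [(w n, \<lambda>_. 1)]) < e" using e by (simp add: power_less_imp_less_base)
  qed
qed

lemma partialH_tendsto:
  assumes f: "f \<in> Fc F" and u: "\<And>n. u n \<in> Cc F" "(\<lambda>n. E1c M E (\<lambda>x. u n x - f x)) \<longlonglongrightarrow> 0"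
  shows "(\<lambda>n. \<iota> [(u n, \<lambda>_. 1)]) \<longlonglongrightarrow> partialH M E F \<iota> f"
proof -
  have "Cauchy (\<lambda>n. \<iota> [(u n, \<lambda>_. 1)])"
    using iota_one_diff_tendsto[OF f u u] by (intro CauchyI) blast
  then obtain v where v: "(\<lambda>n. \<iota> [(u n, \<lambda>_. 1)]) \<longlonglongrightarrow> v" using Cauchy_convergent convergent_def by blast
  have "\<exists>v. \<exists>fs. (\<forall>n. fs n \<in> Cc F) \<and> (\<lambda>n. E1c M E (\<lambda>x. fs n x - f x)) \<longlonglongrightarrow> 0 \<and> (\<lambda>n. \<iota> [(fs n, \<lambda>_. 1)]) \<longlonglongrightarrow> v"
    using u v by blast
  then have "\<exists>fs. (\<forall>n. fs n \<in> Cc F) \<and> (\<lambda>n. E1c M E (\<lambda>x. fs n x - f x)) \<longlonglongrightarrow> 0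
      \<and> (\<lambda>n. \<iota> [(fs n, \<lambda>_. 1)]) \<longlonglongrightarrow> partialH M E F \<iota> f"
    unfolding partialH_def by (rule someI_ex)
  then obtain w where w: "\<And>n. w n \<in> Cc F" "(\<lambda>n. E1c M E (\<lambda>x. w n x - f x)) \<longlonglongrightarrow> 0"
    "(\<lambda>n. \<iota> [(w n, \<lambda>_. 1)]) \<longlonglongrightarrow> partialH M E F \<iota> f" by blast
  have "(\<lambda>n. \<iota> [(u n, \<lambda>_. 1)] - \<iota> [(w n, \<lambda>_. 1)]) \<longlonglongrightarrow> 0"
    using iota_one_diff_tendsto[OF f u w(1,2)] by (intro LIMSEQ_I) (metis diff_zero)
  from tendsto_add[OF this w(3)] show ?thesis by simp
qed

lemma partialH_Cc:
  assumes "f \<in> Cc F"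
  shows "partialH M E F \<iota> f = \<iota> [(f, \<lambda>_. 1)]"
proof -
  have "(\<lambda>n::nat. E1c M E (\<lambda>x. f x - f x)) \<longlonglongrightarrow> 0"
    by (simp add: E1c_def Ec_def)
  from partialH_tendsto[OF Cc_Fc[OF assms] assms this] show ?thesis by (simp add: LIMSEQ_const_iff)
qed

subsection \<open>The commutator\<close>

lemma norm_iota_real:
  assumes a: "a \<in> Ccore F" and b: "b \<in> borel_measurable borel" "bounded (range b)"
  shows "integrable M (\<lambda>x. (cmod (b x))\<^sup>2 * gam M E F a x)"
    and "(norm (\<iota> [(\<lambda>x. complex_of_real (a x), b)]))\<^sup>2 = (\<integral>x. (cmod (b x))\<^sup>2 * gam M E F a x \<partial>M)"
proof -
  have c: "(\<lambda>x. complex_of_real (a x)) \<in> Cc F" using a by (simp add: Cc_of_real)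
  have [measurable]: "b \<in> borel_measurable M" using b(1) by (simp cong: measurable_cong_sets add: sets_M)
  have [measurable]: "gam M E F a \<in> borel_measurable M" "gam M E F (\<lambda>_. 0) \<in> borel_measurable M"
    using gam_integrable[OF Core_F[OF a]] gam_integrable[OF F_zero] by auto
  note n = norm_iota_single[OF c b]
  have ae: "AE x in M. (cmod (b x))\<^sup>2 * (gam M E F a x + gam M E F (\<lambda>_. 0) x) = (cmod (b x))\<^sup>2 * gam M E F a x"
    using gam_zero by eventually_elim simp
  show "integrable M (\<lambda>x. (cmod (b x))\<^sup>2 * gam M E F a x)"
    using n(1) integrable_cong_AE[OF _ _ ae] by simp
  show "(norm (\<iota> [(\<lambda>x. complex_of_real (a x), b)]))\<^sup>2 = (\<integral>x. (cmod (b x))\<^sup>2 * gam M E F a x \<partial>M)"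
    using n(2) integral_cong_AE[OF _ _ ae] by simp
qed

lemma Fc_L2:
  assumes "f \<in> Fc F"
  shows "L2r M (\<lambda>x. Re (f x))" "L2r M (\<lambda>x. Im (f x))"
  by (intro F_L2 FcD assms)+

lemma norm_iota_real_le:
  assumes a: "a \<in> Ccore F" "AE x in M. gam M E F a x \<le> 1" and b: "b \<in> Cc F"
  shows "(norm (\<iota> [(\<lambda>x. complex_of_real (a x), b)]))\<^sup>2 \<le> (\<integral>x. (Re (b x))\<^sup>2 \<partial>M) + (\<integral>x. (Im (b x))\<^sup>2 \<partial>M)"
proof -
  note n = norm_iota_real[OF a(1) Cc_meas[OF b] Cc_bounded[OF b]]
  have i: "integrable M (\<lambda>x. (Re (b x))\<^sup>2)" "integrable M (\<lambda>x. (Im (b x))\<^sup>2)"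
    using Fc_L2[OF Cc_Fc[OF b]] by (auto simp: L2r_def)
  have "(\<integral>x. (cmod (b x))\<^sup>2 * gam M E F a x \<partial>M) \<le> (\<integral>x. (cmod (b x))\<^sup>2 \<partial>M)"
  proof (rule integral_mono_AE[OF n(1)])
    show "integrable M (\<lambda>x. (cmod (b x))\<^sup>2)" using i by (simp add: cmod_power2)
    show "AE x in M. (cmod (b x))\<^sup>2 * gam M E F a x \<le> (cmod (b x))\<^sup>2"
      using a(2) by eventually_elim (simp add: mult_left_le)
  qed
  then show ?thesis unfolding n(2) using i by (simp add: cmod_power2)
qed

lemma real_coefficient:
  assumes "a \<in> Ccore F"
  shows "(\<lambda>x. complex_of_real (a x)) \<in> borel_measurable borel" "bounded (range (\<lambda>x. complex_of_real (a x)))"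
  using Cc_meas Cc_bounded assms by (auto simp: Cc_of_real)

text \<open>For core approximants u_n of f the Leibniz rule reads W n = a \<partial>u_n + Q n with Q
  n = u_n \<partial>a. The bound \<Gamma>(a) \<le> \<mu> makes Q continuous with respect to the L2
  norm, so W converges although only u_n, not a u_n, was known to converge in energy. Hence a u_n is
  Cauchy in energy, closedness puts a f into the domain, and the commutator is the limit of
  Q.\<close>

lemma
  assumes a: "a \<in> Ccore F" "AE x in M. gam M E F a x \<le> 1" and f: "f \<in> Fc F"
  shows Fc_real_mult: "(\<lambda>x. complex_of_real (a x) * f x) \<in> Fc F"
    and norm_commutator_le: "norm (partialH M E F \<iota> (\<lambda>x. complex_of_real (a x) * f x)
      - mulH F \<iota> (\<lambda>x. complex_of_real (a x)) (partialH M E F \<iota> f)) \<le> normL2 M f"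
proof -
  let ?\<alpha> = "\<lambda>x. complex_of_real (a x)"
  have ac: "?\<alpha> \<in> Cc F" using a by (simp add: Cc_of_real)
  obtain R where R: "\<And>x. \<bar>a x\<bar> \<le> R" using Core_bounded[OF a(1)] by metis
  have am: "a \<in> borel_measurable M" by (rule Core_meas[OF a(1)])
  obtain u where u: "\<And>n::nat. u n \<in> Cc F" "(\<lambda>n. E1c M E (\<lambda>x. u n x - f x)) \<longlonglongrightarrow> 0"
    by (rule Cc_approximation[OF f]) blast
  have lims: "(\<lambda>n. \<integral>x. (Re (u n x) - Re (f x))\<^sup>2 \<partial>M) \<longlonglongrightarrow> 0" "(\<lambda>n. \<integral>x. (Im (u n x) - Im (f x))\<^sup>2 \<partial>M) \<longlonglongrightarrow> 0"
    using u(2) unfolding E1c_tendsto_iff[OF Fc_diff[OF Cc_Fc[OF u(1)] f]] by auto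
  have uL2: "L2r M (\<lambda>x. Re (u n x))" "L2r M (\<lambda>x. Im (u n x))" for n using Fc_L2[OF Cc_Fc[OF u(1)]] by auto
  note fL2 = Fc_L2[OF f]
  define Q where "Q = (\<lambda>n. \<iota> [(?\<alpha>, u n)])"
  define W where "W = (\<lambda>n. \<iota> [(\<lambda>x. ?\<alpha> x * u n x, \<lambda>_. 1)])"
  define r where "r = mulH F \<iota> ?\<alpha> (partialH M E F \<iota> f)"
  have "(\<lambda>n. \<iota> (rmul [(u n, \<lambda>_. 1)] ?\<alpha>)) \<longlonglongrightarrow> r"
    unfolding r_def by (intro mulH_tendsto real_coefficient a(1) PS_one u(1) partialH_tendsto[OF f u])
  then have lr: "(\<lambda>n. \<iota> [(u n, ?\<alpha>)]) \<longlonglongrightarrow> r" by simp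
  have WQ: "W n = \<iota> [(u n, ?\<alpha>)] + Q n" for n unfolding W_def Q_def by (rule iota_leibniz[OF a(1) u(1)])
  define d where "d = (\<lambda>n. (\<integral>x. (Re (u n x) - Re (f x))\<^sup>2 \<partial>M) + (\<integral>x. (Im (u n x) - Im (f x))\<^sup>2 \<partial>M))"
  have ld: "d \<longlonglongrightarrow> 0" unfolding d_def using lims by (auto intro!: tendsto_eq_intros)
  have Qd: "(norm (Q m - Q n))\<^sup>2 \<le> 2 * d m + 2 * d n" for m n
  proof -
    have "Q m - Q n = \<iota> [(?\<alpha>, \<lambda>x. u m x - u n x)]"
      unfolding Q_def using iota_diff_right[OF ac Cc_meas[OF u(1)[of m]] Cc_bounded[OF u(1)[of m]] Cc_meas[OF u(1)[of n]] Cc_bounded[OF u(1)[of n]]] by simp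
    then have "(norm (Q m - Q n))\<^sup>2 \<le> (\<integral>x. (Re (u m x) - Re (u n x))\<^sup>2 \<partial>M) + (\<integral>x. (Im (u m x) - Im (u n x))\<^sup>2 \<partial>M)"
      using norm_iota_real_le[OF a Cc_diff[OF u(1)[of m] u(1)[of n]]] by simp
    also have "\<dots> \<le> 2 * d m + 2 * d n"
      unfolding d_def
      by (rule order_trans[OF add_mono[OF L2r_integral_diff_le[OF uL2(1)[of m] uL2(1)[of n] fL2(1)]
              L2r_integral_diff_le[OF uL2(2)[of m] uL2(2)[of n] fL2(2)]]]) simp
    finally show ?thesis .
  qed
  have "Cauchy Q"
  proof (rule CauchyI)
    fix e :: real assume e: "e > 0"
    then have e4: "e\<^sup>2 / 4 > 0" by simp
    obtain N where N: "\<And>n. n \<ge> N \<Longrightarrow> d n < e\<^sup>2 / 4"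
      using order_tendstoD(2)[OF ld e4] by (auto simp: eventually_sequentially)
    have "norm (Q m - Q n) < e" if "m \<ge> N" "n \<ge> N" for m n
    proof -
      have "(norm (Q m - Q n))\<^sup>2 < e\<^sup>2" using Qd[of m n] N[OF that(1)] N[OF that(2)] by linarith
      then show ?thesis using e by (simp add: power_less_imp_less_base)
    qed
    then show "\<exists>N. \<forall>m\<ge>N. \<forall>n\<ge>N. norm (Q m - Q n) < e" by blast
  qed
  then obtain q where q: "Q \<longlonglongrightarrow> q" using Cauchy_convergent convergent_def by blast
  have lW: "W \<longlonglongrightarrow> r + q" using tendsto_add[OF lr q] unfolding WQ[symmetric] by simp
  have uac: "(\<lambda>x. ?\<alpha> x * u n x) \<in> Cc F" for n by (rule Cc_real_mult[OF a(1) u(1)])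
  \<comment> \<open>Here p is either the real or the imaginary part, so that one closedness argument
    serves both.\<close>
  have mulF: "(\<lambda>x. a x * p (f x)) \<in> F \<and>
      (\<lambda>n. \<E> (\<lambda>x. a x * p (u n x) - a x * p (f x))) \<longlonglongrightarrow> 0 \<and>
      (\<lambda>n. \<integral>x. (a x * p (u n x) - a x * p (f x))\<^sup>2 \<partial>M) \<longlonglongrightarrow> 0"
    if pF: "\<And>n. (\<lambda>x. a x * p (u n x)) \<in> F" and pL: "\<And>n. L2r M (\<lambda>x. p (u n x))" "L2r M (\<lambda>x. p (f x))"
      and plim: "(\<lambda>n. \<integral>x. (p (u n x) - p (f x))\<^sup>2 \<partial>M) \<longlonglongrightarrow> 0"
      and pE: "\<And>m n. \<E> (\<lambda>x. a x * p (u m x) - a x * p (u n x)) \<le> (norm (W m - W n))\<^sup>2"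
    for p :: "complex \<Rightarrow> real"
  proof -
    have z: "(\<lambda>n. R\<^sup>2 * (\<integral>x. (p (u n x) - p (f x))\<^sup>2 \<partial>M)) \<longlonglongrightarrow> 0"
      using tendsto_mult_left[OF plim, of "R\<^sup>2"] by simp
    have le: "(\<integral>x. (a x * p (u n x) - a x * p (f x))\<^sup>2 \<partial>M) \<le> R\<^sup>2 * (\<integral>x. (p (u n x) - p (f x))\<^sup>2 \<partial>M)" for n
      using L2r_bounded_mult(2)[OF L2r_diff[OF pL(1)[of n] pL(2)] am R] by (simp add: right_diff_distrib)
    have l2: "(\<lambda>n. \<integral>x. (a x * p (u n x) - a x * p (f x))\<^sup>2 \<partial>M) \<longlonglongrightarrow> 0"
      by (rule tendsto_sandwich[OF always_eventually always_eventually tendsto_const z]) (use le in auto)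
    have "\<exists>N. \<forall>m\<ge>N. \<forall>n\<ge>N. \<E> (\<lambda>x. a x * p (u m x) - a x * p (u n x)) < e"
      if e: "e > 0" for e
    proof -
      have "sqrt e > 0" using e by simp
      then obtain N where N: "\<And>m n. m \<ge> N \<Longrightarrow> n \<ge> N \<Longrightarrow> norm (W m - W n) < sqrt e"
        using LIMSEQ_imp_Cauchy[OF lW] by (meson CauchyD)
      have "(norm (W m - W n))\<^sup>2 < e" if "m \<ge> N" "n \<ge> N" for m n
        using power_strict_mono[OF N[OF that], of 2] e by simp
      then show ?thesis using pE by (meson le_less_trans)
    qed
    from closed_form[OF pF L2r_bounded_mult(1)[OF pL(2) am R] l2 this] l2 show ?thesis by blast
  qed
  have WE: "(norm (W m - W n))\<^sup>2
      = \<E> (\<lambda>x. a x * Re (u m x) - a x * Re (u n x))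
      + \<E> (\<lambda>x. a x * Im (u m x) - a x * Im (u n x))" for m n
    unfolding W_def using norm_iota_one_diff[OF uac[of m] uac[of n]] by simp
  have pF: "(\<lambda>x. a x * Re (u n x)) \<in> F" "(\<lambda>x. a x * Im (u n x)) \<in> F" for n
    by (intro Core_F Core_mult a(1) CcD u(1))+
  have En: "\<E> (\<lambda>x. a x * Re (u m x) - a x * Re (u n x)) \<ge> 0"
    "\<E> (\<lambda>x. a x * Im (u m x) - a x * Im (u n x)) \<ge> 0" for m n
    by (intro E_nonneg F_diff pF)+
  have mR: "(\<lambda>x. a x * Re (f x)) \<in> F \<and>
      (\<lambda>n. \<E> (\<lambda>x. a x * Re (u n x) - a x * Re (f x))) \<longlonglongrightarrow> 0 \<and>
      (\<lambda>n. \<integral>x. (a x * Re (u n x) - a x * Re (f x))\<^sup>2 \<partial>M) \<longlonglongrightarrow> 0"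
    by (rule mulF[of Re]) (use pF uL2 fL2 lims WE En in auto)
  have mI: "(\<lambda>x. a x * Im (f x)) \<in> F \<and>
      (\<lambda>n. \<E> (\<lambda>x. a x * Im (u n x) - a x * Im (f x))) \<longlonglongrightarrow> 0 \<and>
      (\<lambda>n. \<integral>x. (a x * Im (u n x) - a x * Im (f x))\<^sup>2 \<partial>M) \<longlonglongrightarrow> 0"
    by (rule mulF[of Im]) (use pF uL2 fL2 lims WE En in auto)
  show af: "(\<lambda>x. ?\<alpha> x * f x) \<in> Fc F" using mR mI by (simp add: Fc_def)
  have "(\<lambda>n. E1c M E (\<lambda>x. ?\<alpha> x * u n x - ?\<alpha> x * f x)) \<longlonglongrightarrow> 0"
    unfolding E1c_tendsto_iff[OF Fc_diff[OF Cc_Fc[OF uac] af]] using mR mI by simp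
  then have "W \<longlonglongrightarrow> partialH M E F \<iota> (\<lambda>x. ?\<alpha> x * f x)"
    unfolding W_def by (rule partialH_tendsto[OF af uac])
  then have eq: "partialH M E F \<iota> (\<lambda>x. ?\<alpha> x * f x) = r + q" using lW LIMSEQ_unique by blast
  have "(norm q)\<^sup>2 \<le> (normL2 M f)\<^sup>2"
  proof (rule LIMSEQ_le)
    show "(\<lambda>n. (norm (Q n))\<^sup>2) \<longlonglongrightarrow> (norm q)\<^sup>2" by (intro tendsto_intros q)
    show "(\<lambda>n. (\<integral>x. (Re (u n x))\<^sup>2 \<partial>M) + (\<integral>x. (Im (u n x))\<^sup>2 \<partial>M)) \<longlonglongrightarrow> (normL2 M f)\<^sup>2"
      unfolding normL2_sq[OF fL2] by (intro tendsto_intros L2r_square_tendsto uL2 fL2 lims)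
    show "\<exists>N. \<forall>n\<ge>N. (norm (Q n))\<^sup>2 \<le> (\<integral>x. (Re (u n x))\<^sup>2 \<partial>M) + (\<integral>x. (Im (u n x))\<^sup>2 \<partial>M)"
      unfolding Q_def using norm_iota_real_le[OF a u(1)] by blast
  qed
  then have "norm q \<le> normL2 M f" by (rule power2_le_imp_le) (rule normL2_nonneg)
  then show "norm (partialH M E F \<iota> (\<lambda>x. ?\<alpha> x * f x) - mulH F \<iota> ?\<alpha> (partialH M E F \<iota> f)) \<le> normL2 M f"
    unfolding eq r_def[symmetric] by simp
qed

lemma L2_approximation:
  assumes "L2r M g"
  obtains v where "\<And>n::nat. v n \<in> F" "(\<lambda>n. \<integral>x. (v n x - g x)\<^sup>2 \<partial>M) \<longlonglongrightarrow> 0"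
proof -
  have dense: "\<forall>u. L2r M u \<longrightarrow> (\<forall>e>0. \<exists>v\<in>F. (\<integral>x. (u x - v x)\<^sup>2 \<partial>M) < e)"
    using form by (simp add: sym_dirichlet_form_def)
  have "\<exists>v. \<forall>n::nat. v n \<in> F \<and> (\<integral>x. (g x - v n x)\<^sup>2 \<partial>M) < inverse (real (Suc n))"
  proof (rule choice, rule allI)
    fix n :: nat
    have "inverse (real (Suc n)) > 0" by simp
    then show "\<exists>v. v \<in> F \<and> (\<integral>x. (g x - v x)\<^sup>2 \<partial>M) < inverse (real (Suc n))" using dense assms by blast
  qed
  then obtain v where v: "\<And>n::nat. v n \<in> F" "\<And>n. (\<integral>x. (g x - v n x)\<^sup>2 \<partial>M) < inverse (real (Suc n))" by blast
  have le: "(\<integral>x. (v n x - g x)\<^sup>2 \<partial>M) \<le> inverse (real (Suc n))" for n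
    using less_imp_le[OF v(2)[of n]] by (simp add: power2_commute)
  have "(\<lambda>n. \<integral>x. (v n x - g x)\<^sup>2 \<partial>M) \<longlonglongrightarrow> 0"
    by (rule tendsto_sandwich[OF always_eventually always_eventually tendsto_const LIMSEQ_inverse_real_of_nat])
       (use le in auto)
  then show ?thesis using that v(1) by blast
qed

text \<open>Tested against h in the domain, G is minus the adjoint of the first commutator applied
  to \<omega>, because a real multiplication is symmetric on both components. Therefore the real
  part of the inner product of h and G is at most the product of the norms of h and \<omega>.
  Letting h tend to G in L2 gives that the square of the norm of G is at most its norm times that of
  \<omega>.\<close>

lemma norm_adjoint_commutator_le:
  assumes a: "a \<in> Ccore F" "AE x in M. gam M E F a x \<le> 1"
    and g1: "adjoint_rel M E F \<iota> \<omega> g1"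
    and g2: "adjoint_rel M E F \<iota> (mulH F \<iota> (\<lambda>x. complex_of_real (a x)) \<omega>) g2"
  shows "normL2 M (\<lambda>x. g2 x - complex_of_real (a x) * g1 x) \<le> norm \<omega>"
proof -
  let ?\<alpha> = "\<lambda>x. complex_of_real (a x)"
  obtain R where R: "\<And>x. \<bar>a x\<bar> \<le> R" using Core_bounded[OF a(1)] by metis
  have am: "a \<in> borel_measurable M" by (rule Core_meas[OF a(1)])
  have l1: "L2r M (\<lambda>x. Re (g1 x))" "L2r M (\<lambda>x. Im (g1 x))" and l2: "L2r M (\<lambda>x. Re (g2 x))" "L2r M (\<lambda>x. Im (g2 x))"
    using g1 g2 L2c_parts unfolding adjoint_rel_def by auto
  have l1a: "L2r M (\<lambda>x. Re (?\<alpha> x * g1 x))" "L2r M (\<lambda>x. Im (?\<alpha> x * g1 x))"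
    using L2r_bounded_mult(1)[OF l1(1) am R] L2r_bounded_mult(1)[OF l1(2) am R] by auto
  define G where "G = (\<lambda>x. g2 x - ?\<alpha> x * g1 x)"
  have lG: "L2r M (\<lambda>x. Re (G x))" "L2r M (\<lambda>x. Im (G x))"
    using L2r_diff[OF l2(1) l1a(1)] L2r_diff[OF l2(2) l1a(2)] by (auto simp: G_def)
  have test: "Re (innerL2 M h G) \<le> normL2 M h * norm \<omega>" if h: "h \<in> Fc F" for h
  proof -
    note lh = Fc_L2[OF h]
    have "Re (innerL2 M h G) = Re (innerL2 M h g2) - Re (innerL2 M h (\<lambda>x. ?\<alpha> x * g1 x))"
      unfolding Re_innerL2[OF lh lG] Re_innerL2[OF lh l2] Re_innerL2[OF lh l1a] unfolding G_def
      using L2r_mult_integrable[OF lh(1) l2(1)] L2r_mult_integrable[OF lh(2) l2(2)]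
        L2r_mult_integrable[OF lh(1) l1a(1)] L2r_mult_integrable[OF lh(2) l1a(2)]
      by (simp add: right_diff_distrib)
    also have "Re (innerL2 M h g2) = inner (partialH M E F \<iota> h) (mulH F \<iota> ?\<alpha> \<omega>)"
      using g2 h unfolding adjoint_rel_def by simp
    also have "\<dots> = inner (mulH F \<iota> ?\<alpha> (partialH M E F \<iota> h)) \<omega>"
      by (rule mulH_symmetric[symmetric, OF real_coefficient[OF a(1)]]) simp
    also have "innerL2 M h (\<lambda>x. ?\<alpha> x * g1 x) = innerL2 M (\<lambda>x. ?\<alpha> x * h x) g1"
      unfolding innerL2_def by (simp add: mult_ac)
    also have "Re \<dots> = inner (partialH M E F \<iota> (\<lambda>x. ?\<alpha> x * h x)) \<omega>"
      using g1 Fc_real_mult[OF a h] unfolding adjoint_rel_def by simp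
    finally have "Re (innerL2 M h G) = inner (- (partialH M E F \<iota> (\<lambda>x. ?\<alpha> x * h x) - mulH F \<iota> ?\<alpha> (partialH M E F \<iota> h))) \<omega>"
      by (simp add: inner_diff_left)
    also have "\<dots> \<le> norm (partialH M E F \<iota> (\<lambda>x. ?\<alpha> x * h x) - mulH F \<iota> ?\<alpha> (partialH M E F \<iota> h)) * norm \<omega>"
      using norm_cauchy_schwarz[of "- (partialH M E F \<iota> (\<lambda>x. ?\<alpha> x * h x) - mulH F \<iota> ?\<alpha> (partialH M E F \<iota> h))" \<omega>] by (simp only: norm_minus_cancel)
    also have "\<dots> \<le> normL2 M h * norm \<omega>" by (intro mult_right_mono norm_commutator_le[OF a h]) simp
    finally show ?thesis .
  qed
  obtain v where v: "\<And>n::nat. v n \<in> F" "(\<lambda>n. \<integral>x. (v n x - Re (G x))\<^sup>2 \<partial>M) \<longlonglongrightarrow> 0"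
    by (rule L2_approximation[OF lG(1)]) blast
  obtain w where w: "\<And>n::nat. w n \<in> F" "(\<lambda>n. \<integral>x. (w n x - Im (G x))\<^sup>2 \<partial>M) \<longlonglongrightarrow> 0"
    by (rule L2_approximation[OF lG(2)]) blast
  define h where "h = (\<lambda>n x. Complex (v n x) (w n x))"
  have h: "h n \<in> Fc F" for n using v(1) w(1) by (simp add: h_def Fc_def)
  have vL: "L2r M (v n)" and wL: "L2r M (w n)" for n using F_L2 v(1) w(1) by auto
  have "(\<lambda>n. Re (innerL2 M (h n) G)) \<longlonglongrightarrow> (\<integral>x. Re (G x) * Re (G x) \<partial>M) + (\<integral>x. Im (G x) * Im (G x) \<partial>M)"
    unfolding Re_innerL2[OF Fc_L2[OF h] lG] unfolding h_def complex.sel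
    by (intro tendsto_add L2r_inner_tendsto vL wL lG v(2) w(2))
  then have lim1: "(\<lambda>n. Re (innerL2 M (h n) G)) \<longlonglongrightarrow> (normL2 M G)\<^sup>2"
    unfolding normL2_sq[OF lG] by (simp add: power2_eq_square)
  have "(\<lambda>n. (normL2 M (h n))\<^sup>2) \<longlonglongrightarrow> (normL2 M G)\<^sup>2"
    unfolding normL2_sq[OF lG] normL2_sq[OF Fc_L2[OF h]] unfolding h_def complex.sel
    by (intro tendsto_add L2r_square_tendsto vL wL lG v(2) w(2))
  from tendsto_real_sqrt[OF this] have "(\<lambda>n. normL2 M (h n)) \<longlonglongrightarrow> normL2 M G" by (simp add: normL2_nonneg)
  then have lim2: "(\<lambda>n. normL2 M (h n) * norm \<omega>) \<longlonglongrightarrow> normL2 M G * norm \<omega>" by (intro tendsto_intros)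
  have "(normL2 M G)\<^sup>2 \<le> normL2 M G * norm \<omega>"
    using LIMSEQ_le[OF lim1 lim2] test[OF h] by blast
  then have "normL2 M G \<le> norm \<omega>"
    using normL2_nonneg[of M G] by (cases "normL2 M G = 0") (auto simp: power2_eq_square)
  then show ?thesis unfolding G_def .
qed

text \<open>The commutator is off-diagonal: its scalar component depends on \<omega> alone and its
  module component on f alone, so the two bounds are squared and added.\<close>

lemma comm_norm_le1I:
  assumes a: "a \<in> Ccore F" "AE x in M. gam M E F a x \<le> 1"
  shows "comm_norm_le1 M E F \<iota> (\<lambda>x. complex_of_real (a x))"
  unfolding comm_norm_le1_def
proof (intro allI impI, elim conjE)
  fix f \<omega> g1 g2
  assume f: "f \<in> Fc F" and g: "adjoint_rel M E F \<iota> \<omega> g1" "adjoint_rel M E F \<iota> (mulH F \<iota> (\<lambda>x. complex_of_real (a x)) \<omega>) g2"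
  have "(normL2 M (\<lambda>x. g2 x - complex_of_real (a x) * g1 x))\<^sup>2 \<le> (norm \<omega>)\<^sup>2"
    by (rule power_mono[OF norm_adjoint_commutator_le[OF a g] normL2_nonneg])
  moreover have "(norm (partialH M E F \<iota> (\<lambda>x. complex_of_real (a x) * f x)
      - mulH F \<iota> (\<lambda>x. complex_of_real (a x)) (partialH M E F \<iota> f)))\<^sup>2 \<le> (normL2 M f)\<^sup>2"
    by (rule power_mono[OF norm_commutator_le[OF a f]]) simp
  ultimately show "(normL2 M (\<lambda>x. g2 x - complex_of_real (a x) * g1 x))\<^sup>2 +
      (norm (partialH M E F \<iota> (\<lambda>x. complex_of_real (a x) * f x)
      - mulH F \<iota> (\<lambda>x. complex_of_real (a x)) (partialH M E F \<iota> f)))\<^sup>2 \<le> (normL2 M f)\<^sup>2 + (norm \<omega>)\<^sup>2"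
    by linarith
qed

text \<open>With \<omega> = 0 and f = \<phi> a real core function, the commutator is exactly \<phi>
  \<partial>a, and the norm bound says that the integral of \<phi>^2 against \<Gamma>(a) is at most
  that against \<mu>. Letting \<phi> tend to the indicator of the set where the density exceeds 1,
  inside a compact set, shows that this set is null.\<close>

lemma comm_norm_le1D:
  assumes a: "a \<in> Ccore F" and le: "comm_norm_le1 M E F \<iota> (\<lambda>x. complex_of_real (a x))"
  shows "AE x in M. gam M E F a x \<le> 1"
proof -
  let ?\<alpha> = "\<lambda>x. complex_of_real (a x)"
  have gi: "integrable M (gam M E F a)" by (rule gam_integrable[OF Core_F[OF a]])
  then have [measurable]: "gam M E F a \<in> borel_measurable M" by auto
  have test: "(\<integral>x. (\<phi> x)\<^sup>2 * gam M E F a x \<partial>M) \<le> (\<integral>x. (\<phi> x)\<^sup>2 \<partial>M)" if \<phi>: "\<phi> \<in> Ccore F" for \<phi>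
  proof -
    let ?f = "\<lambda>x. complex_of_real (\<phi> x)"
    have f: "?f \<in> Cc F" using \<phi> by (simp add: Cc_of_real)
    note af = Cc_real_mult[OF a f]
    \<comment> \<open>The zero vector is in the domain of the adjoint with value 0, so the scalar
      component contributes nothing.\<close>
    have adj: "adjoint_rel M E F \<iota> 0 (\<lambda>_. 0)" by (simp add: adjoint_rel_def L2c_def innerL2_def)
    have m0: "mulH F \<iota> ?\<alpha> 0 = 0" by (rule mulH_zero[OF real_coefficient[OF a]])
    have "(norm (partialH M E F \<iota> (\<lambda>x. ?\<alpha> x * ?f x) - mulH F \<iota> ?\<alpha> (partialH M E F \<iota> ?f)))\<^sup>2 \<le> (normL2 M ?f)\<^sup>2"
      using le[unfolded comm_norm_le1_def, rule_format, of ?f 0 "\<lambda>_. 0" "\<lambda>_. 0"] Cc_Fc[OF f] Cc_Fc[OF af] adj m0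
      by (simp add: normL2_def)
    moreover have "partialH M E F \<iota> (\<lambda>x. ?\<alpha> x * ?f x) - mulH F \<iota> ?\<alpha> (partialH M E F \<iota> ?f) = \<iota> [(?\<alpha>, ?f)]"
      unfolding partialH_Cc[OF af] partialH_Cc[OF f] mulH_iota[OF real_coefficient[OF a] PS_one[OF f]]
      using iota_leibniz[OF a f] by simp
    moreover have "(normL2 M ?f)\<^sup>2 = (\<integral>x. (\<phi> x)\<^sup>2 \<partial>M)"
      using normL2_sq[OF Fc_L2[OF Cc_Fc[OF f]]] by simp
    ultimately show ?thesis using norm_iota_real(2)[OF a real_coefficient[OF \<phi>]] by simp
  qed
  show ?thesis
  proof (rule AE_compactI)
    fix K :: "'a set" assume K: "compact K"
    have [measurable]: "K \<in> sets M" using compact_imp_closed[OF K] by (simp add: sets_M)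
    define A where "A = {x \<in> K. gam M E F a x > 1}"
    have "{x \<in> space M. x \<in> K \<and> gam M E F a x > 1} \<in> sets M" by measurable
    then have A [measurable]: "A \<in> sets M" by (simp add: A_def)
    have AK: "A \<subseteq> K" by (auto simp: A_def)
    obtain \<phi> \<theta> where \<phi>: "\<And>n::nat. \<phi> n \<in> Ccore F" "\<theta> \<in> Ccore F" "\<And>n x. 0 \<le> \<phi> n x" "\<And>n x. \<phi> n x \<le> \<theta> x"
      "\<And>x. \<theta> x \<le> 1" "AE x in M. (\<lambda>n. \<phi> n x) \<longlonglongrightarrow> indicator A x"
      by (rule indicator_approximation[OF A AK K]) blast
    have [measurable]: "\<phi> n \<in> borel_measurable M" for n by (rule Core_meas[OF \<phi>(1)])
    have sq: "(indicator A x :: real)\<^sup>2 = indicator A x" for x by (simp add: indicator_def)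
    have lim: "AE x in M. (\<lambda>n. (\<phi> n x)\<^sup>2) \<longlonglongrightarrow> indicator A x"
      using \<phi>(6)
    proof eventually_elim
      case (elim x)
      from tendsto_power[OF elim, of 2] show ?case unfolding sq .
    qed
    have \<phi>1: "(\<phi> n x)\<^sup>2 \<le> 1" for n x using \<phi>(3)[of n x] \<phi>(4)[of n x] \<phi>(5)[of x] by (simp add: power_le_one)
    have lim': "AE x in M. (\<lambda>n. (\<phi> n x)\<^sup>2 * gam M E F a x) \<longlonglongrightarrow> indicator A x * gam M E F a x"
      using lim by eventually_elim (intro tendsto_intros)
    have bd': "AE x in M. norm ((\<phi> n x)\<^sup>2 * gam M E F a x) \<le> gam M E F a x" for n
      using \<phi>1 gam_nonneg[OF Core_F[OF a]] by (intro AE_I2) (auto simp: abs_mult intro!: mult_left_le_one_le)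
    have \<theta>i: "integrable M (\<lambda>x. (\<theta> x)\<^sup>2)" using F_L2[OF Core_F[OF \<phi>(2)]] by (simp add: L2r_def)
    have bd: "AE x in M. norm ((\<phi> n x)\<^sup>2) \<le> (\<theta> x)\<^sup>2" for n
      using \<phi>(3,4) by (intro AE_I2) (auto intro!: power_mono)
    have i1: "integrable M (\<lambda>x. indicator A x * gam M E F a x)"
      by (rule integrable_dominated_convergence[OF _ _ gi lim' bd']) auto
    have i2: "integrable M (\<lambda>x. indicator A x :: real)"
      by (rule integrable_dominated_convergence[OF _ _ \<theta>i lim bd]) auto
    have "(\<integral>x. indicator A x * gam M E F a x \<partial>M) \<le> (\<integral>x. indicator A x \<partial>M)"
    proof (rule LIMSEQ_le)
      show "(\<lambda>n. \<integral>x. (\<phi> n x)\<^sup>2 * gam M E F a x \<partial>M) \<longlonglongrightarrow> (\<integral>x. indicator A x * gam M E F a x \<partial>M)"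
        by (rule integral_dominated_convergence[OF _ _ gi lim' bd']) auto
      show "(\<lambda>n. \<integral>x. (\<phi> n x)\<^sup>2 \<partial>M) \<longlonglongrightarrow> (\<integral>x. indicator A x \<partial>M)"
        by (rule integral_dominated_convergence[OF _ _ \<theta>i lim bd]) auto
    qed (use test[OF \<phi>(1)] in blast)
    moreover have nn: "0 \<le> indicator A x * gam M E F a x - indicator A x" for x
      by (auto simp: A_def indicator_def)
    then have "0 \<le> (\<integral>x. indicator A x * gam M E F a x - indicator A x \<partial>M)"
      by (intro Bochner_Integration.integral_nonneg)
    ultimately have "(\<integral>x. indicator A x * gam M E F a x - indicator A x \<partial>M) = 0" using i1 i2 by simp
    then have "AE x in M. indicator A x * gam M E F a x - indicator A x = 0"
      using integral_nonneg_eq_0_iff_AE[OF Bochner_Integration.integrable_diff[OF i1 i2]] nn by auto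
    then show "AE x in M. x \<in> K \<longrightarrow> gam M E F a x \<le> 1"
      by eventually_elim (auto simp: A_def indicator_def split: if_splits)
  qed
qed

end

section \<open>Locality of the energy measure\<close>

text \<open>\<open>damp n s\<close> is the derivative of \<open>t (1 - t\<^sup>2 / R\<^sup>2)\<^sup>n\<close> at \<open>s = t\<^sup>2 / R\<^sup>2\<close>.
  For \<open>n s\<close> small it is close to \<open>1\<close>, and for \<open>n s\<close> large close to \<open>0\<close>.\<close>

definition damp :: "nat \<Rightarrow> real \<Rightarrow> real" where
  "damp n s = (1 - s)^n - 2 * (real n * s * (1 - s)^(n - 1))"

text \<open>The product rule for t (1 - s)^(n+1) = (t (1 - s)^n) (1 - s) with s = t^2 / R^2; the
  recursion has the shape in which the Leibniz rule for densities produces it.\<close>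

lemma damp_Suc: "damp (Suc n) s = (1 - s) * damp n s - 2 * s * (1 - s)^n"
  by (cases n) (simp_all add: damp_def algebra_simps)

text \<open>The induction bounds the probability of at most one success in m + 1 independent trials
  with success probability s; the claim keeps the term for exactly one success.\<close>

lemma binomial_term_le_one:
  assumes "0 \<le> s" "s \<le> (1::real)"
  shows "real n * s * (1 - s)^(n - 1) \<le> 1"
proof -
  have "(1 - s)^Suc m + real (Suc m) * s * (1 - s)^m \<le> 1" for m
  proof (induction m)
    case (Suc m)
    have "(1 - s)^Suc (Suc m) + real (Suc (Suc m)) * s * (1 - s)^Suc m = (1 - s)^Suc m + real (Suc m) * s * (1 - s)^Suc m"
      by (simp add: algebra_simps)
    also have "\<dots> \<le> (1 - s)^Suc m + real (Suc m) * s * (1 - s)^m"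
      using assms by (intro add_left_mono mult_left_mono power_decreasing) auto
    also have "\<dots> \<le> 1" by (rule Suc.IH)
    finally show ?case .
  qed simp
  moreover have "(1 - s)^m \<ge> 0" for m using assms by simp
  ultimately have "real (Suc m) * s * (1 - s)^m \<le> 1" for m
    by (smt (verit))
  then show ?thesis by (cases n) auto
qed

lemma abs_damp_le:
  assumes "0 \<le> s" "s \<le> 1"
  shows "\<bar>damp n s\<bar> \<le> 3"
proof -
  have "0 \<le> (1 - s)^n" "(1 - s)^n \<le> 1" "0 \<le> real n * s * (1 - s)^(n - 1)" using assms by (auto simp: power_le_one)
  then show ?thesis using binomial_term_le_one[OF assms, of n] unfolding damp_def by linarith
qed

text \<open>Bernoulli's inequality costs n s for the power, and the doubled second term costs
  another 2 n s.\<close>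

lemma damp_near_one:
  assumes "0 \<le> s" "s \<le> 1"
  shows "\<bar>damp n s - 1\<bar> \<le> 3 * (real n * s)"
proof -
  have "1 - real n * s \<le> (1 - s)^n" using Bernoulli_inequality[of "- s" n] assms by simp
  moreover have "(1 - s)^n \<le> 1" "(1 - s)^(n - 1) \<le> 1" "0 \<le> (1 - s)^(n - 1)" using assms by (auto simp: power_le_one)
  moreover have "real n * s * (1 - s)^(n - 1) \<le> real n * s" "0 \<le> real n * s * (1 - s)^(n - 1)"
    using assms calculation by (auto intro!: mult_left_le)
  ultimately show ?thesis unfolding damp_def by linarith
qed

lemma power_one_minus_le_exp:
  assumes "0 \<le> s" "s \<le> (1::real)"
  shows "(1 - s)^n \<le> exp (- (real n * s))"
proof -
  have "(1 - s)^n \<le> (exp (- s))^n" using exp_ge_add_one_self[of "- s"] assms by (intro power_mono) auto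
  then show ?thesis by (simp add: exp_of_nat_mult[symmetric])
qed

lemma damp_near_zero:
  assumes "0 \<le> s" "s \<le> 1"
  shows "\<bar>damp n s\<bar> \<le> (1 + 2 * exp 1 * (real n * s)) * exp (- (real n * s))"
proof -
  have 1: "(1 - s)^n \<le> exp (- (real n * s))" by (rule power_one_minus_le_exp[OF assms])
  have "(1 - s)^(n - 1) \<le> exp (- (real (n - 1) * s))" by (rule power_one_minus_le_exp[OF assms])
  \<comment> \<open>The exponent is n - 1 rather than n; as s \<le> 1 the loss is at most a factor
    exp 1.\<close>
  also have "\<dots> \<le> exp (1 + - (real n * s))"
    using assms by (cases n) (auto simp: algebra_simps)
  finally have "(1 - s)^(n - 1) \<le> exp 1 * exp (- (real n * s))" by (simp only: exp_add)
  then have "real n * s * (1 - s)^(n - 1) \<le> real n * s * (exp 1 * exp (- (real n * s)))"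
    using assms by (intro mult_left_mono) auto
  moreover have "0 \<le> (1 - s)^n" "0 \<le> real n * s * (1 - s)^(n - 1)" using assms by auto
  ultimately show ?thesis using 1 unfolding damp_def by (auto simp: algebra_simps)
qed

lemma tendsto_damp_bound: "((\<lambda>z::real. (1 + 2 * exp 1 * z) * exp (- z)) \<longlongrightarrow> 0) at_top"
proof -
  have "((\<lambda>z::real. z^0 / exp z + 2 * exp 1 * (z^1 / exp z)) \<longlongrightarrow> 0 + 2 * exp 1 * 0) at_top"
    by (intro tendsto_intros tendsto_power_div_exp_0)
  moreover have "(\<lambda>z::real. z^0 / exp z + 2 * exp 1 * (z^1 / exp z)) = (\<lambda>z. (1 + 2 * exp 1 * z) * exp (- z))"
    by (auto simp: exp_minus field_simps)
  ultimately show ?thesis by simp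
qed

section \<open>Polynomial chain rule and vanishing on zero sets\<close>

context local_dirichlet
begin

text \<open>Induction by linearity and Leibniz. The recursion multiplies by w twice instead of by 1
  - w^2 / R^2, because a constant need not lie in the core.\<close>

lemma
  assumes w: "w \<in> Ccore F"
  shows damped_Core: "(\<lambda>x. w x * (1 - (w x)\<^sup>2 / R\<^sup>2)^n) \<in> Ccore F"
    and gam2_damped: "k \<in> Ccore F \<Longrightarrow>
      AE x in M. gam2 M E F (\<lambda>x. w x * (1 - (w x)\<^sup>2 / R\<^sup>2)^n) k x = damp n ((w x)\<^sup>2 / R\<^sup>2) * gam2 M E F w k x"
proof -
  define P where "P = (\<lambda>n x. w x * (1 - (w x)\<^sup>2 / R\<^sup>2)^n)"
  have PSuc: "P (Suc n) = (\<lambda>x. P n x + (- 1 / R\<^sup>2) * (w x * (w x * P n x)))" for n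
    by (auto simp: P_def fun_eq_iff power2_eq_square algebra_simps)
  have P0: "P 0 = w" by (auto simp: P_def)
  have PC: "P n \<in> Ccore F" for n
  proof (induction n)
    case (Suc n)
    show ?case unfolding PSuc by (intro Core_closed w Suc.IH)
  qed (simp add: P0 w)
  then show "(\<lambda>x. w x * (1 - (w x)\<^sup>2 / R\<^sup>2)^n) \<in> Ccore F" unfolding P_def by simp
  assume k: "k \<in> Ccore F"
  have "AE x in M. gam2 M E F (P n) k x = damp n ((w x)\<^sup>2 / R\<^sup>2) * gam2 M E F w k x"
  proof (induction n)
    case 0
    show ?case by (simp add: P0 damp_def)
  next
    case (Suc n)
    have wP: "(\<lambda>x. w x * P n x) \<in> Ccore F" "(\<lambda>x. w x * (w x * P n x)) \<in> Ccore F" by (intro Core_closed w PC)+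
    show ?case
      using Suc.IH gam2_linear[OF PC[of n] wP(2) k, of "- 1 / R\<^sup>2"] gam2_leibniz[OF w wP(1) k] gam2_leibniz[OF w PC[of n] k]
    proof eventually_elim
      case (elim x)
      define s where "s = (w x)\<^sup>2 / R\<^sup>2"
      define D where "D = gam2 M E F w k x"
      define p where "p = (1 - s)^n"
      have Pn: "P n x = w x * p" by (simp add: P_def p_def s_def)
      have "gam2 M E F (P (Suc n)) k x = damp n s * D + (- 1 / R\<^sup>2) * (w x * (w x * (damp n s * D) + w x * p * D) + w x * (w x * p) * D)"
        unfolding PSuc using elim unfolding s_def[symmetric] D_def[symmetric] Pn by simp
      also have "\<dots> = damp n s * D - s * (damp n s * D + 2 * p * D)"
        unfolding s_def power2_eq_square by (simp add: algebra_simps add_divide_distrib)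
      also have "\<dots> = damp (Suc n) s * D"
        unfolding damp_Suc p_def by (simp add: algebra_simps)
      finally show ?case unfolding s_def D_def .
    qed
  qed
  then show "AE x in M. gam2 M E F (\<lambda>x. w x * (1 - (w x)\<^sup>2 / R\<^sup>2)^n) k x = damp n ((w x)\<^sup>2 / R\<^sup>2) * gam2 M E F w k x"
    unfolding P_def .
qed

end

context hilbert_dirichlet
begin

text \<open>Damped approximants of \<open>u\<close> converge to \<open>0\<close> in \<open>L\<^sub>2\<close>, while their derivatives converge to
  \<open>1\<^bsub>{u = 0}\<^esub> \<partial>u\<close>; hence the latter vanishes because \<open>\<partial>\<close> is closed.\<close>

lemma gam_zero_set:
  assumes u: "u \<in> F"
  shows "AE x in M. u x = 0 \<longrightarrow> gam M E F u x = 0"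
proof -
  have um [measurable]: "u \<in> borel_measurable M" by (rule F_meas[OF u])
  have u2: "integrable M (\<lambda>x. (u x)\<^sup>2)" using F_L2[OF u] by (simp add: L2r_def)
  obtain w0 where w0: "\<And>n. w0 n \<in> Ccore F" "\<And>n. \<E> (\<lambda>x. w0 n x - u x) < (1/16)^n"
    "\<And>n. (\<integral>x. (w0 n x - u x)\<^sup>2 \<partial>M) < (1/16)^n"
    by (rule Core_approximation[where e = "\<lambda>n. (1/16)^n", OF u]) (simp, blast)
  have w0L: "L2r M (\<lambda>x. w0 n x - u x)" for n by (intro F_L2 F_diff Core_F w0(1) u)
  have z4: "(\<lambda>n. (1/4)^n) \<longlonglongrightarrow> (0::real)" and z16: "(\<lambda>n. (1/16)^n) \<longlonglongrightarrow> (0::real)" by (rule LIMSEQ_power_zero; simp)+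
  \<comment> \<open>The rate 16^(-n) leaves room for the weight 4^n. Almost everywhere along a
    subsequence the squared error then tends to 0 even after multiplication by 4^(r n): this is the
    coupling between exponent and approximation.\<close>
  have "(\<lambda>n. \<integral>x. norm (4^n * (w0 n x - u x)\<^sup>2) \<partial>M) \<longlonglongrightarrow> 0"
  proof (rule tendsto_sandwich[OF always_eventually always_eventually tendsto_const z4]; intro allI)
    fix n
    have "(\<integral>x. norm (4^n * (w0 n x - u x)\<^sup>2) \<partial>M) = 4^n * (\<integral>x. (w0 n x - u x)\<^sup>2 \<partial>M)" by simp
    also have "\<dots> \<le> 4^n * (1/16)^n" using less_imp_le[OF w0(3)[of n]] by (intro mult_left_mono) auto
    also have "\<dots> = (1/4)^n" by (simp flip: power_mult_distrib)
    finally show "(\<integral>x. norm (4^n * (w0 n x - u x)\<^sup>2) \<partial>M) \<le> (1/4)^n" .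
  qed simp
  then obtain r :: "nat \<Rightarrow> nat" where r: "strict_mono r" "AE x in M. (\<lambda>n. 4^(r n) * (w0 (r n) x - u x)\<^sup>2) \<longlonglongrightarrow> 0"
    using tendsto_L1_AE_subseq[of M "\<lambda>n x. 4^n * (w0 n x - u x)\<^sup>2"] w0L by (auto simp: L2r_def)
  define w where "w = (\<lambda>n. w0 (r n))"
  have w: "w n \<in> Ccore F" for n unfolding w_def by (rule w0)
  have wF: "w n \<in> F" for n by (rule Core_F[OF w])
  have [measurable]: "w n \<in> borel_measurable M" for n by (rule F_meas[OF wF])
  have z16r: "(\<lambda>n. (1/16)^(r n)) \<longlonglongrightarrow> (0::real)" using LIMSEQ_subseq_LIMSEQ[OF z16 r(1)] by (simp add: o_def)
  have lE: "(\<lambda>n. \<E> (\<lambda>x. w n x - u x)) \<longlonglongrightarrow> 0"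
    by (rule tendsto_sandwich[OF always_eventually always_eventually tendsto_const z16r])
       (use E_nonneg F_diff wF u less_imp_le[OF w0(2)] in \<open>auto simp: w_def\<close>)
  have lL: "(\<lambda>n. \<integral>x. (w n x - u x)\<^sup>2 \<partial>M) \<longlonglongrightarrow> 0"
    by (rule tendsto_sandwich[OF always_eventually always_eventually tendsto_const z16r])
       (use less_imp_le[OF w0(3)] in \<open>auto simp: w_def\<close>)
  have "\<exists>R. \<forall>n. (\<forall>x. \<bar>w n x\<bar> \<le> real (R n)) \<and> R n > 0"
  proof (rule choice, rule allI)
    fix n
    obtain R0 where R0: "R0 > 0" "\<And>x. \<bar>w n x\<bar> \<le> R0" using Core_bounded[OF w[of n]] by blast
    obtain R where "real R > R0" using reals_Archimedean2 by blast
    then show "\<exists>R. (\<forall>x. \<bar>w n x\<bar> \<le> real R) \<and> R > 0" using R0 by (intro exI[of _ R]) (auto intro: order_trans less_imp_le)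
  qed
  then obtain R where R: "\<And>n x. \<bar>w n x\<bar> \<le> real (R n)" "\<And>n. R n > 0" by blast
  \<comment> \<open>Chosen so that N s = 4^(r n) w^2, which tends to 0 where u = 0 and to infinity
    elsewhere. The bound R is a natural number so that N can be an exponent.\<close>
  define N where "N = (\<lambda>n. 4^(r n) * (R n)\<^sup>2)"
  define s where "s = (\<lambda>n x. (w n x)\<^sup>2 / (real (R n))\<^sup>2)"
  have s01: "0 \<le> s n x" "s n x \<le> 1" for n x
    unfolding s_def using R(1)[of n x] R(2)[of n] abs_le_square_iff[of "w n x" "real (R n)"] by (auto simp: field_simps)
  have Ns: "real (N n) * s n x = 4^(r n) * (w n x)\<^sup>2" for n x
    unfolding N_def s_def using R(2)[of n] by simp
  define b where "b = (\<lambda>n x. damp (N n) (s n x))"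
  define b0 where "b0 = (\<lambda>x. indicator {x. u x = 0} x :: real)"
  define v where "v = (\<lambda>n x. w n x * (1 - s n x)^(N n))"
  have vC: "v n \<in> Ccore F" for n unfolding v_def s_def by (rule damped_Core[OF w])
  have sm [measurable]: "s n \<in> borel_measurable M" for n unfolding s_def by measurable
  have bm [measurable]: "b n \<in> borel_measurable M" for n unfolding b_def damp_def by measurable
  have [measurable]: "{x. u x = 0} \<in> sets M"
  proof -
    have "{x \<in> space M. u x = 0} \<in> sets M" by measurable
    then show ?thesis by simp
  qed
  have b0m [measurable]: "b0 \<in> borel_measurable M" unfolding b0_def by measurable
  have bb: "\<bar>b n x\<bar> \<le> 3" for n x unfolding b_def by (rule abs_damp_le[OF s01])
  have b0b: "\<bar>b0 x\<bar> \<le> 1" for x by (simp add: b0_def indicator_def)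

  have far: "filterlim (\<lambda>n. real (N n) * s n x) at_top sequentially"
    if l: "(\<lambda>n. 4^(r n) * (w n x - u x)\<^sup>2) \<longlonglongrightarrow> 0" and ux: "u x \<noteq> 0" for x
  proof -
    have "(\<lambda>n. (w n x - u x)\<^sup>2) \<longlonglongrightarrow> 0"
      by (rule tendsto_sandwich[OF always_eventually always_eventually tendsto_const l])
         (auto simp: mult_le_cancel_right1)
    then have "(\<lambda>n. w n x - u x) \<longlonglongrightarrow> 0"
      by (rule tendsto_zero_of_square_le_mult[of _ _ 1, rotated]) simp
    then have "(\<lambda>n. w n x) \<longlonglongrightarrow> u x" by (simp add: LIM_zero_iff)
    then have "(\<lambda>n. (w n x)\<^sup>2) \<longlonglongrightarrow> (u x)\<^sup>2" by (intro tendsto_intros)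
    moreover have "filterlim (\<lambda>n. 4^(r n) :: real) at_top sequentially"
    proof (rule filterlim_at_top_mono[OF filterlim_real_sequentially], intro always_eventually allI)
      fix n
      have "n \<le> r n" by (rule seq_suble[OF r(1)])
      also have "\<dots> \<le> 2^(r n)" by (rule less_imp_le[OF less_exp])
      finally have "real n \<le> 2^(r n)" by (metis of_nat_le_iff of_nat_numeral of_nat_power)
      also have "\<dots> \<le> 4^(r n)" by (rule power_mono) auto
      finally show "real n \<le> 4^(r n)" .
    qed
    ultimately show ?thesis unfolding Ns
      using filterlim_tendsto_pos_mult_at_top[of "\<lambda>n. (w n x)\<^sup>2" "(u x)\<^sup>2" sequentially "\<lambda>n. 4^(r n)"] ux
      by (simp add: mult.commute)
  qed
  have blim: "AE x in M. (\<lambda>n. b n x) \<longlonglongrightarrow> b0 x"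
    using r(2)[folded w_def]
  proof eventually_elim
    case (elim x)
    have l: "(\<lambda>n. 4^(r n) * (w n x - u x)\<^sup>2) \<longlonglongrightarrow> 0" using elim by (simp add: w_def)
    show ?case
    proof (cases "u x = 0")
      case True
      then have "(\<lambda>n. 3 * (real (N n) * s n x)) \<longlonglongrightarrow> 0" using tendsto_mult_left[OF l, of 3] by (simp add: Ns)
      then have "(\<lambda>n. b n x - 1) \<longlonglongrightarrow> 0"
        by (rule Lim_null_comparison[rotated]) (use damp_near_one[OF s01] in \<open>auto simp: b_def\<close>)
      then show ?thesis using True by (simp add: LIM_zero_iff b0_def)
    next
      case False
      have "(\<lambda>n. b n x) \<longlonglongrightarrow> 0"
        by (rule Lim_null_comparison[OF _ filterlim_compose[OF tendsto_damp_bound far[OF l False]]])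
           (use damp_near_zero[OF s01] in \<open>auto simp: b_def\<close>)
      then show ?thesis using False by (simp add: b0_def)
    qed
  qed
  have clim: "AE x in M. (\<lambda>n. (1 - s n x)^(N n) * u x) \<longlonglongrightarrow> 0"
    using r(2)[folded w_def]
  proof eventually_elim
    case (elim x)
    have l: "(\<lambda>n. 4^(r n) * (w n x - u x)\<^sup>2) \<longlonglongrightarrow> 0" using elim by (simp add: w_def)
    show ?case
    proof (cases "u x = 0")
      case False
      have e0: "((\<lambda>z::real. exp (- z)) \<longlongrightarrow> 0) at_top"
        by (rule filterlim_compose[OF exp_at_bot filterlim_uminus_at_bot_at_top])
      have "(\<lambda>n. (1 - s n x)^(N n)) \<longlonglongrightarrow> 0"
        by (rule Lim_null_comparison[OF _ filterlim_compose[OF e0 far[OF l False]]])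
           (use power_one_minus_le_exp[OF s01] s01 in auto)
      then show ?thesis using tendsto_mult_left_zero by blast
    qed simp
  qed

  \<comment> \<open>Split v = (1 - s)^N (w - u) + (1 - s)^N u: the first term is no larger than the
    L2 error of w, and the second is dominated by u and tends to 0 pointwise.\<close>
  have vL: "(\<lambda>n. \<integral>x. (v n x - 0)\<^sup>2 \<partial>M) \<longlonglongrightarrow> 0"
  proof -
    have c01: "\<bar>(1 - s n x)^(N n)\<bar> \<le> 1" for n x using s01[of n x] by (auto simp: power_le_one)
    have cm [measurable]: "(\<lambda>x. (1 - s n x)^(N n)) \<in> borel_measurable M" for n by measurable
    have "(\<lambda>n. \<integral>x. ((1 - s n x)^(N n) * u x)\<^sup>2 \<partial>M) \<longlonglongrightarrow> (\<integral>x. 0 \<partial>M)"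
    proof (rule integral_dominated_convergence[OF _ _ u2])
      show "AE x in M. (\<lambda>n. ((1 - s n x)^(N n) * u x)\<^sup>2) \<longlonglongrightarrow> 0"
        using clim
      proof eventually_elim
        case (elim x)
        from tendsto_power[OF elim, of 2] show ?case by simp
      qed
      show "AE x in M. norm (((1 - s n x)^(N n) * u x)\<^sup>2) \<le> (u x)\<^sup>2" for n
      proof (rule AE_I2)
        fix x
        have "((1 - s n x)^(N n))\<^sup>2 \<le> 1" using c01[of n x] by (simp add: abs_square_le_1)
        then show "norm (((1 - s n x)^(N n) * u x)\<^sup>2) \<le> (u x)\<^sup>2"
          unfolding power_mult_distrib by (simp add: mult_left_le_one_le)
      qed
    qed auto
    then have l2: "(\<lambda>n. 2 * (\<integral>x. (w n x - u x)\<^sup>2 \<partial>M) + 2 * (\<integral>x. ((1 - s n x)^(N n) * u x)\<^sup>2 \<partial>M)) \<longlonglongrightarrow> 0"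
      using lL by (auto intro!: tendsto_eq_intros)
    have le: "(\<integral>x. (v n x - 0)\<^sup>2 \<partial>M) \<le> 2 * (\<integral>x. (w n x - u x)\<^sup>2 \<partial>M) + 2 * (\<integral>x. ((1 - s n x)^(N n) * u x)\<^sup>2 \<partial>M)" for n
    proof -
      have d: "L2r M (\<lambda>x. w n x - u x)" by (intro F_L2 F_diff wF u)
      note l = L2r_bounded_mult(2)[OF d cm[of n] c01[of n]]
      have "(\<integral>x. (v n x - 0)\<^sup>2 \<partial>M) = (\<integral>x. ((1 - s n x)^(N n) * (w n x - u x) + (1 - s n x)^(N n) * u x)\<^sup>2 \<partial>M)"
        by (simp add: v_def algebra_simps)
      also have "\<dots> \<le> 2 * (\<integral>x. ((1 - s n x)^(N n) * (w n x - u x))\<^sup>2 \<partial>M) + 2 * (\<integral>x. ((1 - s n x)^(N n) * u x)\<^sup>2 \<partial>M)"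
        by (intro L2r_integral_add_le L2r_bounded_mult(1)[OF _ cm c01] d F_L2 u)
      also have "\<dots> \<le> 2 * (\<integral>x. (w n x - u x)\<^sup>2 \<partial>M) + 2 * (\<integral>x. ((1 - s n x)^(N n) * u x)\<^sup>2 \<partial>M)"
        using l by simp
      finally show ?thesis .
    qed
    show ?thesis
      by (rule tendsto_sandwich[OF always_eventually always_eventually tendsto_const l2]) (use le in auto)
  qed

  define cw where "cw = (\<lambda>n x. complex_of_real (w n x))"
  define cv where "cv = (\<lambda>n x. complex_of_real (v n x))"
  have cwC: "cw n \<in> Cc F" and cvC: "cv n \<in> Cc F" for n unfolding cw_def cv_def using w vC by (simp_all add: Cc_of_real)
  have toC: "(\<lambda>x. complex_of_real (f x)) \<in> borel_measurable borel" "bounded (range (\<lambda>x. complex_of_real (f x)))"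
    if "f \<in> borel_measurable M" "\<And>x. \<bar>f x\<bar> \<le> C" for f C
    using that measurable_cong_sets[OF sets_M refl, of borel] by (auto simp: bounded_range_iff)
  note bC = toC[OF bm bb] note b0C = toC[OF b0m b0b]
  define X where "X = (\<lambda>n. \<iota> [(cw n, \<lambda>x. complex_of_real (b n x))])"
  define Y where "Y = (\<lambda>n. \<iota> [(cw n, \<lambda>x. complex_of_real (b0 x))])"
  \<comment> \<open>The polynomial chain rule in the module: the derivative of the damped function
    is the derivative of w multiplied by b.\<close>
  have Xv: "\<iota> [(cv n, \<lambda>_. 1)] = X n" for n
    unfolding X_def
  proof (rule iota_cong)
    fix k assume k: "k \<in> Ccore F"
    show "AE x in M. pairing M E F [(cv n, \<lambda>_. 1)] k x = pairing M E F [(cw n, \<lambda>x. complex_of_real (b n x))] k x"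
      using gam2_damped[OF w[of n] k, of "real (R n)" "N n"] gam2_zero[OF k]
      unfolding s_def[symmetric] b_def[symmetric]
      by eventually_elim (simp add: gamh_def cv_def cw_def v_def b_def s_def)
  qed (use bC cwC cvC in \<open>auto simp: PS_single\<close>)

  have lg: "(\<lambda>n. \<integral>x. \<bar>gam M E F (w n) x - gam M E F u x\<bar> \<partial>M) \<longlonglongrightarrow> 0"
    by (rule gam_L1_tendsto[OF u w lE])
  have gi: "integrable M (gam M E F u)" and gwi: "integrable M (gam M E F (w n))" for n
    using gam_integrable u wF by auto
  have [measurable]: "gam M E F u \<in> borel_measurable M" "\<And>n. gam M E F (w n) \<in> borel_measurable M" using gi gwi by auto
  have mulgi: "integrable M (\<lambda>x. f x * g x)"
    if "integrable M g" "f \<in> borel_measurable M" "\<And>x. \<bar>f x\<bar> \<le> C" for f g :: "'a \<Rightarrow> real" and C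
  proof -
    have [measurable]: "f \<in> borel_measurable M" "g \<in> borel_measurable M" using that by auto
    show ?thesis
    proof (rule Bochner_Integration.integrable_bound[of _ "\<lambda>x. C * \<bar>g x\<bar>"], goal_cases)
      case 3
      have "norm (f x * g x) \<le> norm (C * \<bar>g x\<bar>)" for x
      proof -
        have "norm (f x * g x) = \<bar>f x\<bar> * \<bar>g x\<bar>" by (simp add: abs_mult)
        also have "\<dots> \<le> C * \<bar>g x\<bar>" by (rule mult_right_mono[OF that(3)]) simp
        also have "\<dots> \<le> norm (C * \<bar>g x\<bar>)" unfolding real_norm_def by (rule abs_ge_self)
        finally show ?thesis .
      qed
      then show ?case by (intro AE_I2)
    qed (use that in auto)
  qed

  \<comment> \<open>The squared norm integrates (b - b0)^2 against the varying density of w.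
    Replacing it by the fixed density of u costs 16 times an L1 distance, where 16 = (3 + 1)^2 comes
    from the bounds on b and b0; dominated convergence then applies.\<close>
  have XY: "(\<lambda>n. X n - Y n) \<longlonglongrightarrow> 0"
  proof -
    have d4: "\<bar>b n x - b0 x\<bar> \<le> 4" for n x using bb[of n x] b0b[of x] by linarith
    have d16: "\<bar>(b n x - b0 x)\<^sup>2\<bar> \<le> 16" for n x using power_mono[OF d4[of n x] abs_ge_zero, of 2] by simp
    have nrm: "(norm (X n - Y n))\<^sup>2 \<le> (\<integral>x. (b n x - b0 x)\<^sup>2 * gam M E F u x \<partial>M)
        + 16 * (\<integral>x. \<bar>gam M E F (w n) x - gam M E F u x\<bar> \<partial>M)" for n
    proof -
      have dm: "(\<lambda>x. b n x - b0 x) \<in> borel_measurable M" by measurable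
      have "X n - Y n = \<iota> [(cw n, \<lambda>x. complex_of_real (b n x - b0 x))]"
        unfolding X_def Y_def using iota_diff_right[OF cwC bC b0C] by simp
      then have "(norm (X n - Y n))\<^sup>2 = (\<integral>x. (b n x - b0 x)\<^sup>2 * gam M E F (w n) x \<partial>M)"
        using norm_iota_real(2)[OF w toC[OF dm d4]] by (simp add: cw_def del: of_real_diff)
      also have "\<dots> \<le> (\<integral>x. (b n x - b0 x)\<^sup>2 * gam M E F u x + 16 * \<bar>gam M E F (w n) x - gam M E F u x\<bar> \<partial>M)"
      proof (rule integral_mono)
        show "integrable M (\<lambda>x. (b n x - b0 x)\<^sup>2 * gam M E F (w n) x)"
          by (rule mulgi[OF gwi _ d16]) measurable
        have "integrable M (\<lambda>x. (b n x - b0 x)\<^sup>2 * gam M E F u x)"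
          by (rule mulgi[OF gi _ d16]) measurable
        then show "integrable M (\<lambda>x. (b n x - b0 x)\<^sup>2 * gam M E F u x + 16 * \<bar>gam M E F (w n) x - gam M E F u x\<bar>)"
          using gi gwi by auto
        fix x
        have "(b n x - b0 x)\<^sup>2 * (gam M E F (w n) x - gam M E F u x)
            \<le> (b n x - b0 x)\<^sup>2 * \<bar>gam M E F (w n) x - gam M E F u x\<bar>"
          by (intro mult_left_mono) auto
        also have "\<dots> \<le> 16 * \<bar>gam M E F (w n) x - gam M E F u x\<bar>"
          using d16[of n x] by (intro mult_right_mono) auto
        finally have "(b n x - b0 x)\<^sup>2 * (gam M E F (w n) x - gam M E F u x) \<le> 16 * \<bar>gam M E F (w n) x - gam M E F u x\<bar>" .
        then show "(b n x - b0 x)\<^sup>2 * gam M E F (w n) x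
            \<le> (b n x - b0 x)\<^sup>2 * gam M E F u x + 16 * \<bar>gam M E F (w n) x - gam M E F u x\<bar>"
          by (simp add: right_diff_distrib)
      qed
      also have "\<dots> = (\<integral>x. (b n x - b0 x)\<^sup>2 * gam M E F u x \<partial>M) + 16 * (\<integral>x. \<bar>gam M E F (w n) x - gam M E F u x\<bar> \<partial>M)"
      proof -
        have "integrable M (\<lambda>x. (b n x - b0 x)\<^sup>2 * gam M E F u x)"
          by (rule mulgi[OF gi _ d16]) measurable
        then show ?thesis using gi gwi by simp
      qed
      finally show ?thesis .
    qed
    have "(\<lambda>n. \<integral>x. (b n x - b0 x)\<^sup>2 * gam M E F u x \<partial>M) \<longlonglongrightarrow> (\<integral>x. 0 \<partial>M)"
    proof (rule integral_dominated_convergence[where w = "\<lambda>x. 16 * gam M E F u x"])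
      show "AE x in M. (\<lambda>n. (b n x - b0 x)\<^sup>2 * gam M E F u x) \<longlonglongrightarrow> 0"
        using blim
      proof eventually_elim
        case (elim x)
        have "(\<lambda>n. (b n x - b0 x)\<^sup>2 * gam M E F u x) \<longlonglongrightarrow> (b0 x - b0 x)\<^sup>2 * gam M E F u x"
          by (intro tendsto_intros elim)
        then show ?case by simp
      qed
      show "AE x in M. norm ((b n x - b0 x)\<^sup>2 * gam M E F u x) \<le> 16 * gam M E F u x" for n
        using d16[of n] gam_nonneg[OF u] by (intro AE_I2) (auto simp: abs_mult intro!: mult_right_mono)
    qed (use gi in auto)
    then have "(\<lambda>n. (\<integral>x. (b n x - b0 x)\<^sup>2 * gam M E F u x \<partial>M)
        + 16 * (\<integral>x. \<bar>gam M E F (w n) x - gam M E F u x\<bar> \<partial>M)) \<longlonglongrightarrow> 0"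
      using lg by (auto intro!: tendsto_eq_intros)
    then have "(\<lambda>n. (norm (X n - Y n))\<^sup>2) \<longlonglongrightarrow> 0"
      by (rule tendsto_sandwich[OF always_eventually always_eventually tendsto_const, rotated 2]) (use nrm in auto)
    then have "(\<lambda>n. norm (X n - Y n)) \<longlonglongrightarrow> 0"
      by (rule tendsto_zero_of_square_le_mult[of _ _ 1, rotated]) simp
    then show ?thesis by (rule tendsto_norm_zero_cancel)
  qed

  \<comment> \<open>Multiplication by b0 does not increase norms, so Y inherits the Cauchy property
    from w; its limit y stands for b0 \<partial>u.\<close>
  have "Cauchy Y"
  proof (rule CauchyI)
    fix e :: real assume e: "e > 0"
    then have e4: "e\<^sup>2 / 4 > 0" by simp
    obtain N0 where N0: "\<And>n. n \<ge> N0 \<Longrightarrow> \<E> (\<lambda>x. w n x - u x) < e\<^sup>2 / 4"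
      using order_tendstoD(2)[OF lE e4] by (auto simp: eventually_sequentially)
    have "norm (Y m - Y n) < e" if mn: "m \<ge> N0" "n \<ge> N0" for m n
    proof -
      have dC: "(\<lambda>x. w m x - w n x) \<in> Ccore F" by (intro Core_diff w)
      have "Y m - Y n = \<iota> [(\<lambda>x. complex_of_real (w m x - w n x), \<lambda>x. complex_of_real (b0 x))]"
        unfolding Y_def using iota_diff_left[OF cwC cwC b0C] by (simp add: cw_def)
      then have "(norm (Y m - Y n))\<^sup>2 = (\<integral>x. (b0 x)\<^sup>2 * gam M E F (\<lambda>x. w m x - w n x) x \<partial>M)"
        using norm_iota_real(2)[OF dC b0C] by (simp del: of_real_diff)
      also have "\<dots> \<le> (\<integral>x. gam M E F (\<lambda>x. w m x - w n x) x \<partial>M)"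
      proof (rule integral_mono)
        show gd: "integrable M (gam M E F (\<lambda>x. w m x - w n x))" by (rule gam_integrable[OF Core_F[OF dC]])
        show "integrable M (\<lambda>x. (b0 x)\<^sup>2 * gam M E F (\<lambda>x. w m x - w n x) x)"
          by (rule mulgi[OF gd, of _ 1]) (use b0b in \<open>auto simp: abs_square_le_1\<close>)
        show "(b0 x)\<^sup>2 * gam M E F (\<lambda>x. w m x - w n x) x \<le> gam M E F (\<lambda>x. w m x - w n x) x" for x
          using b0b[of x] gam_nonneg[OF Core_F[OF dC]] by (intro mult_left_le_one_le) (auto simp: abs_square_le_1)
      qed
      also have "\<dots> = \<E> (\<lambda>x. w m x - w n x)" by (rule gam_integral[OF dC])
      also have "\<dots> < e\<^sup>2" using E_diff_le[OF wF[of m] wF[of n] u] N0[OF mn(1)] N0[OF mn(2)] by linarith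
      finally show ?thesis using e by (simp add: power_less_imp_less_base)
    qed
    then show "\<exists>N. \<forall>m\<ge>N. \<forall>n\<ge>N. norm (Y m - Y n) < e" by blast
  qed
  then obtain y where y: "Y \<longlonglongrightarrow> y" using Cauchy_convergent convergent_def by blast
  have lX: "X \<longlonglongrightarrow> y" using tendsto_add[OF XY y] by simp
  have XE: "(norm (X m - X n))\<^sup>2 = \<E> (\<lambda>x. v m x - v n x)" for m n
    unfolding Xv[symmetric] using norm_iota_one_diff[OF cvC cvC] by (simp add: cv_def)
  have "(\<lambda>n. \<E> (\<lambda>x. v n x - (\<lambda>_. 0) x)) \<longlonglongrightarrow> 0"
  proof (rule closed_form(2)[OF Core_F[OF vC] F_L2[OF F_zero]])
    fix e :: real assume e: "e > 0"
    then have "sqrt e > 0" by simp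
    then obtain N0 where N0: "\<And>m n. m \<ge> N0 \<Longrightarrow> n \<ge> N0 \<Longrightarrow> norm (X m - X n) < sqrt e"
      using LIMSEQ_imp_Cauchy[OF lX] by (meson CauchyD)
    have "\<E> (\<lambda>x. v m x - v n x) < e" if "m \<ge> N0" "n \<ge> N0" for m n
      using power_strict_mono[OF N0[OF that], of 2] e by (simp add: XE)
    then show "\<exists>N. \<forall>m\<ge>N. \<forall>n\<ge>N. \<E> (\<lambda>x. v m x - v n x) < e" by blast
  qed (use vL in auto)
  then have lv: "(\<lambda>n. \<E> (v n)) \<longlonglongrightarrow> 0" by simp
  have "(norm (X n))\<^sup>2 = \<E> (v n)" for n
    unfolding Xv[symmetric] using norm_iota_one[OF cvC] by (simp add: cv_def)
  then have "(\<lambda>n. (norm (X n))\<^sup>2) \<longlonglongrightarrow> 0" using lv by simp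
  moreover have "(\<lambda>n. (norm (X n))\<^sup>2) \<longlonglongrightarrow> (norm y)\<^sup>2" by (intro tendsto_intros lX)
  ultimately have "y = 0" using LIMSEQ_unique by fastforce
  then have "(\<lambda>n. (norm (Y n))\<^sup>2) \<longlonglongrightarrow> 0" using tendsto_power[OF tendsto_norm[OF y], of 2] by simp
  moreover have "(norm (Y n))\<^sup>2 = (\<integral>x. b0 x * gam M E F (w n) x \<partial>M)" for n
  proof -
    have "(b0 x)\<^sup>2 = b0 x" for x by (simp add: b0_def indicator_def)
    then show ?thesis unfolding Y_def cw_def using norm_iota_real(2)[OF w b0C] by simp
  qed
  ultimately have lY: "(\<lambda>n. \<integral>x. b0 x * gam M E F (w n) x \<partial>M) \<longlonglongrightarrow> 0" by simp
  have bi: "integrable M (\<lambda>x. b0 x * gam M E F u x)" "integrable M (\<lambda>x. b0 x * gam M E F (w n) x)" for n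
    by (rule mulgi[OF _ b0m b0b], rule gi gwi)+
  have le: "(\<integral>x. b0 x * gam M E F u x \<partial>M) \<le> (\<integral>x. b0 x * gam M E F (w n) x \<partial>M)
      + (\<integral>x. \<bar>gam M E F (w n) x - gam M E F u x\<bar> \<partial>M)" for n
  proof -
    have "(\<integral>x. b0 x * gam M E F u x \<partial>M) \<le> (\<integral>x. b0 x * gam M E F (w n) x + \<bar>gam M E F (w n) x - gam M E F u x\<bar> \<partial>M)"
      by (rule integral_mono) (use bi gi gwi in \<open>auto simp: b0_def indicator_def\<close>)
    then show ?thesis using bi gi gwi by simp
  qed
  have "(\<integral>x. b0 x * gam M E F u x \<partial>M) \<le> 0"
    by (rule LIMSEQ_le_const[OF tendsto_add_zero[OF lY lg]]) (use le in blast)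
  moreover have "0 \<le> b0 x * gam M E F u x" for x using gam_nonneg[OF u] by (simp add: b0_def)
  ultimately have "AE x in M. b0 x * gam M E F u x = 0"
    using integral_nonneg_eq_0_iff_AE[OF bi(1)] Bochner_Integration.integral_nonneg[of M "\<lambda>x. b0 x * gam M E F u x"]
    by (simp add: antisym)
  then show ?thesis by eventually_elim (auto simp: b0_def)
qed

text \<open>The difference u = g - a vanishes on K, hence so does its density there. The L1 bound is
  available for core functions only, so g is replaced by approximants w n: 2 c |\<Gamma>(w n) -
  \<Gamma>(a)| \<le> \<Gamma>(w n - a) + c^2 \<Gamma>(w n + a). Integrated over K, the first term on
  the right disappears in the limit, and what remains is at most c^2 B. Division by c and c
  \<rightarrow> 0 finish the argument.\<close>

lemma gam_eq_on_compact:
  assumes a: "a \<in> Ccore F" and g: "g \<in> F" and K: "compact K" and eq: "AE x in M. x \<in> K \<longrightarrow> a x = g x"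
  shows "AE x in M. x \<in> K \<longrightarrow> gam M E F g x = gam M E F a x"
proof -
  have [measurable]: "K \<in> sets M" using compact_imp_closed[OF K] by (simp add: sets_M)
  have aF: "a \<in> F" by (rule Core_F[OF a])
  define u where "u = (\<lambda>x. g x - a x)"
  have u: "u \<in> F" unfolding u_def by (intro F_diff g aF)
  have uz: "AE x in M. indicator K x * gam M E F u x = 0"
    using gam_zero_set[OF u] eq by eventually_elim (auto simp: u_def indicator_def)
  obtain w where w: "\<And>n::nat. w n \<in> Ccore F" "\<And>n. \<E> (\<lambda>x. w n x - g x) < inverse (real (Suc n))"
    by (rule Core_approximation[where e = "\<lambda>n. inverse (real (Suc n))", OF g]) (simp, blast)
  have wF: "w n \<in> F" for n by (rule Core_F[OF w(1)])
  have lE: "(\<lambda>n. \<E> (\<lambda>x. w n x - g x)) \<longlonglongrightarrow> 0"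
    by (rule tendsto_sandwich[OF always_eventually always_eventually tendsto_const LIMSEQ_inverse_real_of_nat])
       (use E_nonneg F_diff wF g less_imp_le[OF w(2)] in auto)
  have waC: "(\<lambda>x. w n x - a x) \<in> Ccore F" "(\<lambda>x. w n x + a x) \<in> Ccore F" for n by (intro Core_closed w(1) a)+
  define e where "e = (\<lambda>n. \<integral>x. \<bar>gam M E F (w n) x - gam M E F g x\<bar> \<partial>M)"
  define d where "d = (\<lambda>n. \<integral>x. \<bar>gam M E F (\<lambda>x. w n x - a x) x - gam M E F u x\<bar> \<partial>M)"
  have le: "e \<longlonglongrightarrow> 0" unfolding e_def by (rule gam_L1_tendsto[OF g w(1) lE])
  have ld: "d \<longlonglongrightarrow> 0" unfolding d_def
    by (rule gam_L1_tendsto[OF u waC(1)]) (use lE in \<open>simp add: u_def\<close>)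
  obtain B0 where B0: "\<forall>n. norm (\<E> (w n)) \<le> B0"
    using E_tendsto_diag[OF wF g lE, THEN convergentI, THEN convergent_imp_Bseq] by (auto simp: Bseq_def)
  define B where "B = 2 * B0 + 2 * E a a"
  have B: "\<E> (\<lambda>x. w n x + a x) \<le> B" for n
    using E_add_le[OF wF[of n] aF] B0[rule_format, of n] unfolding B_def by simp
  have gi: "integrable M (gam M E F g)" "integrable M (gam M E F a)" "integrable M (gam M E F u)"
    "\<And>n. integrable M (gam M E F (w n))" "\<And>n. integrable M (gam M E F (\<lambda>x. w n x - a x))"
    "\<And>n. integrable M (gam M E F (\<lambda>x. w n x + a x))"
    using gam_integrable g aF u wF Core_F[OF waC(1)] Core_F[OF waC(2)] by auto
  have ind: "integrable M (\<lambda>x. indicator K x * f x)" if "integrable M f" for f :: "'a \<Rightarrow> real"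
    using integrable_mult_indicator[OF _ that, of K] by simp
  define I where "I = (\<integral>x. indicator K x * \<bar>gam M E F g x - gam M E F a x\<bar> \<partial>M)"
  have bound: "2 * c * I \<le> 2 * c * e n + d n + c\<^sup>2 * B" if c: "c > 0" for c n
  proof -
    have "2 * c * I = (\<integral>x. 2 * c * (indicator K x * \<bar>gam M E F g x - gam M E F a x\<bar>) \<partial>M)" by (simp add: I_def)
    also have "\<dots> \<le> (\<integral>x. 2 * c * \<bar>gam M E F (w n) x - gam M E F g x\<bar>
        + \<bar>gam M E F (\<lambda>x. w n x - a x) x - gam M E F u x\<bar> + c\<^sup>2 * gam M E F (\<lambda>x. w n x + a x) x \<partial>M)"
    proof (rule integral_mono_AE)
      show "integrable M (\<lambda>x. 2 * c * (indicator K x * \<bar>gam M E F g x - gam M E F a x\<bar>))"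
        using ind gi by (intro integrable_mult_right) auto
      show "integrable M (\<lambda>x. 2 * c * \<bar>gam M E F (w n) x - gam M E F g x\<bar>
        + \<bar>gam M E F (\<lambda>x. w n x - a x) x - gam M E F u x\<bar> + c\<^sup>2 * gam M E F (\<lambda>x. w n x + a x) x)"
        using gi by auto
      show "AE x in M. 2 * c * (indicator K x * \<bar>gam M E F g x - gam M E F a x\<bar>)
          \<le> 2 * c * \<bar>gam M E F (w n) x - gam M E F g x\<bar>
        + \<bar>gam M E F (\<lambda>x. w n x - a x) x - gam M E F u x\<bar> + c\<^sup>2 * gam M E F (\<lambda>x. w n x + a x) x"
        using uz dens_C_L1_bound[OF w(1)[of n] gam_dens_C[OF w(1)[of n]] a gam_dens_C[OF a] c
            gam_dens_C[OF waC(1)[of n]] gam_dens_C[OF waC(2)[of n]]]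
      proof eventually_elim
        case (elim x)
        have nn: "0 \<le> c\<^sup>2 * gam M E F (\<lambda>x. w n x + a x) x" using gam_nonneg[OF Core_F[OF waC(2)[of n]]] by simp
        show ?case
        proof (cases "x \<in> K")
          case True
          then have "gam M E F u x = 0" using elim by simp
          moreover have "2 * c * \<bar>gam M E F g x - gam M E F a x\<bar>
              \<le> 2 * c * (\<bar>gam M E F (w n) x - gam M E F g x\<bar> + \<bar>gam M E F (w n) x - gam M E F a x\<bar>)"
            using c by (intro mult_left_mono) auto
          ultimately show ?thesis using elim(2) True by (simp add: distrib_left)
        qed (use nn c in auto)
      qed
    qed
    also have "\<dots> = 2 * c * e n + d n + c\<^sup>2 * \<E> (\<lambda>x. w n x + a x)"
      unfolding e_def d_def gam_integral[OF waC(2), symmetric] using gi by simp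
    also have "\<dots> \<le> 2 * c * e n + d n + c\<^sup>2 * B" using B[of n] by (simp add: mult_left_mono)
    finally show ?thesis .
  qed
  have small: "2 * I \<le> c * B" if c: "c > 0" for c
  proof -
    have "(\<lambda>n. 2 * c * e n + d n + c\<^sup>2 * B) \<longlonglongrightarrow> 2 * c * 0 + 0 + c\<^sup>2 * B" by (intro tendsto_intros le ld)
    then have "2 * c * I \<le> 2 * c * 0 + 0 + c\<^sup>2 * B" by (rule LIMSEQ_le_const) (use bound[OF c] in blast)
    then have "c * (2 * I) \<le> c * (c * B)" by (simp add: power2_eq_square)
    then show ?thesis using c by simp
  qed
  have "I \<le> 0"
  proof (rule ccontr)
    assume I: "\<not> I \<le> 0"
    have B0: "B \<ge> 0" using order_trans[OF E_nonneg[OF Core_F[OF waC(2)[of 0]]] B[of 0]] .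
    \<comment> \<open>With c = I / (B + 1) the estimate would give 2 I \<le> I B / (B + 1),
      impossible for positive I.\<close>
    have "B * I + I * 2 \<le> 0" using small[of "I / (B + 1)"] I B0 by (simp add: field_simps)
    moreover have "B * I \<ge> 0" using I B0 by (intro mult_nonneg_nonneg) auto
    ultimately show False using I by linarith
  qed
  moreover have nn: "0 \<le> indicator K x * \<bar>gam M E F g x - gam M E F a x\<bar>" for x by simp
  moreover have "I \<ge> 0" unfolding I_def by (intro Bochner_Integration.integral_nonneg nn)
  moreover have "integrable M (\<lambda>x. indicator K x * \<bar>gam M E F g x - gam M E F a x\<bar>)" using ind gi by auto
  ultimately have "AE x in M. indicator K x * \<bar>gam M E F g x - gam M E F a x\<bar> = 0"
    using integral_nonneg_eq_0_iff_AE[of M "\<lambda>x. indicator K x * \<bar>gam M E F g x - gam M E F a x\<bar>"]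
    unfolding I_def by (auto intro: antisym)
  then show ?thesis by eventually_elim auto
qed

section \<open>The two distances\<close>

text \<open>A density bounded by 1 already gives membership in \<open>A0\<close>, so the two
  conditions in the definition merge into one.\<close>

lemma d_D_alt:
  "d_D M E F \<iota> x y = Sup {ereal (a x - a y) | a. a \<in> Ccore F \<and> (AE x in M. gam M E F a x \<le> 1)}"
proof -
  have "(\<lambda>z. complex_of_real (a z)) \<in> A0 M E F" if a: "a \<in> Ccore F" "AE x in M. gam M E F a x \<le> 1" for a
  proof -
    have "AE x in M. cmod (gamc M E F (\<lambda>z. complex_of_real (a z)) (\<lambda>z. complex_of_real (a z)) x) \<le> 1"
      using a(2) gam2_diag[OF a(1)] gam2_zero[OF Core_zero] gam2_zero[OF a(1)] gam2_sym[OF a(1) Core_zero]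
      by eventually_elim (use gam_nonneg[OF Core_F[OF a(1)]] in \<open>auto simp: gamc_def\<close>)
    then show ?thesis using a(1) by (auto simp: A0_def Cc_of_real)
  qed
  then have "((\<lambda>z. complex_of_real (a z)) \<in> A0 M E F \<and> comm_norm_le1 M E F \<iota> (\<lambda>z. complex_of_real (a z)))
      \<longleftrightarrow> a \<in> Ccore F \<and> (AE x in M. gam M E F a x \<le> 1)" for a
    using comm_norm_le1I[of a] comm_norm_le1D[of a] by (auto simp: A0_def Cc_of_real)
  then show ?thesis unfolding d_D_def by simp
qed

text \<open>Makes the class of admissible functions symmetric, which yields the absolute value in
  \<open>d_D_ge\<close> and with it symmetry and the triangle inequality.\<close>

lemma gam_minus:
  assumes a: "a \<in> Ccore F"
  shows "AE x in M. gam M E F (\<lambda>x. - a x) x = gam M E F a x"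
proof -
  have "AE x in M. (\<Sum>(c, f, \<gamma>)\<leftarrow>[(1, \<lambda>x. - 1 * a x, gam M E F (\<lambda>x. - 1 * a x)), (-1, a, gam M E F a)]. c * \<gamma> x) = 0"
  proof (rule dens_C_combination)
    fix \<phi> assume "\<phi> \<in> Ccore F"
    then show "(\<Sum>(c, f, \<gamma>)\<leftarrow>[(1, \<lambda>x. - 1 * a x, gam M E F (\<lambda>x. - 1 * a x)), (-1, a, gam M E F a)]. c * wgam \<phi> f f) = 0"
      using wgam_scale[of \<phi> a "\<lambda>x. - 1 * a x" "-1"] wgam_scale_right[of \<phi> a a "-1"] a Core_scale[OF a, of "-1"] by simp
  qed (use gam_dens_C[OF a] gam_dens_C[OF Core_scale[OF a, of "-1"]] in auto)
  then show ?thesis by eventually_elim simp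
qed

lemma d_D_ge:
  assumes "a \<in> Ccore F" "AE x in M. gam M E F a x \<le> 1"
  shows "ereal \<bar>a x - a y\<bar> \<le> d_D M E F \<iota> x y"
proof -
  have m: "(\<lambda>x. - a x) \<in> Ccore F" "AE x in M. gam M E F (\<lambda>x. - a x) x \<le> 1"
    using Core_minus[OF assms(1)] gam_minus[OF assms(1)] assms(2) by (auto elim: AE_mp)
  have "ereal (a x - a y) \<le> d_D M E F \<iota> x y" unfolding d_D_alt using assms by (intro Sup_upper) blast
  moreover have "ereal (- a x - - a y) \<le> d_D M E F \<iota> x y"
    unfolding d_D_alt using m by (intro Sup_upper CollectI exI[of _ "\<lambda>x. - a x"]) auto
  ultimately show ?thesis by (cases "a x - a y \<ge> 0") auto
qed

lemma d_D_le:
  assumes "\<And>a. a \<in> Ccore F \<Longrightarrow> AE x in M. gam M E F a x \<le> 1 \<Longrightarrow> ereal (a x - a y) \<le> c"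
  shows "d_D M E F \<iota> x y \<le> c"
  unfolding d_D_alt by (intro Sup_least) (use assms in blast)

text \<open>Separation is where the coordinate sequence enters. Its members are complex while the
  distance uses real functions; but \<Gamma>(f) is the sum of the densities of real and imaginary
  part, so each part is admissible, and one of them separates the two points.\<close>

lemma wide_metric_d_D:
  assumes "coordinate_sequence M E F fs" "point_separating fs"
  shows "wide_metric (d_D M E F \<iota>)"
proof -
  have nonneg: "0 \<le> d_D M E F \<iota> x y" for x y
  proof -
    have "AE x in M. gam M E F (\<lambda>_. 0) x \<le> 1" using gam_zero by eventually_elim simp
    from d_D_ge[OF Core_zero this, of x y] show ?thesis by (simp add: zero_ereal_def)
  qed
  have refl: "d_D M E F \<iota> x x = 0" for x
    by (intro antisym nonneg d_D_le) simp
  have sym: "d_D M E F \<iota> x y \<le> d_D M E F \<iota> y x" for x y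
  proof (rule d_D_le)
    fix a assume a: "a \<in> Ccore F" "AE x in M. gam M E F a x \<le> 1"
    have "ereal (a x - a y) \<le> ereal \<bar>a y - a x\<bar>" by simp
    also have "\<dots> \<le> d_D M E F \<iota> y x" by (rule d_D_ge[OF a])
    finally show "ereal (a x - a y) \<le> d_D M E F \<iota> y x" .
  qed
  have tri: "d_D M E F \<iota> x z \<le> d_D M E F \<iota> x y + d_D M E F \<iota> y z" for x y z
  proof (rule d_D_le)
    fix a assume a: "a \<in> Ccore F" "AE x in M. gam M E F a x \<le> 1"
    have "ereal (a x - a z) \<le> ereal \<bar>a x - a y\<bar> + ereal \<bar>a y - a z\<bar>" by simp
    also have "\<dots> \<le> d_D M E F \<iota> x y + d_D M E F \<iota> y z" by (intro add_mono d_D_ge[OF a])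
    finally show "ereal (a x - a z) \<le> d_D M E F \<iota> x y + d_D M E F \<iota> y z" .
  qed
  have sep: "d_D M E F \<iota> x y \<noteq> 0" if xy: "x \<noteq> y" for x y
  proof -
    obtain n where n: "fs n x \<noteq> fs n y" using assms(2) xy unfolding point_separating_def by blast
    have f: "fs n \<in> Cc F" "AE x in M. Re (gamc M E F (fs n) (fs n) x) \<le> 1"
      using assms(1) unfolding coordinate_sequence_def gam_le_mu_def by auto
    have g: "AE x in M. gam M E F (\<lambda>x. Re (fs n x)) x \<le> 1 \<and> gam M E F (\<lambda>x. Im (fs n x)) x \<le> 1"
      using f(2) gam2_diag[OF CcD(1)[OF f(1)]] gam2_diag[OF CcD(2)[OF f(1)]]
    proof eventually_elim
      case (elim x)
      then show ?case
        using gam_nonneg[OF Core_F[OF CcD(1)[OF f(1)]], of x] gam_nonneg[OF Core_F[OF CcD(2)[OF f(1)]], of x]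
        by (simp add: gamc_def)
    qed
    have "ereal \<bar>Re (fs n x) - Re (fs n y)\<bar> \<le> d_D M E F \<iota> x y" "ereal \<bar>Im (fs n x) - Im (fs n y)\<bar> \<le> d_D M E F \<iota> x y"
      by (rule d_D_ge[OF CcD(1)[OF f(1)]] d_D_ge[OF CcD(2)[OF f(1)]], use g in \<open>auto elim: AE_mp\<close>)+
    moreover have "Re (fs n x) \<noteq> Re (fs n y) \<or> Im (fs n x) \<noteq> Im (fs n y)" using n by (auto simp: complex_eq_iff)
    ultimately show ?thesis by (auto simp: zero_ereal_def)
  qed
  show ?thesis
    unfolding wide_metric_def using nonneg refl sym tri sep by (metis antisym)
qed

text \<open>A core function is its own local representative. The local condition, however, speaks of
  every g in F that agrees with it on some compact set, and locality carries the bound over to all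
  of these.\<close>

lemma d_D_le_d_Gamma: "d_D M E F \<iota> x y \<le> d_Gamma M E F x y"
proof (rule d_D_le)
  fix a assume a: "a \<in> Ccore F" "AE x in M. gam M E F a x \<le> 1"
  have "Floc M F a" unfolding Floc_def using Core_F[OF a(1)] by (auto intro!: bexI[of _ a])
  moreover have "gam_loc_le_mu M E F a"
    unfolding gam_loc_le_mu_def
  proof (intro allI impI, elim conjE)
    fix K g assume "compact K" "g \<in> F" "AE x in M. x \<in> K \<longrightarrow> a x = g x"
    from gam_eq_on_compact[OF a(1) this(2,1,3)] a(2)
    show "AE x in M. x \<in> K \<longrightarrow> gam M E F g x \<le> 1" by eventually_elim auto
  qed
  ultimately show "ereal (a x - a y) \<le> d_Gamma M E F x y"
    unfolding d_Gamma_def using Core_cont[OF a(1)] by (intro Sup_upper) blast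
qed

text \<open>When X is compact the choice K = X makes the local conditions global: f agrees almost
  everywhere with an element of F, hence lies in F, and its support is automatically
  compact.\<close>

lemma d_Gamma_le_d_D:
  assumes "compact (UNIV :: 'a set)"
  shows "d_Gamma M E F x y \<le> d_D M E F \<iota> x y"
  unfolding d_Gamma_def
proof (rule Sup_least, clarify)
  fix f assume f: "continuous_on UNIV f" "Floc M F f" "gam_loc_le_mu M E F f"
  obtain g where g: "g \<in> F" "AE x in M. f x = g x" using f(2) assms unfolding Floc_def by auto
  have "f \<in> borel_measurable borel" by (rule borel_measurable_continuous_onI[OF f(1)])
  then have fm: "f \<in> borel_measurable M" by (simp cong: measurable_cong_sets add: sets_M)
  have fF: "f \<in> F" by (rule F_cong_AE[OF g(1) fm]) (use g(2) in \<open>auto elim: AE_mp\<close>)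
  have "compact_support f"
    unfolding compact_support_def by (metis assms closed_closure compact_Int_closed inf_top_left)
  then have fC: "f \<in> Ccore F" using fF f(1) by (simp add: Ccore_def)
  have "AE x in M. gam M E F f x \<le> 1"
    using f(3)[unfolded gam_loc_le_mu_def, rule_format, of UNIV f] assms fF by simp
  from order_trans[OF _ d_D_ge[OF fC this, of x y]] show "ereal (f x - f y) \<le> d_D M E F \<iota> x y" by simp
qed

end

theorem theorem5p4:
  fixes M :: "'a::{metric_space,second_countable_topology} measure"
    and E :: "('a \<Rightarrow> real) \<Rightarrow> ('a \<Rightarrow> real) \<Rightarrow> real"
    and F :: "('a \<Rightarrow> real) set"
    and \<iota> :: "(('a \<Rightarrow> complex) \<times> ('a \<Rightarrow> complex)) list \<Rightarrow> 'h::{real_inner,complete_space}"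
  assumes "locally_compact_space (euclidean :: 'a topology)"
    and "radon_full_support M"
    and "sym_dirichlet_form M E F"
    and "regular_form M E F"
    and "strongly_local M E F"
    and "energy_dominant M E F"
    and "\<exists>fs. coordinate_sequence M E F fs \<and> point_separating fs"
    and "hilbert_rep M E F \<iota>"
  shows "wide_metric (d_D M E F \<iota>)
    \<and> (\<forall>x y. d_D M E F \<iota> x y \<le> d_Gamma M E F x y)
    \<and> (compact (UNIV :: 'a set) \<longrightarrow> d_D M E F \<iota> = d_Gamma M E F)"
proof -
  interpret hilbert_dirichlet M E F \<iota>
    by unfold_locales (fact assms)+
  obtain fs where "coordinate_sequence M E F fs" "point_separating fs" using assms(7) by blast
  then have "wide_metric (d_D M E F \<iota>)" by (rule wide_metric_d_D)
  moreover have "d_D M E F \<iota> = d_Gamma M E F" if "compact (UNIV :: 'a set)"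
    using d_D_le_d_Gamma d_Gamma_le_d_D[OF that] by (intro ext antisym)
  ultimately show ?thesis using d_D_le_d_Gamma by blast
qed

end
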